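(* There exists a universal constant $c>0$ such that for every $n\ge1$ and all increasing functions $f,g:\mathbb{R}^n\to[0,1]$, $$ \mathrm{Cor}(f,g)\ \ge\ c\,\min\left(\frac{\mathcal{M}_1(f,g)}{\sqrt{\log\left(\frac{e}{\mathcal{M}_1(f,g)}\right)}},\ \frac{\mathcal{M}_1(f,g)^2}{|\mathcal{M}_2(f,g)|}\right), $$ where $$ \mathcal{M}_1(f,g)=\langle \mathcal{M}_1(f),\mathcal{M}_1(g)\rangle,\qquad \mathcal{M}_2(f,g)=\langle \mathcal{M}_2(f),\mathcal{M}_2(g)\rangle_{HS}. $$
   Context: Let $\gamma$ be the standard Gaussian measure on $\mathbb{R}^n$ and $\mathrm{I}_n$ the $n\times n$ identity matrix. A function $f:\mathbb{R}^n\to\mathbb{R}$ is increasing if for each $i$ it is non-decreasing in the $i$-th coordinate when the other coordinates are kept fixed. Define the first and second degree Hermite tensors $$\mathcal{M}_1(f)=\int x f(x)\,d\gamma(x)\in\mathbb{R}^n,\qquad \mathcal{M}_2(f)=\int (x^{\otimes 2}-\mathrm{I}_n)f(x)\,d\gamma(x)\in\mathbb{R}^{n\times n},$$ where $x^{\otimes 2}=xx^{T}$, and $\langle A,B\rangle_{HS}=\sum_{i,j}A_{i,j}B_{i,j}$. The correlation is $\mathrm{Cor}(f,g)=\int fg\,d\gamma-\left(\int f\,d\gamma\right)\left(\int g\,d\gamma\right)$. Here $\log$ is the natural logarithm. Conventions: the right-hand side is $0$ if $\mathcal{M}_1(f,g)=0$; if $\mathcal{M}_1(f,g)>0$ and $\mathcal{M}_2(f,g)=0$,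 the second term of the minimum is $+\infty$. The constant $c$ does not depend on $n,f,g$. *)

theory Defs
  imports "HOL-Probability.Probability"
begin

text \<open>Points of \<open>\<real>\<^sup>n\<close> are the extensional functions on \<open>{..<n}\<close>, so that the dimension is an
  ordinary natural number and can be quantified after a constant.\<close>

abbreviation Rn :: "nat \<Rightarrow> (nat \<Rightarrow> real) set" where
  "Rn n \<equiv> {..<n} \<rightarrow>\<^sub>E UNIV"

text \<open>The completion matters: a monotone function on \<open>\<real>\<^sup>n\<close> with \<open>n \<ge> 2\<close> need not be Borel
  measurable (it is arbitrary along an antichain), but it is measurable with respect to the
  completed measure. On the uncompleted product its Bochner integral could be the default
  value 0.\<close>

definition std_gaussian :: "nat \<Rightarrow> (nat \<Rightarrow> real) measure" where
  "std_gaussian n =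
     completion (PiM {..<n} (\<lambda>_. density lborel (\<lambda>t. ennreal (std_normal_density t))))"

lemma space_std_gaussian: "space (std_gaussian n) = Rn n"
  by (simp add: std_gaussian_def space_PiM)

definition increasing_Rn :: "nat \<Rightarrow> ((nat \<Rightarrow> real) \<Rightarrow> real) \<Rightarrow> bool" where
  "increasing_Rn n f \<longleftrightarrow> (\<forall>x\<in>Rn n. \<forall>i<n. \<forall>t\<ge>x i. f x \<le> f (x(i := t)))"

definition hermite1 :: "nat \<Rightarrow> ((nat \<Rightarrow> real) \<Rightarrow> real) \<Rightarrow> nat \<Rightarrow> real" where
  "hermite1 n f i = (\<integral>x. x i * f x \<partial>std_gaussian n)"

definition hermite2 :: "nat \<Rightarrow> ((nat \<Rightarrow> real) \<Rightarrow> real) \<Rightarrow> nat \<Rightarrow> nat \<Rightarrow> real" where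
  "hermite2 n f i j = (\<integral>x. (x i * x j - (if i = j then 1 else 0)) * f x \<partial>std_gaussian n)"

definition hermite1_inner ::
  "nat \<Rightarrow> ((nat \<Rightarrow> real) \<Rightarrow> real) \<Rightarrow> ((nat \<Rightarrow> real) \<Rightarrow> real) \<Rightarrow> real" where
  "hermite1_inner n f g = (\<Sum>i<n. hermite1 n f i * hermite1 n g i)"

definition hermite2_inner ::
  "nat \<Rightarrow> ((nat \<Rightarrow> real) \<Rightarrow> real) \<Rightarrow> ((nat \<Rightarrow> real) \<Rightarrow> real) \<Rightarrow> real" where
  "hermite2_inner n f g = (\<Sum>i<n. \<Sum>j<n. hermite2 n f i j * hermite2 n g i j)"

definition Cor ::
  "nat \<Rightarrow> ((nat \<Rightarrow> real) \<Rightarrow> real) \<Rightarrow> ((nat \<Rightarrow> real) \<Rightarrow> real) \<Rightarrow> real" where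
  "Cor n f g = (\<integral>x. f x * g x \<partial>std_gaussian n)
     - (\<integral>x. f x \<partial>std_gaussian n) * (\<integral>x. g x \<partial>std_gaussian n)"

text \<open>The conventions for vanishing arguments are explicit. For the increasing \<open>[0,1]\<close>-valued
  functions considered here, \<open>m1 = hermite1_inner n f g\<close> satisfies \<open>0 \<le> m1 \<le> 1 / (2 * pi)\<close>, so
  the logarithm is at least 1 whenever \<open>m1 \<noteq> 0\<close>.\<close>

definition cor_bound :: "real \<Rightarrow> real \<Rightarrow> ereal" where
  "cor_bound m1 m2 =
     (if m1 = 0 then 0
      else min (ereal (m1 / sqrt (ln (exp 1 / m1))))
               (if m2 = 0 then \<infinity> else ereal (m1\<^sup>2 / \<bar>m2\<bar>)))"

end

theory Submission imports Defs begin

text \<open>Let \<open>F s\<close> be the expectation of \<open>f X * g Y\<close> for standard Gaussian vectors \<open>X\<close> and \<open>Y\<close> with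
  correlation \<open>s\<close>. Then \<open>F 0\<close> is the product of the two means, the first two derivatives of \<open>F\<close> at \<open>0\<close>
  are the Hermite inner products \<open>m1\<close> and \<open>m2\<close>, and \<open>F s\<close> is at most the mean of \<open>f * g\<close> by Harris'
  inequality. It therefore suffices that \<open>F'\<close> remains of order \<open>m1\<close> on an interval of length
  \<open>min (1 / sqrt (ln (e / m1))) (m1 / \<bar>m2\<bar>)\<close>, up to constants.

  Up to a time change \<open>F'\<close> is the same form summed over pairs of nonnegative functions \<open>h\<^sub>i\<close>, \<open>k\<^sub>i\<close>, the
  smoothed partial derivatives of \<open>f\<close> and \<open>g\<close>, whose squares sum to at most \<open>1\<close>. The second derivative
  of such a form at \<open>0\<close> is the inner product of the centred second moment matrices of the two weights,
  which is bounded below by their relative entropies, with no loss in the dimension. Shifting the base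
  point by the semigroup property gives the differential inequality \<open>V'' \<ge> 8 * V * ln V\<close> for
  \<open>V = F'\<close> (up to scaling), and this keeps \<open>V\<close> above half of its initial value for the required time.\<close>

section \<open>Gaussian product measures\<close>

text \<open>The bound on the second derivative has to be one-sided and linear in the logarithm.
  Estimating the two second moment matrices separately and combining them by Cauchy-Schwarz gives a
  product of two logarithms, the order attained by half-spaces, and with it a time interval of order
  \<open>1 / ln (e / m1)\<close> only. A bound \<open>V'' \<ge> - C * V * ln (1 / V)\<close>,
  integrated twice, costs a fixed proportion of \<open>V\<close> only after a time of order
  \<open>1 / sqrt (ln (1 / V))\<close>: this is the origin of the square root. The initial slope of
  \<open>V\<close> is a multiple of \<open>m2\<close> and has no sign; the time that it needs to do
  damage is the second term of the minimum.

  The entropy estimate controls a pair of weights in terms of their means. It is applied to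
  derivatives rather than to \<open>f\<close> and \<open>g\<close> because the means of the
  derivatives are, up to a factor, the entries of the first Hermite tensors, so that
  \<open>m1\<close> is what the estimate speaks about. Monotonicity makes the derivatives
  nonnegative, hence weights, and gives Harris' inequality.\<close>

definition gauss1 :: "real measure" where
  "gauss1 = density lborel (\<lambda>t. ennreal (std_normal_density t))"

definition gauss :: "nat \<Rightarrow> (nat \<Rightarrow> real) measure" where
  "gauss n = PiM {..<n} (\<lambda>_. gauss1)"

lemma std_gaussian_eq: "std_gaussian n = completion (gauss n)"
  by (simp add: std_gaussian_def gauss_def gauss1_def)

lemma sets_gauss1 [measurable_cong, simp]: "sets gauss1 = sets borel"
  by (simp add: gauss1_def)

lemma space_gauss1 [simp]: "space gauss1 = UNIV"
  by (simp add: gauss1_def)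

lemma prob_space_gauss1: "prob_space gauss1"
  unfolding gauss1_def by (rule prob_space_normal_density) simp

interpretation gauss1: prob_space gauss1
  by (rule prob_space_gauss1)

interpretation gausses: product_prob_space "\<lambda>_. gauss1" UNIV
  by standard

lemma prob_space_gauss: "prob_space (gauss n)"
  unfolding gauss_def by (rule prob_space_PiM) (rule prob_space_gauss1)

interpretation gauss: prob_space "gauss n" for n
  by (rule prob_space_gauss)

interpretation gauss_pair: pair_prob_space "gauss n" "gauss n" for n
  by standard

abbreviation gauss_sq :: "nat \<Rightarrow> ((nat \<Rightarrow> real) \<times> (nat \<Rightarrow> real)) measure" where
  "gauss_sq n \<equiv> gauss n \<Otimes>\<^sub>M gauss n"

lemma space_gauss: "space (gauss n) = Rn n"
  by (simp add: gauss_def space_PiM)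

text \<open>Induction on the index set, peeling off the same coordinate of both vectors. Every
  change of variables in Gaussian space below (rotation, Mehler density, translation) is thereby
  reduced to the planar identity \<open>base\<close>.\<close>

lemma coordinatewise_nn_integral:
  fixes T1 T2 :: "real \<times> real \<Rightarrow> real" and rho :: "real \<times> real \<Rightarrow> ennreal"
  assumes "finite I"
    and [measurable]: "T1 \<in> borel_measurable (borel \<Otimes>\<^sub>M borel)" "T2 \<in> borel_measurable (borel \<Otimes>\<^sub>M borel)"
      "rho \<in> borel_measurable (borel \<Otimes>\<^sub>M borel)"
    and base: "\<And>\<psi>. \<psi> \<in> borel_measurable (borel \<Otimes>\<^sub>M borel) \<Longrightarrow>
      (\<integral>\<^sup>+ a. \<integral>\<^sup>+ b. \<psi> (T1 (a, b), T2 (a, b)) \<partial>gauss1 \<partial>gauss1) = (\<integral>\<^sup>+ a. \<integral>\<^sup>+ b. \<psi> (a, b) * rho (a, b) \<partial>gauss1 \<partial>gauss1)"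
    and "\<Psi> \<in> borel_measurable (PiM I (\<lambda>_. gauss1) \<Otimes>\<^sub>M PiM I (\<lambda>_. gauss1))"
  shows "(\<integral>\<^sup>+ z. \<integral>\<^sup>+ w. \<Psi> (\<lambda>i\<in>I. T1 (z i, w i), \<lambda>i\<in>I. T2 (z i, w i)) \<partial>PiM I (\<lambda>_. gauss1) \<partial>PiM I (\<lambda>_. gauss1)) =
    (\<integral>\<^sup>+ z. \<integral>\<^sup>+ w. \<Psi> (z, w) * (\<Prod>i\<in>I. rho (z i, w i)) \<partial>PiM I (\<lambda>_. gauss1) \<partial>PiM I (\<lambda>_. gauss1))"
  using assms(1,6)
proof (induction I arbitrary: \<Psi>)
  case empty
  then show ?case
    by (simp add: gausses.nn_integral_empty space_PiM restrict_def fun_eq_iff PiM_empty nn_integral_count_space_finite)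
next
  case (insert i I)
  note [simp] = \<open>finite I\<close> \<open>i \<notin> I\<close>
  note [measurable] = insert.prems
  let ?G = "PiM I (\<lambda>_. gauss1)" and ?H = "PiM (insert i I) (\<lambda>_. gauss1)"
  interpret G: prob_space ?G by (rule prob_space_PiM) (rule prob_space_gauss1)
  interpret H: prob_space ?H by (rule prob_space_PiM) (rule prob_space_gauss1)
  interpret P: pair_sigma_finite gauss1 ?G ..
  \<comment> \<open>Tonelli moves \<open>a\<close> past \<open>w\<close>, so that the new pair
    \<open>(a, b)\<close> is innermost and \<open>base\<close> applies to it.\<close>
  have split: "(\<integral>\<^sup>+ z. \<integral>\<^sup>+ w. F z w \<partial>?H \<partial>?H) = (\<integral>\<^sup>+ z. \<integral>\<^sup>+ w. \<integral>\<^sup>+ a. \<integral>\<^sup>+ b. F (z(i := a)) (w(i := b)) \<partial>gauss1 \<partial>gauss1 \<partial>?G \<partial>?G)"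
    if [measurable]: "case_prod F \<in> borel_measurable (?H \<Otimes>\<^sub>M ?H)" for F
  proof -
    have "(\<integral>\<^sup>+ z. \<integral>\<^sup>+ w. F z w \<partial>?H \<partial>?H) = (\<integral>\<^sup>+ z. \<integral>\<^sup>+ a. \<integral>\<^sup>+ w. F (z(i := a)) w \<partial>?H \<partial>gauss1 \<partial>?G)"
      by (subst gausses.product_nn_integral_insert) auto
    also have "\<dots> = (\<integral>\<^sup>+ z. \<integral>\<^sup>+ a. \<integral>\<^sup>+ w. \<integral>\<^sup>+ b. F (z(i := a)) (w(i := b)) \<partial>gauss1 \<partial>?G \<partial>gauss1 \<partial>?G)"
    proof (intro nn_integral_cong)
      fix z a assume "z \<in> space ?G"
      then have "z(i := a) \<in> space ?H"
        by (auto simp: space_PiM PiE_def extensional_def)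
      then have "F (z(i := a)) \<in> borel_measurable ?H"
        using that by (rule measurable_Pair2[of "case_prod F", simplified, rotated]) 
      then show "(\<integral>\<^sup>+ w. F (z(i := a)) w \<partial>?H) = (\<integral>\<^sup>+ w. \<integral>\<^sup>+ b. F (z(i := a)) (w(i := b)) \<partial>gauss1 \<partial>?G)"
        by (subst gausses.product_nn_integral_insert) auto
    qed
    also have "\<dots> = (\<integral>\<^sup>+ z. \<integral>\<^sup>+ w. \<integral>\<^sup>+ a. \<integral>\<^sup>+ b. F (z(i := a)) (w(i := b)) \<partial>gauss1 \<partial>gauss1 \<partial>?G \<partial>?G)"
    proof (intro nn_integral_cong)
      fix z assume z[measurable]: "z \<in> space ?G"
      show "(\<integral>\<^sup>+ a. \<integral>\<^sup>+ w. \<integral>\<^sup>+ b. F (z(i := a)) (w(i := b)) \<partial>gauss1 \<partial>?G \<partial>gauss1)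
        = (\<integral>\<^sup>+ w. \<integral>\<^sup>+ a. \<integral>\<^sup>+ b. F (z(i := a)) (w(i := b)) \<partial>gauss1 \<partial>gauss1 \<partial>?G)"
        by (rule P.Fubini'[symmetric]) measurable
    qed
    finally show ?thesis .
  qed
  have [measurable]: "(\<lambda>(z, w). \<Prod>j\<in>J. rho (z j, w j)) \<in> borel_measurable (PiM J (\<lambda>_. gauss1) \<Otimes>\<^sub>M PiM J (\<lambda>_. gauss1))" for J :: "'a set"
    by measurable
  \<comment> \<open>The new pair is integrated out together with its density; the induction
    hypothesis is used for the remaining function.\<close>
  define \<Psi>' where "\<Psi>' = (\<lambda>(z, w). \<integral>\<^sup>+ a. \<integral>\<^sup>+ b. \<Psi> (z(i := a), w(i := b)) * rho (a, b) \<partial>gauss1 \<partial>gauss1)"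
  have [measurable]: "\<Psi>' \<in> borel_measurable (?G \<Otimes>\<^sub>M ?G)"
    unfolding \<Psi>'_def by measurable
  have "(\<integral>\<^sup>+ z. \<integral>\<^sup>+ w. \<Psi> (\<lambda>j\<in>insert i I. T1 (z j, w j), \<lambda>j\<in>insert i I. T2 (z j, w j)) \<partial>?H \<partial>?H)
    = (\<integral>\<^sup>+ z. \<integral>\<^sup>+ w. \<integral>\<^sup>+ a. \<integral>\<^sup>+ b. \<Psi> ((\<lambda>j\<in>I. T1 (z j, w j))(i := T1 (a, b)), (\<lambda>j\<in>I. T2 (z j, w j))(i := T2 (a, b))) \<partial>gauss1 \<partial>gauss1 \<partial>?G \<partial>?G)"
    apply (subst split)
     apply measurable
    apply (intro nn_integral_cong arg_cong[where f=\<Psi>])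
    apply (auto simp: fun_eq_iff)
    done
  also have "\<dots> = (\<integral>\<^sup>+ z. \<integral>\<^sup>+ w. \<Psi>' (\<lambda>j\<in>I. T1 (z j, w j), \<lambda>j\<in>I. T2 (z j, w j)) \<partial>?G \<partial>?G)"
  proof (intro nn_integral_cong)
    fix z w assume zw: "z \<in> space ?G" "w \<in> space ?G"
    have [measurable]: "(\<lambda>j\<in>I. T1 (z j, w j)) \<in> space ?G" "(\<lambda>j\<in>I. T2 (z j, w j)) \<in> space ?G"
      by (auto simp: space_PiM)
    have "(\<lambda>(a, b). \<Psi> ((\<lambda>j\<in>I. T1 (z j, w j))(i := a), (\<lambda>j\<in>I. T2 (z j, w j))(i := b))) \<in> borel_measurable (borel \<Otimes>\<^sub>M borel)"
      by measurable
    from base[OF this]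
    show "(\<integral>\<^sup>+ a. \<integral>\<^sup>+ b. \<Psi> ((\<lambda>j\<in>I. T1 (z j, w j))(i := T1 (a, b)), (\<lambda>j\<in>I. T2 (z j, w j))(i := T2 (a, b))) \<partial>gauss1 \<partial>gauss1)
      = \<Psi>' (\<lambda>j\<in>I. T1 (z j, w j), \<lambda>j\<in>I. T2 (z j, w j))"
      by (simp add: \<Psi>'_def)
  qed
  also have "\<dots> = (\<integral>\<^sup>+ z. \<integral>\<^sup>+ w. \<Psi>' (z, w) * (\<Prod>i\<in>I. rho (z i, w i)) \<partial>?G \<partial>?G)"
    by (rule insert.IH) measurable
  also have "\<dots> = (\<integral>\<^sup>+ z. \<integral>\<^sup>+ w. \<integral>\<^sup>+ a. \<integral>\<^sup>+ b. \<Psi> (z(i := a), w(i := b)) * (\<Prod>j\<in>insert i I. rho ((z(i := a)) j, (w(i := b)) j)) \<partial>gauss1 \<partial>gauss1 \<partial>?G \<partial>?G)"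
  proof (intro nn_integral_cong)
    fix z w assume zw[measurable]: "z \<in> space ?G" "w \<in> space ?G"
    have e: "(\<Prod>j\<in>insert i I. rho ((z(i := a)) j, (w(i := b)) j)) = rho (a, b) * (\<Prod>j\<in>I. rho (z j, w j))" for a b
      by (auto intro!: arg_cong2[where f="(*)"] prod.cong)
    show "\<Psi>' (z, w) * (\<Prod>i\<in>I. rho (z i, w i)) = (\<integral>\<^sup>+ a. \<integral>\<^sup>+ b. \<Psi> (z(i := a), w(i := b)) * (\<Prod>j\<in>insert i I. rho ((z(i := a)) j, (w(i := b)) j)) \<partial>gauss1 \<partial>gauss1)"
      unfolding e mult.assoc[symmetric] \<Psi>'_def prod.case
      by (simp add: nn_integral_multc)
  qed
  also have "\<dots> = (\<integral>\<^sup>+ z. \<integral>\<^sup>+ w. \<Psi> (z, w) * (\<Prod>i\<in>insert i I. rho (z i, w i)) \<partial>?H \<partial>?H)"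
    by (rule split[symmetric]) (measurable)
  finally show ?case .
qed

text \<open>As an equality of measures the change of variables also serves signed
  integrands.\<close>

lemma coordinatewise_distr:
  fixes T1 T2 :: "real \<times> real \<Rightarrow> real" and rho :: "real \<times> real \<Rightarrow> ennreal"
  assumes [measurable]: "T1 \<in> borel_measurable (borel \<Otimes>\<^sub>M borel)" "T2 \<in> borel_measurable (borel \<Otimes>\<^sub>M borel)"
      "rho \<in> borel_measurable (borel \<Otimes>\<^sub>M borel)"
    and base: "\<And>\<psi>. \<psi> \<in> borel_measurable (borel \<Otimes>\<^sub>M borel) \<Longrightarrow>
      (\<integral>\<^sup>+ a. \<integral>\<^sup>+ b. \<psi> (T1 (a, b), T2 (a, b)) \<partial>gauss1 \<partial>gauss1) = (\<integral>\<^sup>+ a. \<integral>\<^sup>+ b. \<psi> (a, b) * rho (a, b) \<partial>gauss1 \<partial>gauss1)"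
  shows "distr (gauss_sq n) (gauss_sq n) (\<lambda>(z, w). (\<lambda>i\<in>{..<n}. T1 (z i, w i), \<lambda>i\<in>{..<n}. T2 (z i, w i)))
    = density (gauss_sq n) (\<lambda>(z, w). \<Prod>i<n. rho (z i, w i))" (is "distr ?P _ ?T = density _ ?r")
proof (rule measure_eqI)
  have [measurable]: "?T \<in> ?P \<rightarrow>\<^sub>M ?P"
    unfolding gauss_def by measurable
  have [measurable]: "?r \<in> borel_measurable ?P"
    unfolding gauss_def by measurable
  fix A assume "A \<in> sets (distr ?P ?P ?T)"
  then have [measurable]: "A \<in> sets ?P" by simp
  have "emeasure (distr ?P ?P ?T) A = (\<integral>\<^sup>+ p. indicator A (?T p) \<partial>?P)"
    using nn_integral_distr[of ?T ?P ?P "indicator A"] by simp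
  also have "\<dots> = (\<integral>\<^sup>+ z. \<integral>\<^sup>+ w. indicator A (?T (z, w)) \<partial>gauss n \<partial>gauss n)"
    by (rule gauss.nn_integral_fst[symmetric]) measurable
  also have "\<dots> = (\<integral>\<^sup>+ z. \<integral>\<^sup>+ w. indicator A (z, w) * ?r (z, w) \<partial>gauss n \<partial>gauss n)"
    using coordinatewise_nn_integral[OF _ assms, of "{..<n}" "indicator A"]
    by (simp add: gauss_def[symmetric])
  also have "\<dots> = (\<integral>\<^sup>+ p. indicator A p * ?r p \<partial>?P)"
    by (rule gauss.nn_integral_fst) measurable
  also have "\<dots> = emeasure (density ?P ?r) A"
    by (simp add: emeasure_density mult.commute)
  finally show "emeasure (distr ?P ?P ?T) A = emeasure (density ?P ?r) A" .
qed simp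

section \<open>Affine maps and rotations of Gaussian vectors\<close>

lemma nn_integral_gauss1:
  assumes [measurable]: "f \<in> borel_measurable borel"
  shows "(\<integral>\<^sup>+ x. f x \<partial>gauss1) = (\<integral>\<^sup>+ x. ennreal (std_normal_density x) * f x \<partial>lborel)"
  unfolding gauss1_def by (rule nn_integral_density) auto

text \<open>The density of \<open>c * Y + d\<close> relative to the standard Gaussian law of \<open>Y\<close>.\<close>

definition affine_rho :: "real \<Rightarrow> real \<Rightarrow> real \<Rightarrow> real" where
  "affine_rho c d y = exp (y\<^sup>2 / 2 - ((y - d) / c)\<^sup>2 / 2) / \<bar>c\<bar>"

lemma measurable_affine_rho [measurable]: "case_prod (affine_rho c) \<in> borel_measurable (borel \<Otimes>\<^sub>M borel)"
  unfolding affine_rho_def by measurable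

lemma nn_integral_gauss1_affine:
  assumes [measurable]: "f \<in> borel_measurable borel" and c: "c \<noteq> 0"
  shows "(\<integral>\<^sup>+ y. f (c * y + d) \<partial>gauss1) = (\<integral>\<^sup>+ y. f y * ennreal (affine_rho c d y) \<partial>gauss1)"
proof -
  have "(\<integral>\<^sup>+ y. f (c * y + d) \<partial>gauss1) = (\<integral>\<^sup>+ y. ennreal (std_normal_density y) * f (c * y + d) \<partial>lborel)"
    by (rule nn_integral_gauss1) measurable
  also have "\<dots> = ennreal \<bar>1 / c\<bar> * (\<integral>\<^sup>+ x. ennreal (std_normal_density (- d / c + (1 / c) * x)) * f (c * (- d / c + (1 / c) * x) + d) \<partial>lborel)"
    using c by (subst nn_integral_real_affine[where c="1/c" and t="-d/c"]) auto
  also have "\<dots> = (\<integral>\<^sup>+ x. ennreal (std_normal_density x) * (f x * ennreal (affine_rho c d x)) \<partial>lborel)"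
  proof (subst nn_integral_cmult[symmetric], measurable, intro nn_integral_cong)
    fix x
    define q where "q = (x - d) / c"
    have "- d / c + (1 / c) * x = q"
      by (simp add: diff_divide_distrib q_def)
    moreover have "std_normal_density x * (exp (x\<^sup>2 / 2 - q\<^sup>2 / 2) / \<bar>c\<bar>) = (exp (- x\<^sup>2 / 2) * exp (x\<^sup>2 / 2 - q\<^sup>2 / 2)) / (sqrt (2 * pi) * \<bar>c\<bar>)"
      by (simp add: std_normal_density_def)
    ultimately have "\<bar>1 / c\<bar> * std_normal_density (- d / c + (1 / c) * x) = std_normal_density x * affine_rho c d x"
      unfolding affine_rho_def q_def[symmetric]
      by (simp add: std_normal_density_def exp_add[symmetric])
    then have "ennreal \<bar>1 / c\<bar> * ennreal (std_normal_density (- d / c + (1 / c) * x)) = ennreal (std_normal_density x) * ennreal (affine_rho c d x)"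
      by (simp flip: ennreal_mult' add: affine_rho_def)
    moreover have "c * (- d / c + (1 / c) * x) + d = x" using c by (simp add: field_simps)
    ultimately show "ennreal \<bar>1 / c\<bar> * (ennreal (std_normal_density (- d / c + (1 / c) * x)) * f (c * (- d / c + (1 / c) * x) + d))
      = ennreal (std_normal_density x) * (f x * ennreal (affine_rho c d x))"
      by (metis (no_types, lifting) mult.assoc mult.commute)
  qed
  also have "\<dots> = (\<integral>\<^sup>+ y. f y * ennreal (affine_rho c d y) \<partial>gauss1)"
    by (rule nn_integral_gauss1[symmetric]) (simp add: affine_rho_def)
  finally show ?thesis .
qed

text \<open>The orthogonal map is split into two affine substitutions in one variable, each possible
  because \<open>b \<noteq> 0\<close>, whose densities cancel. The map is a reflection, hence its
  own inverse, which is convenient when it has to be undone.\<close>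

lemma gauss1_rotation:
  assumes [measurable]: "\<psi> \<in> borel_measurable (borel \<Otimes>\<^sub>M borel)" and ab: "a\<^sup>2 + b\<^sup>2 = (1::real)" and b: "b \<noteq> 0"
  shows "(\<integral>\<^sup>+ z. \<integral>\<^sup>+ w. \<psi> (a * z + b * w, b * z - a * w) \<partial>gauss1 \<partial>gauss1) = (\<integral>\<^sup>+ z. \<integral>\<^sup>+ w. \<psi> (z, w) \<partial>gauss1 \<partial>gauss1)"
proof -
  interpret G: pair_sigma_finite gauss1 gauss1 ..
  have ab': "z = b\<^sup>2 * z + a\<^sup>2 * z" for z
    using ab by (metis add.commute distrib_right mult_1)
  have "(\<integral>\<^sup>+ z. \<integral>\<^sup>+ w. \<psi> (a * z + b * w, b * z - a * w) \<partial>gauss1 \<partial>gauss1)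
    = (\<integral>\<^sup>+ z. \<integral>\<^sup>+ u. \<psi> (u, (z - a * u) / b) * ennreal (affine_rho b (a * z) u) \<partial>gauss1 \<partial>gauss1)"
  proof (rule nn_integral_cong)
    fix z
    \<comment> \<open>With \<open>u = a * z + b * w\<close>, the relation
      \<open>a\<^sup>2 + b\<^sup>2 = 1\<close> turns the second component into
      \<open>(z - a * u) / b\<close>.\<close>
    have "(\<integral>\<^sup>+ w. \<psi> (a * z + b * w, b * z - a * w) \<partial>gauss1) = (\<integral>\<^sup>+ w. (\<lambda>u. \<psi> (u, (z - a * u) / b)) (b * w + a * z) \<partial>gauss1)"
      using b ab'[of z] by (intro nn_integral_cong arg_cong[where f=\<psi>]) (auto simp: field_simps power2_eq_square)
    also have "\<dots> = (\<integral>\<^sup>+ u. \<psi> (u, (z - a * u) / b) * ennreal (affine_rho b (a * z) u) \<partial>gauss1)"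
      by (rule nn_integral_gauss1_affine) (use b in auto)
    finally show "(\<integral>\<^sup>+ w. \<psi> (a * z + b * w, b * z - a * w) \<partial>gauss1) = (\<integral>\<^sup>+ u. \<psi> (u, (z - a * u) / b) * ennreal (affine_rho b (a * z) u) \<partial>gauss1)" .
  qed
  also have "\<dots> = (\<integral>\<^sup>+ u. \<integral>\<^sup>+ z. \<psi> (u, (z - a * u) / b) * ennreal (affine_rho b (a * z) u) \<partial>gauss1 \<partial>gauss1)"
    by (rule G.Fubini'[symmetric]) measurable
  also have "\<dots> = (\<integral>\<^sup>+ u. \<integral>\<^sup>+ v. \<psi> (u, v) \<partial>gauss1 \<partial>gauss1)"
  proof (rule nn_integral_cong)
    fix u
    have "(\<integral>\<^sup>+ v. \<psi> (u, v) \<partial>gauss1) = (\<integral>\<^sup>+ v. (\<lambda>z. \<psi> (u, (z - a * u) / b)) (b * v + a * u) \<partial>gauss1)"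
      using b by (intro nn_integral_cong) simp
    also have "\<dots> = (\<integral>\<^sup>+ z. \<psi> (u, (z - a * u) / b) * ennreal (affine_rho b (a * u) z) \<partial>gauss1)"
      by (rule nn_integral_gauss1_affine) (use b in auto)
    also have "\<dots> = (\<integral>\<^sup>+ z. \<psi> (u, (z - a * u) / b) * ennreal (affine_rho b (a * z) u) \<partial>gauss1)"
    proof (intro nn_integral_cong)
      fix z
      \<comment> \<open>The density is symmetric in \<open>z\<close> and \<open>u\<close>: this is
        where the second substitution undoes the first.\<close>
      have "z\<^sup>2 * b\<^sup>2 - (z - a * u)\<^sup>2 - (u\<^sup>2 * b\<^sup>2 - (u - a * z)\<^sup>2) = (a\<^sup>2 + b\<^sup>2 - 1) * (z\<^sup>2 - u\<^sup>2)"
        by (simp add: algebra_simps power2_eq_square)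
      then have "z\<^sup>2 / 2 - ((z - a * u) / b)\<^sup>2 / 2 = u\<^sup>2 / 2 - ((u - a * z) / b)\<^sup>2 / 2"
        using b ab by (simp add: power_divide field_simps)
      then show "\<psi> (u, (z - a * u) / b) * ennreal (affine_rho b (a * u) z) = \<psi> (u, (z - a * u) / b) * ennreal (affine_rho b (a * z) u)"
        by (simp add: affine_rho_def)
    qed
    finally show "(\<integral>\<^sup>+ z. \<psi> (u, (z - a * u) / b) * ennreal (affine_rho b (a * z) u) \<partial>gauss1) = (\<integral>\<^sup>+ v. \<psi> (u, v) \<partial>gauss1)" by (rule sym)
  qed
  finally show ?thesis .
qed

text \<open>The restriction keeps the result extensional, hence inside the space of
  \<open>gauss n\<close>.\<close>

definition lincomb :: "nat \<Rightarrow> real \<Rightarrow> (nat \<Rightarrow> real) \<Rightarrow> real \<Rightarrow> (nat \<Rightarrow> real) \<Rightarrow> nat \<Rightarrow> real" where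
  "lincomb n a x b y = (\<lambda>i\<in>{..<n}. a * x i + b * y i)"

lemma lincomb_apply [simp]: "i < n \<Longrightarrow> lincomb n a x b y i = a * x i + b * y i"
  by (simp add: lincomb_def)

lemma lincomb_in_space [simp, measurable]: "lincomb n a x b y \<in> space (gauss n)"
  by (simp add: lincomb_def space_gauss)

lemma measurable_gauss_component [measurable]: "i < n \<Longrightarrow> (\<lambda>x. x i) \<in> borel_measurable (gauss n)"
  unfolding gauss_def using measurable_component_singleton[of i "{..<n}" "\<lambda>_. gauss1"] by simp

lemma measurable_lincomb [measurable]:
  assumes [measurable]: "a \<in> borel_measurable M" "b \<in> borel_measurable M" "f \<in> M \<rightarrow>\<^sub>M gauss n" "g \<in> M \<rightarrow>\<^sub>M gauss n"
  shows "(\<lambda>w. lincomb n (a w) (f w) (b w) (g w)) \<in> M \<rightarrow>\<^sub>M gauss n"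
  unfolding lincomb_def gauss_def
  by (rule measurable_restrict) (use assms in \<open>auto simp: gauss_def intro!: borel_measurable_add borel_measurable_times measurable_compose[OF _ measurable_gauss_component[unfolded gauss_def]]\<close>)

lemma distr_gauss_rotation:
  assumes ab: "a\<^sup>2 + b\<^sup>2 = (1::real)" and b: "b \<noteq> 0"
  shows "distr (gauss_sq n) (gauss_sq n) (\<lambda>(z, w). (lincomb n a z b w, lincomb n b z (-a) w)) = gauss_sq n"
proof -
  have "distr (gauss_sq n) (gauss_sq n)
      (\<lambda>(z, w). (\<lambda>i\<in>{..<n}. (\<lambda>(z, w). a * z + b * w) (z i, w i), \<lambda>i\<in>{..<n}. (\<lambda>(z, w). b * z - a * w) (z i, w i)))
    = density (gauss_sq n) (\<lambda>(z, w). \<Prod>i<n. (\<lambda>_. 1) (z i, w i))"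
    by (rule coordinatewise_distr) (use gauss1_rotation[OF _ ab b] in auto)
  moreover have "(\<lambda>(z :: nat \<Rightarrow> real, w :: nat \<Rightarrow> real). \<Prod>i<n. (\<lambda>_. 1) (z i, w i)) = (\<lambda>_. 1 :: ennreal)"
    by auto
  ultimately show ?thesis
    by (simp add: lincomb_def density_1)
qed

section \<open>Integrability, moments and Bessel's inequality\<close>

lemma integral_gauss1:
  fixes f :: "real \<Rightarrow> real"
  assumes [measurable]: "f \<in> borel_measurable borel"
  shows "(\<integral>x. f x \<partial>gauss1) = (\<integral>x. std_normal_density x * f x \<partial>lborel)"
  unfolding gauss1_def by (subst integral_density) auto

lemma integrable_gauss1:
  fixes f :: "real \<Rightarrow> real"
  assumes [measurable]: "f \<in> borel_measurable borel"
  shows "integrable gauss1 f \<longleftrightarrow> integrable lborel (\<lambda>x. std_normal_density x * f x)"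
  unfolding gauss1_def by (subst integrable_density) auto

text \<open>The factor uses up half of the Gaussian exponent and leaves a normal density of variance
  2. Its product over the coordinates is the dominating function for polynomials, Mehler's kernel
  and translations alike.\<close>

lemma integrable_gauss1_exp_square: "integrable gauss1 (\<lambda>x. exp (x\<^sup>2 / 4))"
proof -
  have "std_normal_density x * exp (x\<^sup>2 / 4) = sqrt 2 * normal_density 0 (sqrt 2) x" for x
    by (simp add: normal_density_def exp_add[symmetric] real_sqrt_mult field_simps)
  then show ?thesis
    by (subst integrable_gauss1) auto
qed

lemma gauss1_moments:
  "integrable gauss1 (\<lambda>x. x)" "(\<integral>x. x \<partial>gauss1) = 0"
  "integrable gauss1 (\<lambda>x. x\<^sup>2)" "(\<integral>x. x\<^sup>2 \<partial>gauss1) = 1"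
  using std_normal_moment_even[of 1] std_normal_moment_odd[of 0]
  by (auto simp: integrable_gauss1 integral_gauss1 has_bochner_integral_iff)

lemma integrable_gauss_exp: "integrable (gauss n) (\<lambda>x. exp ((\<Sum>i<n. (x i)\<^sup>2) / 4))"
proof -
  have "integrable (gauss n) (\<lambda>x. \<Prod>i<n. exp ((x i)\<^sup>2 / 4))"
    unfolding gauss_def
    by (rule gausses.product_integrable_prod) (auto simp: integrable_gauss1_exp_square)
  then show ?thesis
    by (simp add: exp_sum sum_divide_distrib)
qed

lemma integrable_gauss_exp_bound:
  assumes [measurable]: "f \<in> borel_measurable (gauss n)"
    and bound: "\<And>x. x \<in> space (gauss n) \<Longrightarrow> \<bar>f x\<bar> \<le> K * exp ((\<Sum>i<n. (x i)\<^sup>2) / 4)"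
  shows "integrable (gauss n) (f :: _ \<Rightarrow> real)"
proof (rule Bochner_Integration.integrable_bound)
  show "integrable (gauss n) (\<lambda>x. K * exp ((\<Sum>i<n. (x i)\<^sup>2) / 4))"
    by (intro integrable_mult_right integrable_gauss_exp)
  show "AE x in gauss n. norm (f x) \<le> norm (K * exp ((\<Sum>i<n. (x i)\<^sup>2) / 4))"
    using bound by (intro AE_I2) (fastforce intro: order.trans)
qed measurable

lemma square_le_sum_squares: "i < n \<Longrightarrow> (x i :: real)\<^sup>2 \<le> (\<Sum>i<n. (x i)\<^sup>2)" for n :: nat
  by (rule member_le_sum) auto

lemma coordinate_product_le_exp:
  fixes n :: nat
  assumes "i < n" "j < n"
  shows "\<bar>x i * x j :: real\<bar> \<le> 4 * exp ((\<Sum>i<n. (x i)\<^sup>2) / 4)"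
proof -
  let ?A = "\<Sum>i<n. (x i)\<^sup>2"
  have "(x i)\<^sup>2 \<le> ?A" "(x j)\<^sup>2 \<le> ?A"
    using assms by (auto intro: square_le_sum_squares)
  moreover have "2 * \<bar>x i * x j\<bar> \<le> (x i)\<^sup>2 + (x j)\<^sup>2"
    using sum_squares_bound[of "\<bar>x i\<bar>" "\<bar>x j\<bar>"] by (simp add: abs_mult)
  moreover have "?A \<le> 4 * exp (?A / 4)"
    using exp_ge_add_one_self[of "?A / 4"] by (simp del: exp_ge_add_one_self)
  ultimately show ?thesis by linarith
qed

lemma coordinate_le_exp:
  fixes n :: nat
  assumes "i < n"
  shows "\<bar>x i :: real\<bar> \<le> 4 * exp ((\<Sum>i<n. (x i)\<^sup>2) / 4)"
proof -
  have "\<bar>x i\<bar> \<le> 1 + (x i)\<^sup>2 / 4"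
    using sum_squares_bound[of "\<bar>x i\<bar> / 2" 1] by (simp add: power_divide)
  also have "\<dots> \<le> exp ((x i)\<^sup>2 / 4)" by (rule exp_ge_add_one_self)
  also have "\<dots> \<le> exp ((\<Sum>i<n. (x i)\<^sup>2) / 4)"
    using assms by (auto intro: square_le_sum_squares)
  finally show ?thesis
    using exp_ge_zero[of "(\<Sum>i<n. (x i)\<^sup>2) / 4"] by linarith
qed

lemma integrable_bounded_mult_coordinate:
  assumes [measurable]: "h \<in> borel_measurable (gauss n)" and h: "\<And>x. x \<in> space (gauss n) \<Longrightarrow> \<bar>h x :: real\<bar> \<le> C"
    and i: "i < n"
  shows "integrable (gauss n) (\<lambda>x. x i * h x)"
proof (rule integrable_gauss_exp_bound)
  note [measurable] = i
  show "(\<lambda>x. x i * h x) \<in> borel_measurable (gauss n)" by measurable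
  fix x assume "x \<in> space (gauss n)"
  then have "\<bar>x i\<bar> * \<bar>h x\<bar> \<le> 4 * exp ((\<Sum>i<n. (x i)\<^sup>2) / 4) * C"
    by (intro mult_mono coordinate_le_exp i h) auto
  then show "\<bar>x i * h x\<bar> \<le> (4 * C) * exp ((\<Sum>i<n. (x i)\<^sup>2) / 4)"
    by (simp only: abs_mult mult_ac)
qed

lemma integrable_bounded_mult_coordinates:
  assumes [measurable]: "h \<in> borel_measurable (gauss n)" and h: "\<And>x. x \<in> space (gauss n) \<Longrightarrow> \<bar>h x :: real\<bar> \<le> C"
    and "i < n" "j < n"
  shows "integrable (gauss n) (\<lambda>x. x i * x j * h x)"
proof (rule integrable_gauss_exp_bound)
  note [measurable] = \<open>i < n\<close> \<open>j < n\<close>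
  show "(\<lambda>x. x i * x j * h x) \<in> borel_measurable (gauss n)" by measurable
  fix x assume "x \<in> space (gauss n)"
  then have "\<bar>x i * x j\<bar> * \<bar>h x\<bar> \<le> 4 * exp ((\<Sum>i<n. (x i)\<^sup>2) / 4) * C"
    by (intro mult_mono coordinate_product_le_exp assms h) auto
  then show "\<bar>x i * x j * h x\<bar> \<le> (4 * C) * exp ((\<Sum>i<n. (x i)\<^sup>2) / 4)"
    by (simp only: abs_mult mult_ac)
qed

lemma gauss_moments:
  assumes "i < n" "j < n"
  shows "integrable (gauss n) (\<lambda>x. x i)" "(\<integral>x. x i \<partial>gauss n) = 0"
    "integrable (gauss n) (\<lambda>x. x i * x j)" "(\<integral>x. x i * x j \<partial>gauss n) = (if i = j then 1 else 0)"
proof -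
  note [measurable] = assms
  show "integrable (gauss n) (\<lambda>x. x i)"
    using coordinate_le_exp[OF assms(1)] by (intro integrable_gauss_exp_bound) measurable
  show "integrable (gauss n) (\<lambda>x. x i * x j)"
    using coordinate_product_le_exp[OF assms] by (intro integrable_gauss_exp_bound) measurable
  \<comment> \<open>Indicator exponents write a monomial as a product over all coordinates, the
    shape in which the integral factorizes.\<close>
  define e :: "nat \<Rightarrow> nat \<Rightarrow> nat" where "e = (\<lambda>i k. if k = i then 1 else 0)"
  have int: "integrable gauss1 (\<lambda>x. x ^ (e i k + e j k))" for i j k
    using gauss1_moments by (auto simp: e_def power2_eq_square numeral_2_eq_2)
  have int1: "integrable gauss1 (\<lambda>x. x ^ e i k)" for i k
    using gauss1_moments by (auto simp: e_def)
  have prod_e: "(\<Prod>k<n. x k ^ e i k) = x i" if "i < n" for i and x :: "nat \<Rightarrow> real"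
  proof -
    have "(\<Prod>k<n. x k ^ e i k) = (\<Prod>k<n. if k = i then x i else 1)"
      by (intro prod.cong) (auto simp: e_def)
    then show ?thesis using that by simp
  qed
  have "(\<integral>x. x i \<partial>gauss n) = (\<integral>x. (\<Prod>k<n. x k ^ e i k) \<partial>gauss n)"
    using assms by (simp add: prod_e)
  also have "\<dots> = (\<Prod>k<n. \<integral>x. x ^ e i k \<partial>gauss1)"
    unfolding gauss_def by (rule gausses.product_integral_prod) (use int1 in auto)
  also have "\<dots> = 0"
    using assms gauss1_moments by (intro prod_zero) (auto simp: e_def intro!: bexI[of _ i])
  finally show "(\<integral>x. x i \<partial>gauss n) = 0" .
  have "(\<integral>x. x i * x j \<partial>gauss n) = (\<integral>x. (\<Prod>k<n. x k ^ (e i k + e j k)) \<partial>gauss n)"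
    using assms by (simp add: prod_e power_add prod.distrib)
  also have "\<dots> = (\<Prod>k<n. \<integral>x. x ^ (e i k + e j k) \<partial>gauss1)"
    unfolding gauss_def by (rule gausses.product_integral_prod) (use int in auto)
  also have "\<dots> = (if i = j then 1 else 0)"
  proof (cases "i = j")
    case True
    have "(\<integral>x. x ^ (e i k + e i k) \<partial>gauss1) = 1" for k
      using gauss1_moments gauss1.prob_space by (cases "k = i") (auto simp: e_def numeral_2_eq_2)
    with True show ?thesis by simp
  next
    case False
    then show ?thesis
      using assms gauss1_moments by (auto simp: e_def intro!: prod_zero bexI[of _ i])
  qed
  finally show "(\<integral>x. x i * x j \<partial>gauss n) = (if i = j then 1 else 0)" .
qed

text \<open>The coordinates are orthonormal, and the difference of the two sides is the squared norm
  of \<open>f\<close> minus its projection to the linear functions.\<close>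

lemma bessel_inequality_gauss:
  assumes [measurable]: "f \<in> borel_measurable (gauss n)" and bound: "\<And>x. x \<in> space (gauss n) \<Longrightarrow> \<bar>f x\<bar> \<le> B"
  shows "(\<Sum>i<n. (\<integral>x. x i * f x \<partial>gauss n)\<^sup>2) \<le> (\<integral>x. (f x)\<^sup>2 \<partial>gauss n)"
proof -
  define a where "a i = (\<integral>x. x i * f x \<partial>gauss n)" for i
  have int1: "integrable (gauss n) (\<lambda>x. (f x)\<^sup>2)"
    using power_mono[OF bound abs_ge_zero, of _ 2] by (intro gauss.integrable_const_bound[where B="B\<^sup>2"]) auto
  have int2: "integrable (gauss n) (\<lambda>x. x i * f x)" if "i < n" for i
    by (rule integrable_bounded_mult_coordinate[OF assms that])
  have int3: "integrable (gauss n) (\<lambda>x. x i * x j)" if "i < n" "j < n" for i j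
    by (rule gauss_moments(3)[OF that])
  have "0 \<le> (\<integral>x. (f x - (\<Sum>i<n. a i * x i))\<^sup>2 \<partial>gauss n)"
    by (rule Bochner_Integration.integral_nonneg) simp
  also have "\<dots> = (\<integral>x. (f x)\<^sup>2 - 2 * (\<Sum>i<n. a i * (x i * f x)) + (\<Sum>i<n. \<Sum>j<n. a i * a j * (x i * x j)) \<partial>gauss n)"
  proof (intro Bochner_Integration.integral_cong refl)
    fix x :: "nat \<Rightarrow> real"
    have "(f x - S)\<^sup>2 = (f x)\<^sup>2 - 2 * (S * f x) + S * S" for S
      by (simp add: power2_eq_square algebra_simps)
    moreover have "(\<Sum>i<n. a i * x i) * f x = (\<Sum>i<n. a i * (x i * f x))"
      by (simp add: sum_distrib_right sum_distrib_left mult_ac)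
    moreover have "(\<Sum>i<n. a i * x i) * (\<Sum>i<n. a i * x i) = (\<Sum>i<n. \<Sum>j<n. a i * a j * (x i * x j))"
      by (simp add: sum_product mult_ac)
    ultimately show "(f x - (\<Sum>i<n. a i * x i))\<^sup>2
      = (f x)\<^sup>2 - 2 * (\<Sum>i<n. a i * (x i * f x)) + (\<Sum>i<n. \<Sum>j<n. a i * a j * (x i * x j))"
      by simp
  qed
  also have "\<dots> = (\<integral>x. (f x)\<^sup>2 \<partial>gauss n) - 2 * (\<Sum>i<n. a i * a i) + (\<Sum>i<n. \<Sum>j<n. a i * a j * (if i = j then 1 else 0))"
  proof -
    have int2': "integrable (gauss n) (\<lambda>x. \<Sum>i<n. a i * (x i * f x))"
      using int2 by (intro Bochner_Integration.integrable_sum integrable_mult_right) simp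
    have int3': "integrable (gauss n) (\<lambda>x. \<Sum>i<n. \<Sum>j<n. a i * a j * (x i * x j))"
      using int3 by (intro Bochner_Integration.integrable_sum integrable_mult_right) simp
    have "(\<integral>x. (\<Sum>i<n. a i * (x i * f x)) \<partial>gauss n) = (\<Sum>i<n. a i * a i)"
      using int2 by (subst Bochner_Integration.integral_sum) (auto simp: a_def)
    moreover have "(\<integral>x. (\<Sum>i<n. \<Sum>j<n. a i * a j * (x i * x j)) \<partial>gauss n) = (\<Sum>i<n. \<integral>x. (\<Sum>j<n. a i * a j * (x i * x j)) \<partial>gauss n)"
      using int3 by (intro Bochner_Integration.integral_sum Bochner_Integration.integrable_sum integrable_mult_right) simp
    moreover have "(\<integral>x. (\<Sum>j<n. a i * a j * (x i * x j)) \<partial>gauss n) = (\<Sum>j<n. a i * a j * (if i = j then 1 else 0))" if "i < n" for i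
      using int3 that gauss_moments(4)[OF that]
      by (subst Bochner_Integration.integral_sum) (auto simp: integral_mult_right simp del: mult_cancel_left1 intro!: sum.cong)
    ultimately show ?thesis
      using int1 int2' int3' by simp
  qed
  also have "\<dots> = (\<integral>x. (f x)\<^sup>2 \<partial>gauss n) - (\<Sum>i<n. (a i)\<^sup>2)"
    by (simp add: if_distrib power2_eq_square cong: if_cong)
  finally show ?thesis by (simp add: a_def)
qed

text \<open>The Hermite tensors over the uncompleted measure. The analysis is done there for Borel
  functions, and the completion is dealt with only at the end.\<close>

definition herm1 :: "nat \<Rightarrow> ((nat \<Rightarrow> real) \<Rightarrow> real) \<Rightarrow> nat \<Rightarrow> real" where
  "herm1 n f i = (\<integral>x. x i * f x \<partial>gauss n)"

definition herm2 :: "nat \<Rightarrow> ((nat \<Rightarrow> real) \<Rightarrow> real) \<Rightarrow> nat \<Rightarrow> nat \<Rightarrow> real" where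
  "herm2 n f i j = (\<integral>x. (x i * x j - (if i = j then 1 else 0)) * f x \<partial>gauss n)"

section \<open>Second moments of two positive weights\<close>

definition quad :: "nat \<Rightarrow> (nat \<Rightarrow> nat \<Rightarrow> real) \<Rightarrow> (nat \<Rightarrow> real) \<Rightarrow> (nat \<Rightarrow> real) \<Rightarrow> real" where
  "quad n A u v = (\<Sum>i<n. \<Sum>j<n. A i j * u i * v j)"

lemma quad_cong: "(\<And>i. i < n \<Longrightarrow> u i = u' i) \<Longrightarrow> (\<And>i. i < n \<Longrightarrow> v i = v' i) \<Longrightarrow> quad n A u v = quad n A u' v'"
  by (simp add: quad_def)

lemma quad_sum_right: "quad n A u (\<lambda>p. \<Sum>i\<in>I. k i * w i p) = (\<Sum>i\<in>I. k i * quad n A u (w i))"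
proof -
  have "quad n A u (\<lambda>p. \<Sum>i\<in>I. k i * w i p) = (\<Sum>a<n. \<Sum>b<n. \<Sum>i\<in>I. k i * (A a b * u a * w i b))"
    by (simp add: quad_def sum_distrib_left mult_ac)
  also have "\<dots> = (\<Sum>a<n. \<Sum>i\<in>I. \<Sum>b<n. k i * (A a b * u a * w i b))"
    by (intro sum.cong refl sum.swap)
  also have "\<dots> = (\<Sum>i\<in>I. \<Sum>a<n. \<Sum>b<n. k i * (A a b * u a * w i b))"
    by (rule sum.swap)
  finally show ?thesis by (simp add: quad_def sum_distrib_left)
qed

lemma quad_diff_right: "quad n A u (\<lambda>p. v p - w p) = quad n A u v - quad n A u w"
  by (simp add: quad_def right_diff_distrib sum_subtractf)

lemma quad_sym:
  assumes "\<And>i j. i < n \<Longrightarrow> j < n \<Longrightarrow> A i j = A j i"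
  shows "quad n A u v = quad n A v u"
  unfolding quad_def using assms by (subst sum.swap) (auto intro!: sum.cong simp: mult_ac)

text \<open>Gram-Schmidt for the form \<open>A\<close> on the standard basis, without normalization.
  The diagonal entries stay 1, so the change of basis has determinant 1 and no determinant theory is
  required later. The last conjunct records the inverse change of basis.\<close>

lemma gram_schmidt_unitriangular:
  assumes sym: "\<And>i j. i < n \<Longrightarrow> j < n \<Longrightarrow> A i j = A j i"
    and pos: "\<And>v i. i < n \<Longrightarrow> v i \<noteq> 0 \<Longrightarrow> quad n A v v > 0"
    and "m \<le> n"
  shows "\<exists>l c. (\<forall>i<m. l i i = 1 \<and> (\<forall>p>i. l i p = 0)) \<and>
    (\<forall>i<m. \<forall>j<m. i \<noteq> j \<longrightarrow> quad n A (l i) (l j) = 0) \<and>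
    (\<forall>j<m. \<forall>p. (if p = j then 1 else 0 :: real) = l j p + (\<Sum>i<j. c j i * l i p))"
  using \<open>m \<le> n\<close>
proof (induction m)
  case 0
  then show ?case by simp
next
  case (Suc m)
  from Suc.IH[OF Suc_leD[OF Suc.prems]] obtain l c where *: "(\<forall>i<m. l i i = 1 \<and> (\<forall>p>i. l i p = 0)) \<and>
    (\<forall>i<m. \<forall>j<m. i \<noteq> j \<longrightarrow> quad n A (l i) (l j) = 0) \<and>
    (\<forall>j<m. \<forall>p. (if p = j then 1 else 0 :: real) = l j p + (\<Sum>i<j. c j i * l i p))"
    by (elim exE) (rule that)
  then have l1: "\<And>i. i < m \<Longrightarrow> l i i = 1" and l0: "\<And>i p. i < m \<Longrightarrow> p > i \<Longrightarrow> l i p = 0" and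
    orth: "\<And>i j. i < m \<Longrightarrow> j < m \<Longrightarrow> i \<noteq> j \<Longrightarrow> quad n A (l i) (l j) = 0"
    by blast+
  have dec: "(if p = j then 1 else 0 :: real) = l j p + (\<Sum>i<j. c j i * l i p)" if "j < m" for j p
    using * that by blast
  \<comment> \<open>The next basis vector; \<open>cm\<close> are its projection coefficients on the
    vectors already found.\<close>
  define e where "e = (\<lambda>p. if p = m then 1 else 0 :: real)"
  define cm where "cm i = quad n A (l i) e / quad n A (l i) (l i)" for i
  define lm where "lm p = e p - (\<Sum>i<m. cm i * l i p)" for p
  have nz: "quad n A (l i) (l i) \<noteq> 0" if "i < m" for i
    using pos[of i "l i"] l1[OF that] that Suc.prems by force
  have orth_m: "quad n A (l j) lm = 0" if "j < m" for j
  proof -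
    have "quad n A (l j) lm = quad n A (l j) e - (\<Sum>i<m. cm i * quad n A (l j) (l i))"
      unfolding lm_def quad_diff_right quad_sum_right ..
    also have "(\<Sum>i<m. cm i * quad n A (l j) (l i)) = (\<Sum>i<m. if i = j then cm j * quad n A (l j) (l j) else 0)"
      using orth that by (intro sum.cong) auto
    also have "\<dots> = quad n A (l j) e"
      using that nz by (simp add: cm_def)
    finally show ?thesis by simp
  qed
  let ?l = "l(m := lm)" and ?c = "c(m := cm)"
  have "(\<Sum>i<m. cm i * l i m) = 0" using l0 by (intro sum.neutral) auto
  then have "lm m = 1" by (simp add: lm_def e_def)
  moreover have "lm p = 0" if "p > m" for p
    using that l0 by (auto simp: lm_def e_def intro!: sum.neutral)
  ultimately have "\<forall>i<Suc m. ?l i i = 1 \<and> (\<forall>p>i. ?l i p = 0)"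
    using l1 l0 by (auto simp: less_Suc_eq)
  moreover have "\<forall>i<Suc m. \<forall>j<Suc m. i \<noteq> j \<longrightarrow> quad n A (?l i) (?l j) = 0"
    using orth orth_m quad_sym[of n A, OF sym] by (auto simp: less_Suc_eq)
  moreover have "\<forall>j<Suc m. \<forall>p. (if p = j then 1 else 0 :: real) = ?l j p + (\<Sum>i<j. ?c j i * ?l i p)"
  proof (intro allI impI)
    fix j p assume "j < Suc m"
    then consider "j < m" | "j = m" by linarith
    then show "(if p = j then 1 else 0 :: real) = ?l j p + (\<Sum>i<j. ?c j i * ?l i p)"
    proof cases
      case 1
      then show ?thesis using dec[of j p] by simp
    next
      case 2
      have "(\<Sum>i<m. cm i * ?l i p) = (\<Sum>i<m. cm i * l i p)" by (intro sum.cong) auto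
      with 2 show ?thesis by (simp add: lm_def e_def)
    qed
  qed
  ultimately show ?case by blast
qed

text \<open>With the vectors \<open>l i\<close> as rows of \<open>L\<close>, the matrix
  \<open>L * A * L^T\<close> is diagonal with entries \<open>(s i)\<^sup>2\<close>. Both triangular
  systems matter: the last property is a sum of squares for \<open>A\<close>, whereas the squares of
  the functionals \<open>l i\<close>, divided by \<open>(s i)\<^sup>2\<close>, sum to the form of
  the inverse of \<open>A\<close>. The logarithm of the determinant is
  \<open>2 * (\<Sum>i<n. ln (s i))\<close>.\<close>

lemma unitriangular_diagonalization:
  assumes sym: "\<And>i j. i < n \<Longrightarrow> j < n \<Longrightarrow> A i j = A j i"
    and pos: "\<And>v i. i < n \<Longrightarrow> v i \<noteq> 0 \<Longrightarrow> quad n A v v > 0"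
  obtains l c s where
    "\<And>i. i < n \<Longrightarrow> s i > 0"
    "\<And>i. i < n \<Longrightarrow> l i i = 1" "\<And>i p. i < n \<Longrightarrow> p > i \<Longrightarrow> l i p = 0"
    "\<And>i. i < n \<Longrightarrow> quad n A (l i) (l i) = (s i)\<^sup>2"
    "\<And>x. quad n A x x = (\<Sum>i<n. (s i)\<^sup>2 * (x i + (\<Sum>j\<in>{j\<in>{..<n}. i < j}. c i j * x j))\<^sup>2)"
proof -
  have "\<exists>l c. (\<forall>i<n. l i i = 1 \<and> (\<forall>p>i. l i p = 0)) \<and>
    (\<forall>i<n. \<forall>j<n. i \<noteq> j \<longrightarrow> quad n A (l i) (l j) = 0) \<and>
    (\<forall>j<n. \<forall>p. (if p = j then 1 else 0 :: real) = l j p + (\<Sum>i<j. c j i * l i p))"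
    using sym pos by (intro gram_schmidt_unitriangular) auto
  then obtain l c where *: "(\<forall>i<n. l i i = 1 \<and> (\<forall>p>i. l i p = 0)) \<and>
    (\<forall>i<n. \<forall>j<n. i \<noteq> j \<longrightarrow> quad n A (l i) (l j) = 0) \<and>
    (\<forall>j<n. \<forall>p. (if p = j then 1 else 0 :: real) = l j p + (\<Sum>i<j. c j i * l i p))"
    by (elim exE) (rule that)
  then have l1: "\<And>i. i < n \<Longrightarrow> l i i = 1" and l0: "\<And>i p. i < n \<Longrightarrow> p > i \<Longrightarrow> l i p = 0" and
    orth: "\<And>i j. i < n \<Longrightarrow> j < n \<Longrightarrow> i \<noteq> j \<Longrightarrow> quad n A (l i) (l j) = 0"
    by blast+
  have dec: "(if p = j then 1 else 0 :: real) = l j p + (\<Sum>i<j. c j i * l i p)" if "j < n" for j p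
    using * that by blast
  define s where "s i = sqrt (quad n A (l i) (l i))" for i
  have Dpos: "quad n A (l i) (l i) > 0" if "i < n" for i
    using pos[of i "l i"] l1[OF that] that by force
  then have s: "s i > 0" "quad n A (l i) (l i) = (s i)\<^sup>2" if "i < n" for i
    using that by (auto simp: s_def Dpos less_imp_le)
  have "quad n A x x = (\<Sum>i<n. (s i)\<^sup>2 * (x i + (\<Sum>j\<in>{j\<in>{..<n}. i < j}. c j i * x j))\<^sup>2)" for x
  proof -
    define k where "k i = x i + (\<Sum>j\<in>{j\<in>{..<n}. i < j}. c j i * x j)" for i
    have xp: "x p = (\<Sum>i<n. k i * l i p)" if "p < n" for p
    proof -
      have "x p = (\<Sum>j<n. x j * (if p = j then 1 else 0))"
        using that by (simp add: if_distrib cong: if_cong)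
      also have "\<dots> = (\<Sum>j<n. x j * (l j p + (\<Sum>i<j. c j i * l i p)))"
        using dec by (intro sum.cong) auto
      also have "\<dots> = (\<Sum>j<n. x j * l j p) + (\<Sum>j<n. \<Sum>i\<in>{i\<in>{..<n}. i < j}. c j i * x j * l i p)"
        unfolding distrib_left sum.distrib sum_distrib_left
        by (intro arg_cong2[where f="(+)"] refl sum.cong) (auto simp: mult_ac)
      also have "(\<Sum>j<n. \<Sum>i\<in>{i\<in>{..<n}. i < j}. c j i * x j * l i p) = (\<Sum>i<n. \<Sum>j\<in>{j\<in>{..<n}. i < j}. c j i * x j * l i p)"
        by (rule sum.swap_restrict) auto
      finally show ?thesis
        by (simp add: k_def distrib_right sum.distrib sum_distrib_right)
    qed
    have "quad n A x x = quad n A (\<lambda>p. \<Sum>i<n. k i * l i p) (\<lambda>p. \<Sum>i<n. k i * l i p)"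
      using xp by (intro quad_cong) auto
    also have "\<dots> = (\<Sum>i<n. k i * (\<Sum>j<n. k j * quad n A (l i) (l j)))"
      unfolding quad_sum_right
      by (subst quad_sym[OF sym], assumption, assumption) (simp add: quad_sum_right)
    also have "\<dots> = (\<Sum>i<n. k i * (\<Sum>j<n. if j = i then k i * (s i)\<^sup>2 else 0))"
      using orth s by (intro sum.cong arg_cong2[where f="(*)"] refl) auto
    also have "\<dots> = (\<Sum>i<n. (s i)\<^sup>2 * (k i)\<^sup>2)"
      by (intro sum.cong) (auto simp: power2_eq_square)
    finally show ?thesis by (simp add: k_def)
  qed
  with that[of s l "\<lambda>i j. c j i"] s l1 l0 show ?thesis by blast
qed

text \<open>The variable of largest rank is integrated first: it occurs in its own factor only, and
  that factor integrates to 1 whatever its second argument is. A rank function instead of the order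
  of the indices covers upper and lower triangular systems at once.\<close>

lemma nn_integral_triangular:
  fixes P :: "'i \<Rightarrow> real \<times> real \<Rightarrow> ennreal" and r :: "'i \<Rightarrow> nat"
  assumes "finite I" "inj_on r I"
    and [measurable]: "\<And>j. j \<in> I \<Longrightarrow> P j \<in> borel_measurable (borel \<Otimes>\<^sub>M borel)"
    and "\<And>j a. j \<in> I \<Longrightarrow> (\<integral>\<^sup>+ t. P j (t, a) \<partial>gauss1) = 1"
  shows "(\<integral>\<^sup>+ x. (\<Prod>j\<in>I. P j (x j, \<Sum>i\<in>{i\<in>I. r i < r j}. c j i * x i)) \<partial>PiM I (\<lambda>_. gauss1)) = 1"
  using assms
proof (induction I rule: finite_ranking_induct[where f=r])
  case empty
  then show ?case by (simp add: PiM_empty nn_integral_count_space_finite)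
next
  case (insert m J)
  show ?case
  proof (cases "m \<in> J")
    case True
    then show ?thesis using insert by (simp add: insert_absorb)
  next
    case False
    note [simp] = \<open>finite J\<close> False
    note [measurable] = insert.prems(2)
    let ?s = "\<lambda>x j. \<Sum>i\<in>{i\<in>insert m J. r i < r j}. c j i * x i" and ?t = "\<lambda>x j. \<Sum>i\<in>{i\<in>J. r i < r j}. c j i * x i"
    let ?I = "PiM (insert m J) (\<lambda>_. gauss1)" and ?J = "PiM J (\<lambda>_. gauss1)"
    have lt: "r j < r m" if "j \<in> J" for j
      using insert(2)[OF that] that False \<open>inj_on r (insert m J)\<close> by (metis inj_on_insert insert_Diff_single insert_iff image_eqI le_neq_implies_less Diff_insert_absorb)
    have s1: "{i \<in> insert m J. r i < r j} = {i \<in> J. r i < r j}" if "j \<in> J" for j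
      using lt[OF that] by auto
    have s2: "{i \<in> insert m J. r i < r m} = J"
      using lt by auto
    have meas: "(\<lambda>x. \<Prod>j\<in>insert m J. P j (x j, ?s x j)) \<in> borel_measurable ?I"
    proof (rule borel_measurable_prod_ennreal)
      fix j assume [measurable]: "j \<in> insert m J"
      have "(\<lambda>x. ?s x j) \<in> borel_measurable ?I"
      proof (intro borel_measurable_sum borel_measurable_times borel_measurable_const)
        fix i assume "i \<in> {i\<in>insert m J. r i < r j}"
        then have "i \<in> insert m J" by simp
        then show "(\<lambda>x. x i) \<in> borel_measurable ?I"
          using measurable_component_singleton[of i "insert m J" "\<lambda>_. gauss1"] by (simp cong: measurable_cong_sets)
      qed
      have "(\<lambda>x. x j) \<in> borel_measurable ?I"
        using measurable_component_singleton[of j "insert m J" "\<lambda>_. gauss1"] \<open>j \<in> insert m J\<close> by (simp cong: measurable_cong_sets)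
      with \<open>(\<lambda>x. ?s x j) \<in> _\<close>
      show "(\<lambda>x. P j (x j, ?s x j)) \<in> borel_measurable ?I"
        by (intro measurable_compose[OF _ insert.prems(2)] measurable_Pair) (use \<open>j \<in> insert m J\<close> in auto)
    qed
    have eq: "(\<Prod>j\<in>insert m J. P j ((x(m := t)) j, ?s (x(m := t)) j))
      = P m (t, \<Sum>i\<in>J. c m i * x i) * (\<Prod>j\<in>J. P j (x j, ?t x j))" for x t
    proof -
      have "(\<Sum>i\<in>J. c m i * (x(m := t)) i) = (\<Sum>i\<in>J. c m i * x i)"
        by (rule sum.cong) auto
      moreover have "P j ((x(m := t)) j, ?s (x(m := t)) j)
        = P j (x j, ?t x j)" if "j \<in> J" for j
      proof -
        have "(?t (x(m := t)) j) = (?t x j)"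
          by (rule sum.cong) auto
        moreover have "(x(m := t)) j = x j" using that by auto
        ultimately show ?thesis by (simp only: s1[OF that])
      qed
      ultimately show ?thesis
        by (simp only: prod.insert[OF \<open>finite J\<close> False] s2 fun_upd_same cong: prod.cong)
    qed
    have "(\<integral>\<^sup>+ x. (\<Prod>j\<in>insert m J. P j (x j, ?s x j)) \<partial>?I)
      = (\<integral>\<^sup>+ x. \<integral>\<^sup>+ t. P m (t, \<Sum>i\<in>J. c m i * x i) * (\<Prod>j\<in>J. P j (x j, ?t x j)) \<partial>gauss1 \<partial>?J)"
      by (subst gausses.product_nn_integral_insert[OF _ _ meas]) (simp_all only: eq \<open>finite J\<close> False not_False_eq_True)
    also have "\<dots> = (\<integral>\<^sup>+ x. (\<Prod>j\<in>J. P j (x j, ?t x j)) \<partial>?J)"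
    proof (rule nn_integral_cong)
      fix x
      have pair: "(\<lambda>t::real. (t, a::real)) \<in> borel \<rightarrow>\<^sub>M borel \<Otimes>\<^sub>M borel" for a
        by measurable
      have [measurable]: "(\<lambda>t. P m (t, a)) \<in> borel_measurable gauss1" for a
        using measurable_compose[OF pair insert.prems(2)[of m]] by (simp cong: measurable_cong_sets)
      show "(\<integral>\<^sup>+ t. P m (t, \<Sum>i\<in>J. c m i * x i) * (\<Prod>j\<in>J. P j (x j, ?t x j)) \<partial>gauss1)
        = (\<Prod>j\<in>J. P j (x j, ?t x j))"
        using insert.prems(3)[of m] by (subst nn_integral_multc) auto
    qed
    also have "\<dots> = 1"
      using insert by auto
    finally show ?thesis .
  qed
qed

text \<open>The integrand is the density, relative to \<open>gauss n\<close>, of a centred Gaussian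
  law whose quadratic form is given by completed squares. Conditionally on the variables of smaller
  rank each factor is an \<open>affine_rho\<close>.\<close>

lemma nn_integral_triangular_gauss:
  fixes r :: "nat \<Rightarrow> nat"
  assumes "inj_on r {..<n}" and s: "\<And>j. j < n \<Longrightarrow> s j > 0"
  shows "(\<integral>\<^sup>+ x. ennreal (exp (\<Sum>j<n. (x j)\<^sup>2 / 2 - ((x j + (\<Sum>i\<in>{i\<in>{..<n}. r i < r j}. c j i * x i)) / s j)\<^sup>2 / 2 - ln (s j))) \<partial>gauss n) = 1"
proof -
  have "(\<integral>\<^sup>+ x. (\<Prod>j<n. (\<lambda>(t, a). ennreal (affine_rho (s j) (- a) t)) (x j, \<Sum>i\<in>{i\<in>{..<n}. r i < r j}. c j i * x i)) \<partial>PiM {..<n} (\<lambda>_. gauss1)) = 1"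
  proof (rule nn_integral_triangular)
    fix j a assume "j \<in> {..<n}"
    then show "(\<integral>\<^sup>+ t. (case (t, a) of (t, a) \<Rightarrow> ennreal (affine_rho (s j) (- a) t)) \<partial>gauss1) = 1"
      using nn_integral_gauss1_affine[of "\<lambda>_. 1" "s j" "- a"] s[of j] gauss1.emeasure_space_1 by simp
  qed (use assms in auto)
  moreover have "(\<Prod>j<n. (\<lambda>(t, a). ennreal (affine_rho (s j) (- a) t)) (x j, \<Sum>i\<in>{i\<in>{..<n}. r i < r j}. c j i * x i))
    = ennreal (exp (\<Sum>j<n. (x j)\<^sup>2 / 2 - ((x j + (\<Sum>i\<in>{i\<in>{..<n}. r i < r j}. c j i * x i)) / s j)\<^sup>2 / 2 - ln (s j)))" for x
    unfolding exp_sum[OF finite_lessThan] prod_ennreal[OF exp_ge_zero, symmetric] prod.case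
    by (intro prod.cong refl arg_cong[where f=ennreal]) (use s in \<open>auto simp: affine_rho_def exp_diff abs_of_pos\<close>)
  ultimately show ?thesis
    by (simp add: gauss_def)
qed

text \<open>Gibbs' variational principle, with the relative entropy of \<open>h / a\<close> bounded by the logarithm of its
  second moment.\<close>

lemma (in prob_space) gibbs_second_moment:
  fixes h \<phi> :: "'a \<Rightarrow> real"
  assumes h: "\<And>x. x \<in> space M \<Longrightarrow> 0 \<le> h x"
    and int: "integrable M h" "integrable M (\<lambda>x. (h x)\<^sup>2)" "integrable M (\<lambda>x. h x * \<phi> x)"
    and [measurable]: "\<phi> \<in> borel_measurable M"
    and \<phi>: "(\<integral>\<^sup>+ x. ennreal (exp (\<phi> x)) \<partial>M) \<le> 1"
    and a: "a = expectation h" "0 < a"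
  shows "expectation (\<lambda>x. h x * \<phi> x) \<le> a * ln (expectation (\<lambda>x. (h x)\<^sup>2) / a\<^sup>2)"
proof -
  define R where "R = expectation (\<lambda>x. (h x)\<^sup>2) / a\<^sup>2"
  have int_exp: "integrable M (\<lambda>x. exp (\<phi> x))"
    by (rule integrableI_bounded) (use \<phi> in \<open>auto simp: top_unique intro: le_less_trans\<close>)
  then have exp_le: "expectation (\<lambda>x. exp (\<phi> x)) \<le> 1"
    using \<phi> by (simp add: nn_integral_eq_integral)
  have "a\<^sup>2 \<le> expectation (\<lambda>x. (h x)\<^sup>2)"
    using variance_eq[OF int(1,2)] variance_positive[of h] a by simp
  then have E2: "expectation (\<lambda>x. (h x)\<^sup>2) > 0"
    using a(2) less_le_trans[of 0 "a\<^sup>2"] by simp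
  then have R: "R > 0"
    using a(2) by (simp add: R_def)
  \<comment> \<open>Two uses of \<open>ln y \<le> y - 1\<close> at \<open>r = h x / a\<close>: one
    compares \<open>\<phi> x\<close> with \<open>ln r\<close>, the other replaces
    \<open>ln r\<close> by its tangent at \<open>R\<close>. Weighted by \<open>h\<close> and
    integrated, the term \<open>r / R\<close> contributes exactly \<open>a\<close>, since
    \<open>R\<close> is the mean of \<open>r\<close> under that weight divided by
    \<open>a\<close>.\<close>
  have "h x * \<phi> x \<le> h x * ln R + (h x)\<^sup>2 / (a * R) - 2 * h x + a * exp (\<phi> x)" if "x \<in> space M" for x
  proof (cases "h x = 0")
    case True
    then show ?thesis using a by simp
  next
    case False
    define r where "r = h x / a"
    have r: "r > 0" "h x = a * r" using False h[OF that] a by (auto simp: r_def)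
    have 1: "ln (exp (\<phi> x) / r) \<le> exp (\<phi> x) / r - 1"
      by (rule ln_le_minus_one) (use r in auto)
    have 2: "ln (r / R) \<le> r / R - 1"
      by (rule ln_le_minus_one) (use r R in auto)
    from 1 2 have "\<phi> x \<le> ln R + r / R - 2 + exp (\<phi> x) / r"
      using r R by (simp add: ln_div)
    then have "(a * r) * \<phi> x \<le> (a * r) * (ln R + r / R - 2 + exp (\<phi> x) / r)"
      using a r by (intro mult_left_mono) auto
    also have "\<dots> = h x * ln R + (h x)\<^sup>2 / (a * R) - 2 * h x + a * exp (\<phi> x)"
      using r a R by (simp add: field_simps power2_eq_square)
    finally show ?thesis using r by simp
  qed
  then have "expectation (\<lambda>x. h x * \<phi> x) \<le> expectation (\<lambda>x. h x * ln R + (h x)\<^sup>2 / (a * R) - 2 * h x + a * exp (\<phi> x))"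
    using int int_exp by (intro integral_mono) auto
  also have "\<dots> = a * ln R + expectation (\<lambda>x. (h x)\<^sup>2) / (a * R) - 2 * a + a * expectation (\<lambda>x. exp (\<phi> x))"
    using int int_exp a by simp
  also have "expectation (\<lambda>x. (h x)\<^sup>2) / (a * R) = a"
    using a(2) E2 by (simp add: R_def power2_eq_square[of a])
  also have "a * ln R + a - 2 * a + a * expectation (\<lambda>x. exp (\<phi> x)) \<le> a * ln R"
    using a mult_left_mono[OF exp_le, of a] by simp
  finally show ?thesis by (simp add: R_def)
qed

lemma square_eq_quad: "(\<Sum>i<n. v i * x i)\<^sup>2 = quad n (\<lambda>i j. v i * v j) x x"
  by (simp add: quad_def power2_eq_square sum_product mult_ac)

text \<open>Gibbs' inequality is applied to both weights with Gaussian test densities whose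
  covariance matrices are inverse to each other, the second moments of \<open>k\<close> being one of
  them, so that the log-determinants cancel.\<close>

lemma herm2_inner_lower_bound:
  assumes [measurable]: "h \<in> borel_measurable (gauss n)" "k \<in> borel_measurable (gauss n)"
    and h: "\<And>x. x \<in> space (gauss n) \<Longrightarrow> 0 \<le> h x \<and> h x \<le> C"
    and k: "\<And>x. x \<in> space (gauss n) \<Longrightarrow> 0 \<le> k x \<and> k x \<le> C"
    and a: "a = (\<integral>x. h x \<partial>gauss n)" "0 < a" and b: "b = (\<integral>x. k x \<partial>gauss n)" "0 < b"
  shows "(\<Sum>i<n. \<Sum>j<n. herm2 n h i j * herm2 n k i j) \<ge>
    - 2 * a * b * (ln ((\<integral>x. (h x)\<^sup>2 \<partial>gauss n) / a\<^sup>2) + ln ((\<integral>x. (k x)\<^sup>2 \<partial>gauss n) / b\<^sup>2))"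
proof -
  define X where "X i j = (\<integral>x. x i * x j * h x \<partial>gauss n) / a" for i j
  define Y where "Y i j = (\<integral>x. x i * x j * k x \<partial>gauss n) / b" for i j
  have abs_h: "\<bar>h x\<bar> \<le> C" and abs_k: "\<bar>k x\<bar> \<le> C" if "x \<in> space (gauss n)" for x
    using h k that by auto
  have int_h: "integrable (gauss n) (\<lambda>x. x i * x j * h x)" and int_k: "integrable (gauss n) (\<lambda>x. x i * x j * k x)"
    if "i < n" "j < n" for i j
    using that abs_h abs_k by (auto intro!: integrable_bounded_mult_coordinates[where C=C])
  have int1: "integrable (gauss n) h" "integrable (gauss n) k"
    using abs_h abs_k by (auto intro!: gauss.integrable_const_bound[where B=C])
  have int2: "integrable (gauss n) (\<lambda>x. (h x)\<^sup>2)" "integrable (gauss n) (\<lambda>x. (k x)\<^sup>2)"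
    using power_mono[OF abs_h abs_ge_zero, of _ 2] power_mono[OF abs_k abs_ge_zero, of _ 2]
    by (auto intro!: gauss.integrable_const_bound[where B="C\<^sup>2"])
  define Lh where "Lh = ln ((\<integral>x. (h x)\<^sup>2 \<partial>gauss n) / a\<^sup>2)"
  define Lk where "Lk = ln ((\<integral>x. (k x)\<^sup>2 \<partial>gauss n) / b\<^sup>2)"
  define SX where "SX = (\<Sum>i<n. X i i)"
  define SY where "SY = (\<Sum>i<n. Y i i)"
  have quad_int: "integrable (gauss n) (\<lambda>x. g x * quad n A x x) \<and> (\<integral>x. g x * quad n A x x \<partial>gauss n) = (\<Sum>i<n. \<Sum>j<n. A i j * (\<integral>x. x i * x j * g x \<partial>gauss n))"
    if int: "\<And>i j. i < n \<Longrightarrow> j < n \<Longrightarrow> integrable (gauss n) (\<lambda>x. x i * x j * g x)" for g A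
  proof -
    have "g x * quad n A x x = (\<Sum>i<n. \<Sum>j<n. A i j * (x i * x j * g x))" for x
      by (simp add: quad_def sum_distrib_left mult_ac)
    moreover have "integrable (gauss n) (\<lambda>x. \<Sum>j<n. A i j * (x i * x j * g x))" if "i < n" for i
      using int[OF that] by (intro Bochner_Integration.integrable_sum integrable_mult_right) auto
    moreover have "(\<integral>x. (\<Sum>j<n. A i j * (x i * x j * g x)) \<partial>gauss n) = (\<Sum>j<n. A i j * (\<integral>x. x i * x j * g x \<partial>gauss n))" if "i < n" for i
      using int[OF that] by (simp add: Bochner_Integration.integral_sum)
    ultimately show ?thesis
      using int by (auto intro!: Bochner_Integration.integrable_sum simp: Bochner_Integration.integral_sum)
  qed
  have sq_int: "integrable (gauss n) (\<lambda>x. g x * (\<Sum>i<n. (x i)\<^sup>2)) \<and> (\<integral>x. g x * (\<Sum>i<n. (x i)\<^sup>2) \<partial>gauss n) = (\<Sum>i<n. \<integral>x. x i * x i * g x \<partial>gauss n)"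
    if int: "\<And>i j. i < n \<Longrightarrow> j < n \<Longrightarrow> integrable (gauss n) (\<lambda>x. x i * x j * g x)" for g
  proof -
    have "g x * (\<Sum>i<n. (x i)\<^sup>2) = (\<Sum>i<n. x i * x i * g x)" for x
      by (simp add: sum_distrib_left power2_eq_square mult_ac)
    then show ?thesis
      using int by (auto intro!: Bochner_Integration.integrable_sum simp: Bochner_Integration.integral_sum)
  qed
  have key: "2 * (Lh + Lk) \<ge> - (\<Sum>i<n. \<Sum>j<n. X i j * Y i j) + SX + SY - real n - e * SX" if e: "e > 0" for e
  proof -
    \<comment> \<open>\<open>Y\<close> is visibly only semidefinite; the shift by \<open>e\<close>
      makes \<open>A\<close> positive definite and is removed by the limit \<open>e\<close> to 0 at
      the end.\<close>
    define A where "A i j = Y i j + (if i = j then e else 0)" for i j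
    have quadA: "quad n A v v = quad n Y v v + e * (\<Sum>i<n. (v i)\<^sup>2)" for v
    proof -
      have "quad n A v v = quad n Y v v + (\<Sum>i<n. \<Sum>j<n. if i = j then e * (v i)\<^sup>2 else 0)"
        unfolding quad_def sum.distrib[symmetric] A_def
        by (intro sum.cong refl) (auto simp: algebra_simps power2_eq_square)
      then show ?thesis by (simp add: sum_distrib_left)
    qed
    have quadY: "quad n Y v v = (\<integral>x. k x * (\<Sum>i<n. v i * x i)\<^sup>2 \<partial>gauss n) / b" for v
    proof -
      have "(\<integral>x. k x * (\<Sum>i<n. v i * x i)\<^sup>2 \<partial>gauss n) = (\<Sum>i<n. \<Sum>j<n. v i * v j * (\<integral>x. x i * x j * k x \<partial>gauss n))"
        unfolding square_eq_quad
        using quad_int[of k "\<lambda>i j. v i * v j"] int_k by simp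
      then show ?thesis
        by (simp add: quad_def Y_def sum_divide_distrib mult_ac)
    qed
    have "quad n Y v v \<ge> 0" for v
      unfolding quadY using b k by (intro divide_nonneg_pos Bochner_Integration.integral_nonneg) auto
    moreover have "(\<Sum>i<n. (v i)\<^sup>2) > 0" if "i < n" "v i \<noteq> 0" for v :: "nat \<Rightarrow> real" and i
      using that by (intro sum_pos2[of _ i]) auto
    ultimately have posA: "quad n A v v > 0" if "i < n" "v i \<noteq> 0" for v i
      unfolding quadA using e that by (simp add: add_nonneg_pos)
    have symA: "A i j = A j i" if "i < n" "j < n" for i j
      by (simp add: A_def Y_def mult_ac)
    obtain l c s where
      s: "\<And>i. i < n \<Longrightarrow> s i > 0" and
      l1: "\<And>i. i < n \<Longrightarrow> l i i = 1" and l0: "\<And>i p. i < n \<Longrightarrow> p > i \<Longrightarrow> l i p = 0" and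
      l2: "\<And>i. i < n \<Longrightarrow> quad n A (l i) (l i) = (s i)\<^sup>2" and
      diag: "\<And>x. quad n A x x = (\<Sum>i<n. (s i)\<^sup>2 * (x i + (\<Sum>j\<in>{j\<in>{..<n}. i < j}. c i j * x j))\<^sup>2)"
      apply (rule unitriangular_diagonalization[of n A])
        apply (rule symA; assumption)
       apply (rule posA; assumption)
      apply (rule that; assumption)
      done
    \<comment> \<open>Logarithmic densities of the centred Gaussians with covariance inverse to
      \<open>A\<close> (for \<open>\<phi>\<close>) and equal to \<open>A\<close> (for
      \<open>\<psi>\<close>). Half of the log-determinant of \<open>A\<close> enters with opposite
      signs and drops out of the sum of the two entropy bounds.\<close>
    define \<phi> where "\<phi> x = (\<Sum>i<n. (x i)\<^sup>2) / 2 - quad n A x x / 2 + (\<Sum>i<n. ln (s i))" for x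
    define \<psi> where "\<psi> x = (\<Sum>i<n. (x i)\<^sup>2) / 2 - (\<Sum>i<n. (\<Sum>p<n. l i p * x p)\<^sup>2 / (s i)\<^sup>2) / 2 - (\<Sum>i<n. ln (s i))" for x
    have [measurable]: "(\<lambda>x. quad n A x x) \<in> borel_measurable (gauss n)"
      unfolding quad_def by measurable
    have \<phi>1: "(\<integral>\<^sup>+ x. ennreal (exp (\<phi> x)) \<partial>gauss n) = 1"
    proof -
      \<comment> \<open>In \<open>diag\<close> the square with index \<open>j\<close> involves the
        coordinates above \<open>j\<close>, hence the reversing rank \<open>n - i\<close>;
        \<open>\<psi>\<close> uses the natural order.\<close>
      have "\<phi> x = (\<Sum>j<n. (x j)\<^sup>2 / 2 - ((x j + (\<Sum>i\<in>{i\<in>{..<n}. n - i < n - j}. c j i * x i)) / inverse (s j))\<^sup>2 / 2 - ln (inverse (s j)))" for x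
      proof -
        have "{i\<in>{..<n}. n - i < n - j} = {i\<in>{..<n}. j < i}" for j by auto
        moreover have "(X / inverse (s j))\<^sup>2 = (s j)\<^sup>2 * X\<^sup>2" for X j
          by (simp add: divide_inverse power_mult_distrib mult.commute)
        ultimately show ?thesis
          unfolding \<phi>_def diag sum_divide_distrib sum_subtractf[symmetric] sum.distrib[symmetric]
          using s by (intro sum.cong) (auto simp: ln_inverse)
      qed
      moreover have "inj_on (\<lambda>i. n - i) {..<n}" by (auto simp: inj_on_def)
      ultimately show ?thesis
        using nn_integral_triangular_gauss[of "\<lambda>i. n - i" n "\<lambda>i. inverse (s i)" c] s by simp
    qed
    have \<psi>1: "(\<integral>\<^sup>+ x. ennreal (exp (\<psi> x)) \<partial>gauss n) = 1"
    proof -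
      have "(\<Sum>p<n. l j p * x p) = x j + (\<Sum>i\<in>{i\<in>{..<n}. i < j}. l j i * x i)" if "j < n" for j and x :: "nat \<Rightarrow> real"
      proof -
        have "(\<Sum>p<n. l j p * x p) = (\<Sum>p\<in>insert j {i\<in>{..<n}. i < j}. l j p * x p)"
        proof (intro sum.mono_neutral_right ballI)
          fix p assume "p \<in> {..<n} - insert j {i\<in>{..<n}. i < j}"
          then have "p > j" by auto
          then show "l j p * x p = 0" using l0[OF that] by simp
        qed (use that in auto)
        then show ?thesis using l1[OF that] by simp
      qed
      then have "\<psi> x = (\<Sum>j<n. (x j)\<^sup>2 / 2 - ((x j + (\<Sum>i\<in>{i\<in>{..<n}. i < j}. l j i * x i)) / s j)\<^sup>2 / 2 - ln (s j))" for x
        unfolding \<psi>_def sum_divide_distrib sum_subtractf[symmetric]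
        by (intro sum.cong) (auto simp: power_divide)
      then show ?thesis
        using nn_integral_triangular_gauss[of "\<lambda>i. i" n s l] s by simp
    qed
    have "(\<integral>x. h x * \<phi> x \<partial>gauss n) \<le> a * Lh" if "integrable (gauss n) (\<lambda>x. h x * \<phi> x)"
      unfolding Lh_def by (rule gauss.gibbs_second_moment) (use h int1 int2 \<phi>1 a that in \<open>auto simp: \<phi>_def\<close>)
    moreover have "integrable (gauss n) (\<lambda>x. h x * \<phi> x) \<and> (\<integral>x. h x * \<phi> x \<partial>gauss n) = a * (SX / 2 - (\<Sum>i<n. \<Sum>j<n. A i j * X i j) / 2 + (\<Sum>i<n. ln (s i)))"
    proof -
      have *: "h x * \<phi> x = h x * (\<Sum>i<n. (x i)\<^sup>2) / 2 - h x * quad n A x x / 2 + h x * (\<Sum>i<n. ln (s i))" for x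
        by (simp add: \<phi>_def algebra_simps)
      have "(\<Sum>i<n. \<integral>x. x i * x i * h x \<partial>gauss n) = a * SX" "(\<Sum>i<n. \<Sum>j<n. A i j * (\<integral>x. x i * x j * h x \<partial>gauss n)) = a * (\<Sum>i<n. \<Sum>j<n. A i j * X i j)"
        using a(2) by (auto simp: SX_def X_def sum_distrib_left intro!: sum.cong)
      with sq_int[of h, OF int_h] quad_int[of h A, OF int_h]
      have I: "integrable (gauss n) (\<lambda>x. h x * (\<Sum>i<n. (x i)\<^sup>2))" "(\<integral>x. h x * (\<Sum>i<n. (x i)\<^sup>2) \<partial>gauss n) = a * SX"
        "integrable (gauss n) (\<lambda>x. h x * quad n A x x)" "(\<integral>x. h x * quad n A x x \<partial>gauss n) = a * (\<Sum>i<n. \<Sum>j<n. A i j * X i j)"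
        by auto
      then have "(\<integral>x. h x * \<phi> x \<partial>gauss n) = a * SX / 2 - a * (\<Sum>i<n. \<Sum>j<n. A i j * X i j) / 2 + a * (\<Sum>i<n. ln (s i))"
        unfolding * using int1 a(1) by simp
      moreover have "integrable (gauss n) (\<lambda>x. h x * \<phi> x)"
        unfolding * using I int1 by simp
      ultimately show ?thesis by (simp add: algebra_simps)
    qed
    ultimately have H: "SX / 2 - (\<Sum>i<n. \<Sum>j<n. A i j * X i j) / 2 + (\<Sum>i<n. ln (s i)) \<le> Lh"
      using a by simp
    have "(\<integral>x. k x * \<psi> x \<partial>gauss n) \<le> b * Lk" if "integrable (gauss n) (\<lambda>x. k x * \<psi> x)"
      unfolding Lk_def by (rule gauss.gibbs_second_moment) (use k int1 int2 \<psi>1 b that in \<open>auto simp: \<psi>_def\<close>)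
    moreover have "integrable (gauss n) (\<lambda>x. k x * \<psi> x) \<and> (\<integral>x. k x * \<psi> x \<partial>gauss n) = b * (SY / 2 - (\<Sum>i<n. quad n Y (l i) (l i) / (s i)\<^sup>2) / 2 - (\<Sum>i<n. ln (s i)))"
    proof -
      have *: "k x * \<psi> x = k x * (\<Sum>i<n. (x i)\<^sup>2) / 2 - (\<Sum>i<n. k x * (\<Sum>p<n. l i p * x p)\<^sup>2 / (s i)\<^sup>2) / 2 - k x * (\<Sum>i<n. ln (s i))" for x
        by (simp add: \<psi>_def right_diff_distrib sum_distrib_left)
      have int_l: "integrable (gauss n) (\<lambda>x. k x * (\<Sum>p<n. l i p * x p)\<^sup>2)" for i
        unfolding square_eq_quad
        using quad_int[of k "\<lambda>p q. l i p * l i q"] int_k by simp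
      have "(\<integral>x. (\<Sum>i<n. k x * (\<Sum>p<n. l i p * x p)\<^sup>2 / (s i)\<^sup>2) \<partial>gauss n) = (\<Sum>i<n. b * quad n Y (l i) (l i) / (s i)\<^sup>2)"
        using int_l b by (simp add: Bochner_Integration.integral_sum quadY)
      then have I1: "(\<integral>x. (\<Sum>i<n. k x * (\<Sum>p<n. l i p * x p)\<^sup>2 / (s i)\<^sup>2) \<partial>gauss n) = b * (\<Sum>i<n. quad n Y (l i) (l i) / (s i)\<^sup>2)"
        by (simp add: sum_distrib_left)
      have "(\<Sum>i<n. \<integral>x. x i * x i * k x \<partial>gauss n) = b * SY"
        using b(2) by (auto simp: SY_def Y_def sum_distrib_left intro!: sum.cong)
      with sq_int[of k, OF int_k]
      have I: "integrable (gauss n) (\<lambda>x. k x * (\<Sum>i<n. (x i)\<^sup>2))" "(\<integral>x. k x * (\<Sum>i<n. (x i)\<^sup>2) \<partial>gauss n) = b * SY"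
        by auto
      have I2: "integrable (gauss n) (\<lambda>x. \<Sum>i<n. k x * (\<Sum>p<n. l i p * x p)\<^sup>2 / (s i)\<^sup>2)"
        using int_l by auto
      have "(\<integral>x. k x * \<psi> x \<partial>gauss n) = b * SY / 2 - b * (\<Sum>i<n. quad n Y (l i) (l i) / (s i)\<^sup>2) / 2 - b * (\<Sum>i<n. ln (s i))"
        unfolding * using I I1 I2 int1 b(1) by simp
      moreover have "integrable (gauss n) (\<lambda>x. k x * \<psi> x)"
        unfolding * using I I2 int1 by simp
      ultimately show ?thesis by (simp add: algebra_simps)
    qed
    ultimately have K: "SY / 2 - (\<Sum>i<n. quad n Y (l i) (l i) / (s i)\<^sup>2) / 2 - (\<Sum>i<n. ln (s i)) \<le> Lk"
      using b by simp
    \<comment> \<open>The left side is the trace of \<open>Y\<close> times the inverse of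
      \<open>A\<close>, at most \<open>n\<close> because the form of \<open>Y\<close> is below that
      of \<open>A\<close>. This replaces the unknown inverse by the dimension, which cancels against
      the identity matrices in \<open>herm2\<close>.\<close>
    have "(\<Sum>i<n. quad n Y (l i) (l i) / (s i)\<^sup>2) \<le> (\<Sum>i<n. 1)"
    proof (rule sum_mono)
      fix i assume "i \<in> {..<n}"
      then have i: "i < n" by simp
      have "0 \<le> e * (\<Sum>p<n. (l i p)\<^sup>2)" using e by (simp add: sum_nonneg)
      then have "quad n Y (l i) (l i) \<le> (s i)\<^sup>2"
        using quadA[of "l i"] l2[OF i] by linarith
      moreover have "(s i)\<^sup>2 > 0" using s[OF i] by simp
      ultimately show "quad n Y (l i) (l i) / (s i)\<^sup>2 \<le> 1" by simp
    qed
    moreover have "(\<Sum>i<n. \<Sum>j<n. A i j * X i j) = (\<Sum>i<n. \<Sum>j<n. X i j * Y i j) + e * SX"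
    proof -
      have "(\<Sum>i<n. \<Sum>j<n. A i j * X i j) = (\<Sum>i<n. \<Sum>j<n. X i j * Y i j + (if i = j then e * X i j else 0))"
        by (intro sum.cong refl) (auto simp: A_def algebra_simps)
      then show ?thesis by (simp add: sum.distrib SX_def sum_distrib_left)
    qed
    moreover have "- q + x + y - N - e \<le> 2 * (L + L')"
      if "x / 2 - (q + e) / 2 + S \<le> L" "y / 2 - T / 2 - S \<le> L'" "T \<le> N" for x y q e S T L L' N :: real
      using that by argo
    ultimately show ?thesis using H K by simp
  qed
  have "2 * (Lh + Lk) \<ge> - (\<Sum>i<n. \<Sum>j<n. X i j * Y i j) + SX + SY - real n"
  proof (rule tendsto_upperbound)
    show "((\<lambda>e. - (\<Sum>i<n. \<Sum>j<n. X i j * Y i j) + SX + SY - real n - e * SX) \<longlongrightarrow> - (\<Sum>i<n. \<Sum>j<n. X i j * Y i j) + SX + SY - real n) (at_right 0)"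
      by (auto intro!: tendsto_eq_intros)
    show "\<forall>\<^sub>F e in at_right 0. - (\<Sum>i<n. \<Sum>j<n. X i j * Y i j) + SX + SY - real n - e * SX \<le> 2 * (Lh + Lk)"
      using key by (auto simp: eventually_at_right_less intro: eventually_at_rightI[of 0 1])
  qed simp
  moreover have "(\<Sum>i<n. \<Sum>j<n. herm2 n h i j * herm2 n k i j) = a * b * ((\<Sum>i<n. \<Sum>j<n. X i j * Y i j) - SX - SY + real n)"
  proof -
    have 1: "herm2 n h i j = a * (X i j - (if i = j then 1 else 0))" if "i < n" "j < n" for i j
      using int_h[OF that] int1 a by (auto simp: herm2_def X_def left_diff_distrib right_diff_distrib)
    have 2: "herm2 n k i j = b * (Y i j - (if i = j then 1 else 0))" if "i < n" "j < n" for i j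
      using int_k[OF that] int1 b by (auto simp: herm2_def Y_def left_diff_distrib right_diff_distrib)
    have "(\<Sum>i<n. \<Sum>j<n. herm2 n h i j * herm2 n k i j) = (\<Sum>i<n. \<Sum>j<n. a * b * (X i j * Y i j) + (if i = j then a * b * (1 - X i i - Y i i) else 0))"
      by (intro sum.cong refl) (auto simp: 1 2 algebra_simps)
    then show ?thesis
      by (simp add: sum.distrib sum_subtractf sum_distrib_left[symmetric] SX_def SY_def algebra_simps)
  qed
  moreover have "- 2 * a * b * (Lh + Lk) \<le> a * b * ((\<Sum>i<n. \<Sum>j<n. X i j * Y i j) - SX - SY + real n)"
    if "2 * (Lh + Lk) \<ge> - (\<Sum>i<n. \<Sum>j<n. X i j * Y i j) + SX + SY - real n"
  proof -
    have "(a * b) * (- 2 * (Lh + Lk)) \<le> (a * b) * ((\<Sum>i<n. \<Sum>j<n. X i j * Y i j) - SX - SY + real n)"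
      using that a b by (intro mult_left_mono) auto
    then show ?thesis by (simp add: algebra_simps)
  qed
  ultimately show ?thesis
    by (simp add: Lh_def Lk_def)
qed

section \<open>The Mehler form\<close>

lemma has_real_derivative_integral:
  fixes \<phi> \<phi>' :: "real \<Rightarrow> 'a \<Rightarrow> real"
  assumes int: "\<And>s. \<bar>s\<bar> < r \<Longrightarrow> integrable M (\<phi> s)"
    and der: "\<And>s x. \<bar>s\<bar> < r \<Longrightarrow> x \<in> space M \<Longrightarrow> ((\<lambda>s. \<phi> s x) has_real_derivative \<phi>' s x) (at s)"
    and bound: "\<And>s x. \<bar>s\<bar> < r \<Longrightarrow> x \<in> space M \<Longrightarrow> \<bar>\<phi>' s x\<bar> \<le> W x"
    and W: "integrable M W" and s: "\<bar>s\<bar> < r" and meas: "\<phi>' s \<in> borel_measurable M"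
  shows "((\<lambda>s. \<integral>x. \<phi> s x \<partial>M) has_real_derivative (\<integral>x. \<phi>' s x \<partial>M)) (at s)"
proof -
  let ?S = "{-r<..<r}"
  have S: "x \<in> ?S \<longleftrightarrow> \<bar>x\<bar> < r" for x by auto
  have "((\<lambda>s. \<integral>x. \<phi> s x \<partial>M) has_real_derivative (\<integral>x. \<phi>' s x \<partial>M)) (at s within ?S)"
    unfolding has_field_derivative_iff tendsto_at_iff_sequentially
  proof (intro allI impI)
    fix X assume X: "\<forall>i. X i \<in> ?S - {s}" and lim: "X \<longlonglongrightarrow> s"
    have Xi: "\<bar>X i\<bar> < r" "X i \<noteq> s" for i using X S by auto
    have "(\<lambda>i. \<integral>x. (\<phi> (X i) x - \<phi> s x) / (X i - s) \<partial>M) \<longlonglongrightarrow> (\<integral>x. \<phi>' s x \<partial>M)"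
    proof (rule integral_dominated_convergence[where w=W])
      show "\<phi>' s \<in> borel_measurable M" by fact
      show "(\<lambda>x. (\<phi> (X i) x - \<phi> s x) / (X i - s)) \<in> borel_measurable M" for i
        using int[OF Xi(1)[of i]] int[OF s] by simp
      show "AE x in M. (\<lambda>i. (\<phi> (X i) x - \<phi> s x) / (X i - s)) \<longlonglongrightarrow> \<phi>' s x"
      proof (intro AE_I2)
        fix x assume "x \<in> space M"
        from der[OF s this] have "((\<lambda>y. (\<phi> y x - \<phi> s x) / (y - s)) \<longlongrightarrow> \<phi>' s x) (at s)"
          by (simp add: has_field_derivative_iff)
        then show "(\<lambda>i. (\<phi> (X i) x - \<phi> s x) / (X i - s)) \<longlonglongrightarrow> \<phi>' s x"
          using lim Xi by (auto simp: tendsto_at_iff_sequentially o_def)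
      qed
      show "AE x in M. norm ((\<phi> (X i) x - \<phi> s x) / (X i - s)) \<le> W x" for i
      proof (intro AE_I2)
        fix x assume x: "x \<in> space M"
        have "norm (\<phi> (X i) x - \<phi> s x) \<le> W x * norm (X i - s)"
        proof (rule field_differentiable_bound[where S="?S"])
          show "((\<lambda>s. \<phi> s x) has_field_derivative \<phi>' z x) (at z within ?S)" if "z \<in> ?S" for z
            using der[of z x] that x S by (auto intro: has_field_derivative_at_within)
        qed (use bound x Xi s S in auto)
        then show "norm ((\<phi> (X i) x - \<phi> s x) / (X i - s)) \<le> W x"
          using Xi(2)[of i] by (simp add: field_simps)
      qed
    qed (rule W)
    moreover have "(\<integral>x. (\<phi> (X i) x - \<phi> s x) / (X i - s) \<partial>M) = ((\<integral>x. \<phi> (X i) x \<partial>M) - (\<integral>x. \<phi> s x \<partial>M)) / (X i - s)" for i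
      using int[OF Xi(1)[of i]] int[OF s] by simp
    ultimately show "((\<lambda>y. ((\<integral>x. \<phi> y x \<partial>M) - (\<integral>x. \<phi> s x \<partial>M)) / (y - s)) \<circ> X) \<longlonglongrightarrow> (\<integral>x. \<phi>' s x \<partial>M)"
      by (simp only: o_def)
  qed
  moreover have "at s within ?S = at s"
    using s by (intro at_within_open) auto
  ultimately show ?thesis by simp
qed

section \<open>Mehler's kernel and its derivatives in the correlation\<close>

definition sqsum :: "nat \<Rightarrow> (nat \<Rightarrow> real) \<times> (nat \<Rightarrow> real) \<Rightarrow> real" where
  "sqsum n p = (\<Sum>i<n. (fst p i)\<^sup>2 + (snd p i)\<^sup>2)"

definition dotp :: "nat \<Rightarrow> (nat \<Rightarrow> real) \<times> (nat \<Rightarrow> real) \<Rightarrow> real" where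
  "dotp n p = (\<Sum>i<n. fst p i * snd p i)"

text \<open>The logarithm of Mehler's kernel in dimension \<open>N\<close>, where \<open>A\<close>
  is the sum of the squared norms of the two points and \<open>B\<close> their inner
  product.\<close>

definition mehler_exponent :: "real \<Rightarrow> real \<Rightarrow> real \<Rightarrow> real \<Rightarrow> real" where
  "mehler_exponent N A B s = - (N / 2) * ln (1 - s\<^sup>2) + (s * B - s\<^sup>2 * A / 2) / (1 - s\<^sup>2)"

definition mehler_exponent' :: "real \<Rightarrow> real \<Rightarrow> real \<Rightarrow> real \<Rightarrow> real" where
  "mehler_exponent' N A B s = N * s / (1 - s\<^sup>2) + (B * (1 + s\<^sup>2) - s * A) / (1 - s\<^sup>2)\<^sup>2"

definition mehler_exponent'' :: "real \<Rightarrow> real \<Rightarrow> real \<Rightarrow> real \<Rightarrow> real" where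
  "mehler_exponent'' N A B s = N * (1 + s\<^sup>2) / (1 - s\<^sup>2)\<^sup>2 + (2 * s * B - A) / (1 - s\<^sup>2)\<^sup>2
    + 4 * s * (B * (1 + s\<^sup>2) - s * A) / (1 - s\<^sup>2) ^ 3"

lemma one_minus_square_ge: "\<bar>s\<bar> < 1/8 \<Longrightarrow> 1 - s\<^sup>2 \<ge> 1/2" for s :: real
proof -
  assume "\<bar>s\<bar> < 1/8"
  then have "s\<^sup>2 \<le> (1/8)\<^sup>2" by (metis abs_le_square_iff abs_of_pos less_imp_le zero_less_divide_1_iff zero_less_numeral)
  then show ?thesis by (simp add: power2_eq_square)
qed

lemma DERIV_mehler_exponent:
  assumes "\<bar>s\<bar> < 1/8"
  shows "(mehler_exponent N A B has_real_derivative mehler_exponent' N A B s) (at s)"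
proof -
  define u where "u = 1 - s\<^sup>2"
  have u: "u > 0" using one_minus_square_ge[OF assms] by (simp add: u_def)
  have s2: "s\<^sup>2 = 1 - u" by (simp add: u_def)
  have "((\<lambda>s. - (N / 2) * ln (1 - s\<^sup>2)) has_real_derivative - (N / 2) * (- (2 * s) / u)) (at s)"
    using u by (auto intro!: derivative_eq_intros simp: u_def[symmetric])
  moreover have "((\<lambda>s. (s * B - s\<^sup>2 * A / 2) / (1 - s\<^sup>2)) has_real_derivative
    ((B - s * A) * u - (s * B - s\<^sup>2 * A / 2) * (- (2 * s))) / (u * u)) (at s)"
    using u by (auto intro!: derivative_eq_intros simp: u_def[symmetric])
  ultimately have "(mehler_exponent N A B has_real_derivative
    - (N / 2) * (- (2 * s) / u) + ((B - s * A) * u - (s * B - s\<^sup>2 * A / 2) * (- (2 * s))) / (u * u)) (at s)"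
    unfolding mehler_exponent_def[abs_def] by (rule DERIV_add)
  moreover have "(B - s * A) * u - (s * B - s\<^sup>2 * A / 2) * (- (2 * s)) = B * (1 + s\<^sup>2) - s * A"
    by (simp add: u_def algebra_simps power2_eq_square)
  ultimately show ?thesis
    by (simp add: mehler_exponent'_def u_def[symmetric] power2_eq_square[of u] mult_ac)
qed

lemma DERIV_mehler_exponent':
  assumes "\<bar>s\<bar> < 1/8"
  shows "(mehler_exponent' N A B has_real_derivative mehler_exponent'' N A B s) (at s)"
proof -
  define u where "u = 1 - s\<^sup>2"
  have u: "u > 0" using one_minus_square_ge[OF assms] by (simp add: u_def)
  have quotient: "(P * u\<^sup>2 - Q * (2 * u * (- (2 * s)))) / (u\<^sup>2 * u\<^sup>2) = P / u\<^sup>2 + 4 * s * Q / u ^ 3" for P Q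
    using u by (simp add: field_simps eval_nat_numeral)
  have "((\<lambda>s. N * s / (1 - s\<^sup>2)) has_real_derivative (N * u - N * s * (- (2 * s))) / (u * u)) (at s)"
    using u by (auto intro!: derivative_eq_intros simp: u_def[symmetric])
  moreover have "((\<lambda>s. (B * (1 + s\<^sup>2) - s * A) / (1 - s\<^sup>2)\<^sup>2) has_real_derivative
     ((2 * s * B - A) * u\<^sup>2 - (B * (1 + s\<^sup>2) - s * A) * (2 * u * (- (2 * s)))) / (u\<^sup>2 * u\<^sup>2)) (at s)"
    using u by (auto intro!: derivative_eq_intros simp: u_def[symmetric])
  ultimately have "(mehler_exponent' N A B has_real_derivative
     (N * u - N * s * (- (2 * s))) / (u * u) + ((2 * s * B - A) * u\<^sup>2 - (B * (1 + s\<^sup>2) - s * A) * (2 * u * (- (2 * s)))) / (u\<^sup>2 * u\<^sup>2)) (at s)"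
    unfolding mehler_exponent'_def[abs_def] by (rule DERIV_add)
  moreover have "(N * u - N * s * (- (2 * s))) / (u * u) = N * (1 + s\<^sup>2) / u\<^sup>2"
    by (simp add: u_def power2_eq_square algebra_simps)
  moreover have "((2 * s * B - A) * u\<^sup>2 - (B * (1 + s\<^sup>2) - s * A) * (2 * u * (- (2 * s)))) / (u\<^sup>2 * u\<^sup>2)
    = (2 * s * B - A) / u\<^sup>2 + 4 * s * (B * (1 + s\<^sup>2) - s * A) / u ^ 3"
    by (rule quotient)
  ultimately show ?thesis
    by (simp add: mehler_exponent''_def u_def[symmetric] add.assoc)
qed

text \<open>The range \<open>\<bar>s\<bar> < 1/8\<close> is chosen so that the exponent grows by at
  most \<open>A / 8\<close>. This leaves room for the polynomial factors from two derivatives below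
  the integrable \<open>exp (A / 4)\<close>.\<close>

lemma mehler_exponent_le:
  assumes s: "\<bar>s\<bar> < 1/8" and "0 \<le> N" and B: "\<bar>B\<bar> \<le> A / 2"
  shows "mehler_exponent N A B s \<le> N + A / 8"
    "\<bar>mehler_exponent' N A B s\<bar> \<le> 10 * (N + A + 1)"
    "\<bar>mehler_exponent'' N A B s\<bar> \<le> 20 * (N + A + 1)"
proof -
  define u where "u = 1 - s\<^sup>2"
  have u: "u \<ge> 1/2" "u \<le> 1" "s\<^sup>2 \<le> 1/2" using one_minus_square_ge[OF s] by (auto simp: u_def)
  define v where "v = 1 / u"
  have v: "0 < v" "v \<le> 2" using u by (auto simp: v_def divide_simps)
  have A: "A \<ge> 0" using B by linarith
  have v2: "0 < v\<^sup>2" "v\<^sup>2 \<le> 4" using v power_mono[of v 2 2] by auto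
  have v3: "0 < v^3" "v^3 \<le> 8" using v power_mono[of v 2 3] by auto
  have sB: "\<bar>s * B\<bar> \<le> A / 16"
    using mult_mono[of "\<bar>s\<bar>" "1/8" "\<bar>B\<bar>" "A/2"] s B by (simp add: abs_mult)
  have sA: "\<bar>s * A\<bar> \<le> A / 8"
    using mult_mono[of "\<bar>s\<bar>" "1/8" "\<bar>A\<bar>" A] s A by (simp add: abs_mult)
  have s2B: "\<bar>B * (1 + s\<^sup>2)\<bar> \<le> A"
    using mult_mono[of "\<bar>B\<bar>" "A/2" "\<bar>1 + s\<^sup>2\<bar>" 2] u B by (simp add: abs_mult)
  have C: "\<bar>B * (1 + s\<^sup>2) - s * A\<bar> \<le> 9/8 * A" using s2B sA by linarith
  have "ln (1 / u) \<le> 1 / u - 1" by (rule ln_le_minus_one) (use u in auto)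
  then have "- ln u \<le> 1" using u v by (simp add: ln_div v_def)
  then have "N / 2 * (- ln u) \<le> N / 2 * 1" using \<open>0 \<le> N\<close> by (intro mult_left_mono) auto
  moreover have "s * B - s\<^sup>2 * A / 2 \<le> A / 16"
    using sB mult_nonneg_nonneg[OF zero_le_power2[of s] A] by linarith
  then have "(s * B - s\<^sup>2 * A / 2) * v \<le> A / 16 * 2"
    using v A by (intro mult_mono) auto
  moreover have "mehler_exponent N A B s = N / 2 * (- ln u) + (s * B - s\<^sup>2 * A / 2) * v"
    by (simp add: mehler_exponent_def u_def[symmetric] v_def)
  ultimately show "mehler_exponent N A B s \<le> N + A / 8"
    using \<open>0 \<le> N\<close> by linarith
  have b1: "\<bar>N * s * v\<bar> \<le> N * (1/8) * 2"
    unfolding abs_mult using s v \<open>0 \<le> N\<close> by (intro mult_mono) auto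
  have b2: "\<bar>(B * (1 + s\<^sup>2) - s * A) * v\<^sup>2\<bar> \<le> 9/8 * A * 4"
    unfolding abs_mult using C v2 A by (intro mult_mono) auto
  have eq: "mehler_exponent' N A B s = N * s * v + (B * (1 + s\<^sup>2) - s * A) * v\<^sup>2"
    by (simp add: mehler_exponent'_def u_def[symmetric] v_def power_divide)
  have "\<bar>mehler_exponent' N A B s\<bar> \<le> N * (1/8) * 2 + 9/8 * A * 4"
    unfolding eq by (rule order.trans[OF abs_triangle_ineq add_mono[OF b1 b2]])
  then show "\<bar>mehler_exponent' N A B s\<bar> \<le> 10 * (N + A + 1)"
    by (rule order.trans) (use A \<open>0 \<le> N\<close> in auto)
  have c1: "\<bar>N * (1 + s\<^sup>2) * v\<^sup>2\<bar> \<le> N * 2 * 4"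
    unfolding abs_mult using u v2 \<open>0 \<le> N\<close> by (intro mult_mono) auto
  have c2: "\<bar>(2 * s * B - A) * v\<^sup>2\<bar> \<le> (9/8 * A) * 4"
    unfolding abs_mult using v2 A sB by (intro mult_mono) auto
  have c3: "\<bar>(4 * s) * (B * (1 + s\<^sup>2) - s * A) * v ^ 3\<bar> \<le> (1/2) * (9/8 * A) * 8"
    unfolding abs_mult[of "4 * s * _" "v^3"] abs_mult[of "4 * s"] using s v3 A C by (intro mult_mono) auto
  have eq: "mehler_exponent'' N A B s = N * (1 + s\<^sup>2) * v\<^sup>2 + (2 * s * B - A) * v\<^sup>2 + (4 * s) * (B * (1 + s\<^sup>2) - s * A) * v ^ 3"
    by (simp add: mehler_exponent''_def u_def[symmetric] v_def power_divide)
  have "\<bar>mehler_exponent'' N A B s\<bar> \<le> N * 2 * 4 + (9/8 * A) * 4 + (1/2) * (9/8 * A) * 8"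
    unfolding eq by (rule order.trans[OF abs_triangle_ineq add_mono[OF order.trans[OF abs_triangle_ineq add_mono[OF c1 c2]] c3]])
  then show "\<bar>mehler_exponent'' N A B s\<bar> \<le> 20 * (N + A + 1)"
    by (rule order.trans) (use A \<open>0 \<le> N\<close> in auto)
qed

definition mehler :: "nat \<Rightarrow> real \<Rightarrow> (nat \<Rightarrow> real) \<times> (nat \<Rightarrow> real) \<Rightarrow> real" where
  "mehler n s p = exp (mehler_exponent (real n) (sqsum n p) (dotp n p) s)"

definition mehler' :: "nat \<Rightarrow> real \<Rightarrow> (nat \<Rightarrow> real) \<times> (nat \<Rightarrow> real) \<Rightarrow> real" where
  "mehler' n s p = mehler_exponent' (real n) (sqsum n p) (dotp n p) s * mehler n s p"

definition mehler'' :: "nat \<Rightarrow> real \<Rightarrow> (nat \<Rightarrow> real) \<times> (nat \<Rightarrow> real) \<Rightarrow> real" where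
  "mehler'' n s p = (mehler_exponent'' (real n) (sqsum n p) (dotp n p) s
     + (mehler_exponent' (real n) (sqsum n p) (dotp n p) s)\<^sup>2) * mehler n s p"

lemma DERIV_mehler:
  assumes "\<bar>s\<bar> < 1/8"
  shows "((\<lambda>s. mehler n s p) has_real_derivative mehler' n s p) (at s)"
    "((\<lambda>s. mehler' n s p) has_real_derivative mehler'' n s p) (at s)"
proof -
  show 1: "((\<lambda>s. mehler n s p) has_real_derivative mehler' n s p) (at s)"
    unfolding mehler_def mehler'_def
    by (rule DERIV_mehler_exponent[OF assms, THEN DERIV_fun_exp, THEN DERIV_cong]) simp
  have "((\<lambda>s. mehler' n s p) has_real_derivative
    mehler_exponent'' (real n) (sqsum n p) (dotp n p) s * mehler n s p + mehler' n s p * mehler_exponent' (real n) (sqsum n p) (dotp n p) s) (at s)"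
    unfolding mehler'_def[where s="_::real", abs_def]
    by (rule DERIV_mult[OF DERIV_mehler_exponent'[OF assms] 1, unfolded mehler'_def])
  then show "((\<lambda>s. mehler' n s p) has_real_derivative mehler'' n s p) (at s)"
    by (rule DERIV_cong) (simp add: mehler''_def mehler'_def algebra_simps power2_eq_square)
qed

lemma mehler_zero: "mehler n 0 p = 1" "mehler' n 0 p = dotp n p" "mehler'' n 0 p = real n - sqsum n p + (dotp n p)\<^sup>2"
  by (simp_all add: mehler_def mehler'_def mehler''_def mehler_exponent_def mehler_exponent'_def mehler_exponent''_def)

lemma abs_dotp_le: "\<bar>dotp n p\<bar> \<le> sqsum n p / 2"
proof -
  have "\<bar>dotp n p\<bar> \<le> (\<Sum>i<n. \<bar>fst p i * snd p i\<bar>)" unfolding dotp_def by (rule sum_abs)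
  also have "\<dots> \<le> (\<Sum>i<n. ((fst p i)\<^sup>2 + (snd p i)\<^sup>2) / 2)"
  proof (rule sum_mono)
    fix i
    show "\<bar>fst p i * snd p i\<bar> \<le> ((fst p i)\<^sup>2 + (snd p i)\<^sup>2) / 2"
      using sum_squares_bound[of "\<bar>fst p i\<bar>" "\<bar>snd p i\<bar>"] by (simp add: abs_mult)
  qed
  finally show ?thesis by (simp add: sqsum_def sum_divide_distrib)
qed

text \<open>The factor 120 is 20 + 100, from the second derivative of the exponent and the square of
  the first; 1024 comes from squaring \<open>1 + A \<le> 32 * exp (A / 32)\<close>. The dependence
  on \<open>n\<close> is harmless: the bound only justifies exchanging limits, derivatives and
  integrals.\<close>

definition mehler_bound :: "nat \<Rightarrow> (nat \<Rightarrow> real) \<times> (nat \<Rightarrow> real) \<Rightarrow> real" where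
  "mehler_bound n p = 120 * 1024 * (real n + 1)\<^sup>2 * exp (real n) * exp (sqsum n p / 4)"

lemma mehler_le_bound:
  assumes s: "\<bar>s\<bar> < 1/8"
  shows "\<bar>mehler n s p\<bar> \<le> mehler_bound n p" "\<bar>mehler' n s p\<bar> \<le> mehler_bound n p" "\<bar>mehler'' n s p\<bar> \<le> mehler_bound n p"
proof -
  let ?A = "sqsum n p" and ?N = "real n"
  define q where "q = ?N + ?A + 1"
  note E = mehler_exponent_le[OF s, of "real n" "dotp n p" "sqsum n p", OF of_nat_0_le_iff abs_dotp_le]
  have A: "0 \<le> ?A" by (simp add: sqsum_def sum_nonneg)
  then have q1: "q \<ge> 1" by (simp add: q_def)
  have "q \<le> (?N + 1) * (1 + ?A)" using A by (simp add: q_def algebra_simps)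
  also have "1 + ?A \<le> 32 * exp (?A / 32)"
    using exp_ge_add_one_self[of "?A / 32"] by (simp del: exp_ge_add_one_self)
  finally have "q \<le> (?N + 1) * (32 * exp (?A / 32))" by (simp add: mult_left_mono)
  then have "q\<^sup>2 \<le> ((?N + 1) * (32 * exp (?A / 32)))\<^sup>2"
    using q1 by (intro power_mono) auto
  also have "\<dots> = 1024 * (?N + 1)\<^sup>2 * exp (?A / 16)"
    by (simp add: power_mult_distrib exp_double[symmetric])
  finally have q2: "q\<^sup>2 \<le> 1024 * (?N + 1)\<^sup>2 * exp (?A / 16)" .
  have m: "mehler n s p \<le> exp ?N * exp (?A / 8)"
    using E(1) by (simp add: mehler_def exp_add[symmetric])
  have main: "c * mehler n s p \<le> mehler_bound n p" if "c \<le> 120 * q\<^sup>2" for c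
  proof -
    have "c * mehler n s p \<le> (120 * (1024 * (?N + 1)\<^sup>2 * exp (?A / 16))) * (exp ?N * exp (?A / 8))"
      using that q2 m by (intro mult_mono) (auto simp: mehler_def)
    also have "\<dots> = (120 * 1024 * (?N + 1)\<^sup>2 * exp ?N) * (exp (?A / 16) * exp (?A / 8))"
      by (simp add: mult_ac)
    also have "\<dots> \<le> (120 * 1024 * (?N + 1)\<^sup>2 * exp ?N) * exp (?A / 4)"
      using A by (intro mult_left_mono) (auto simp flip: exp_add)
    finally show ?thesis by (simp add: mehler_bound_def)
  qed
  have q3: "q \<le> q\<^sup>2" "1 \<le> q\<^sup>2" using q1 mult_mono[of 1 q 1 q] by (auto simp: power2_eq_square mult_le_cancel_left1)
  have e1: "\<bar>mehler_exponent' ?N ?A (dotp n p) s\<bar> \<le> 10 * q" and e2: "\<bar>mehler_exponent'' ?N ?A (dotp n p) s\<bar> \<le> 20 * q"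
    using E(2,3) by (auto simp: q_def)
  have "(mehler_exponent' ?N ?A (dotp n p) s)\<^sup>2 \<le> (10 * q)\<^sup>2"
    using power_mono[OF e1, of 2] by simp
  then have e3: "\<bar>mehler_exponent'' ?N ?A (dotp n p) s + (mehler_exponent' ?N ?A (dotp n p) s)\<^sup>2\<bar> \<le> 120 * q\<^sup>2"
  proof -
    have "\<bar>mehler_exponent'' ?N ?A (dotp n p) s\<bar> + \<bar>(mehler_exponent' ?N ?A (dotp n p) s)\<^sup>2\<bar> \<le> 20 * q\<^sup>2 + 100 * q\<^sup>2"
      using e2 q3 \<open>(mehler_exponent' ?N ?A (dotp n p) s)\<^sup>2 \<le> (10 * q)\<^sup>2\<close>
      by (intro add_mono) (auto simp: power_mult_distrib)
    then show ?thesis by (intro order.trans[OF abs_triangle_ineq]) simp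
  qed
  have [simp]: "0 \<le> mehler n s p" by (simp add: mehler_def)
  show "\<bar>mehler n s p\<bar> \<le> mehler_bound n p" using main[of 1] q3 by simp
  show "\<bar>mehler' n s p\<bar> \<le> mehler_bound n p" using main[of "\<bar>mehler_exponent' ?N ?A (dotp n p) s\<bar>"] e1 q3
    by (simp add: mehler'_def abs_mult)
  show "\<bar>mehler'' n s p\<bar> \<le> mehler_bound n p" using main[OF e3]
    by (simp add: mehler''_def abs_mult)
qed

lemma fst_in_space [simp]: "p \<in> space (A \<Otimes>\<^sub>M B) \<Longrightarrow> fst p \<in> space A"
  and snd_in_space [simp]: "p \<in> space (A \<Otimes>\<^sub>M B) \<Longrightarrow> snd p \<in> space B"
  by (auto simp: space_pair_measure)

lemma measurable_sqsum [measurable]: "sqsum n \<in> borel_measurable (gauss_sq n)"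
  unfolding sqsum_def[abs_def] by measurable

lemma measurable_dotp [measurable]: "dotp n \<in> borel_measurable (gauss_sq n)"
  unfolding dotp_def[abs_def] by measurable

lemma measurable_mehler [measurable]:
  "mehler n s \<in> borel_measurable (gauss_sq n)"
  "mehler' n s \<in> borel_measurable (gauss_sq n)"
  "mehler'' n s \<in> borel_measurable (gauss_sq n)"
  unfolding mehler''_def[abs_def] mehler'_def[abs_def] mehler_def[abs_def]
    mehler_exponent_def mehler_exponent'_def mehler_exponent''_def by measurable

lemma integrable_product_pair:
  fixes f g :: "_ \<Rightarrow> real"
  assumes "integrable (gauss n) f" "integrable (gauss n) g"
  shows "integrable (gauss_sq n) (\<lambda>p. f (fst p) * g (snd p))"
    "(\<integral>p. f (fst p) * g (snd p) \<partial>gauss_sq n) = (\<integral>x. f x \<partial>gauss n) * (\<integral>x. g x \<partial>gauss n)"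
proof -
  have [measurable]: "f \<in> borel_measurable (gauss n)" "g \<in> borel_measurable (gauss n)" using assms by auto
  show *: "integrable (gauss_sq n) (\<lambda>p. f (fst p) * g (snd p))"
    by (rule gauss_pair.Fubini_integrable) (use assms in \<open>auto simp: abs_mult\<close>)
  show "(\<integral>p. f (fst p) * g (snd p) \<partial>gauss_sq n) = (\<integral>x. f x \<partial>gauss n) * (\<integral>x. g x \<partial>gauss n)"
    using gauss_pair.integral_fst'[OF *] by simp
qed

lemma integrable_mehler_bound: "integrable (gauss_sq n) (mehler_bound n)"
proof -
  have "integrable (gauss_sq n) (\<lambda>p. exp ((\<Sum>i<n. (fst p i)\<^sup>2) / 4) * exp ((\<Sum>i<n. (snd p i)\<^sup>2) / 4))"
    by (rule integrable_product_pair(1)[OF integrable_gauss_exp integrable_gauss_exp])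
  then show ?thesis
    unfolding mehler_bound_def[abs_def]
    by (intro integrable_mult_right) (simp add: sqsum_def exp_add[symmetric] add_divide_distrib sum.distrib)
qed

section \<open>The bilinear form and its derivatives\<close>

definition unit_fun :: "nat \<Rightarrow> ((nat \<Rightarrow> real) \<Rightarrow> real) \<Rightarrow> bool" where
  "unit_fun n f \<longleftrightarrow> f \<in> borel_measurable (gauss n) \<and> (\<forall>x\<in>space (gauss n). \<bar>f x\<bar> \<le> 1)"

lemma unit_funD: "unit_fun n f \<Longrightarrow> f \<in> borel_measurable (gauss n)" "unit_fun n f \<Longrightarrow> x \<in> space (gauss n) \<Longrightarrow> \<bar>f x\<bar> \<le> 1"
  by (auto simp: unit_fun_def)

text \<open>\<open>mform n f g s\<close> is the expectation of \<open>f X * g Y\<close> for standard Gaussian vectors \<open>X\<close>, \<open>Y\<close> with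
  correlation \<open>s\<close>. Written with Mehler's kernel it is visibly smooth in \<open>s\<close>, also around \<open>s = 0\<close>.\<close>

definition mform :: "nat \<Rightarrow> ((nat \<Rightarrow> real) \<Rightarrow> real) \<Rightarrow> ((nat \<Rightarrow> real) \<Rightarrow> real) \<Rightarrow> real \<Rightarrow> real" where
  "mform n f g s = (\<integral>p. f (fst p) * g (snd p) * mehler n s p \<partial>gauss_sq n)"

definition mform' :: "nat \<Rightarrow> ((nat \<Rightarrow> real) \<Rightarrow> real) \<Rightarrow> ((nat \<Rightarrow> real) \<Rightarrow> real) \<Rightarrow> real \<Rightarrow> real" where
  "mform' n f g s = (\<integral>p. f (fst p) * g (snd p) * mehler' n s p \<partial>gauss_sq n)"

definition mform'' :: "nat \<Rightarrow> ((nat \<Rightarrow> real) \<Rightarrow> real) \<Rightarrow> ((nat \<Rightarrow> real) \<Rightarrow> real) \<Rightarrow> real \<Rightarrow> real" where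
  "mform'' n f g s = (\<integral>p. f (fst p) * g (snd p) * mehler'' n s p \<partial>gauss_sq n)"

lemma mform_integrand:
  assumes f: "unit_fun n f" and g: "unit_fun n g" and [measurable]: "K \<in> borel_measurable (gauss_sq n)"
    and K: "\<And>p. \<bar>K p\<bar> \<le> mehler_bound n p"
  shows "integrable (gauss_sq n) (\<lambda>p. f (fst p) * g (snd p) * K p)"
    "p \<in> space (gauss_sq n) \<Longrightarrow> \<bar>f (fst p) * g (snd p) * K p\<bar> \<le> mehler_bound n p"
    "\<bar>\<integral>p. f (fst p) * g (snd p) * K p \<partial>gauss_sq n\<bar> \<le> (\<integral>p. mehler_bound n p \<partial>gauss_sq n)"
proof -
  note [measurable] = unit_funD(1)[OF f] unit_funD(1)[OF g]
  have b: "\<bar>f (fst p) * g (snd p) * K p\<bar> \<le> mehler_bound n p" if "p \<in> space (gauss_sq n)" for p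
  proof -
    have "\<bar>f (fst p)\<bar> * \<bar>g (snd p)\<bar> * \<bar>K p\<bar> \<le> 1 * 1 * mehler_bound n p"
      using unit_funD(2)[OF f, of "fst p"] unit_funD(2)[OF g, of "snd p"] K[of p] that
      by (intro mult_mono) auto
    then show ?thesis by (simp add: abs_mult)
  qed
  then show "p \<in> space (gauss_sq n) \<Longrightarrow> \<bar>f (fst p) * g (snd p) * K p\<bar> \<le> mehler_bound n p" .
  show int: "integrable (gauss_sq n) (\<lambda>p. f (fst p) * g (snd p) * K p)"
    by (rule Bochner_Integration.integrable_bound[OF integrable_mehler_bound])
       (use b in \<open>auto intro!: AE_I2 simp: mehler_bound_def\<close>)
  have "\<bar>\<integral>p. f (fst p) * g (snd p) * K p \<partial>gauss_sq n\<bar> \<le> (\<integral>p. \<bar>f (fst p) * g (snd p) * K p\<bar> \<partial>gauss_sq n)"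
    by (rule integral_abs_bound)
  also have "\<dots> \<le> (\<integral>p. mehler_bound n p \<partial>gauss_sq n)"
    by (intro integral_mono integrable_abs int integrable_mehler_bound b)
  finally show "\<bar>\<integral>p. f (fst p) * g (snd p) * K p \<partial>gauss_sq n\<bar> \<le> (\<integral>p. mehler_bound n p \<partial>gauss_sq n)" .
qed

lemma DERIV_mform:
  assumes f: "unit_fun n f" and g: "unit_fun n g" and s: "\<bar>s\<bar> < 1/8"
  shows "(mform n f g has_real_derivative mform' n f g s) (at s)"
    "(mform' n f g has_real_derivative mform'' n f g s) (at s)"
proof -
  note [measurable] = unit_funD(1)[OF f] unit_funD(1)[OF g]
  note I = mform_integrand[OF f g measurable_mehler(1) mehler_le_bound(1)]
    and I' = mform_integrand[OF f g measurable_mehler(2) mehler_le_bound(2)]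
    and I'' = mform_integrand[OF f g measurable_mehler(3) mehler_le_bound(3)]
  show "(mform n f g has_real_derivative mform' n f g s) (at s)"
    unfolding mform_def[abs_def] mform'_def
    by (rule has_real_derivative_integral[where r="1/8" and W="mehler_bound n"])
       (use s in \<open>auto intro!: I I' DERIV_cmult DERIV_mehler integrable_mehler_bound\<close>)
  show "(mform' n f g has_real_derivative mform'' n f g s) (at s)"
    unfolding mform'_def[abs_def] mform''_def
    by (rule has_real_derivative_integral[where r="1/8" and W="mehler_bound n"])
       (use s in \<open>auto intro!: I' I'' DERIV_cmult DERIV_mehler integrable_mehler_bound\<close>)
qed

text \<open>The derivatives of Mehler's kernel at correlation 0 are sums of products of a Hermite
  polynomial in the first point and the same one in the second, so the integrals over the two points
  separate.\<close>

lemma mform_zero: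
  assumes f: "unit_fun n f" and g: "unit_fun n g"
  shows "mform n f g 0 = (\<integral>x. f x \<partial>gauss n) * (\<integral>x. g x \<partial>gauss n)"
    "mform' n f g 0 = (\<Sum>i<n. herm1 n f i * herm1 n g i)"
    "mform'' n f g 0 = (\<Sum>i<n. \<Sum>j<n. herm2 n f i j * herm2 n g i j)"
proof -
  note [measurable] = unit_funD(1)[OF f] unit_funD(1)[OF g]
  have int0: "integrable (gauss n) h" if "unit_fun n h" for h
    using unit_funD[OF that] by (auto intro!: gauss.integrable_const_bound[where B=1])
  have int2: "integrable (gauss n) (\<lambda>x. x i * x j * h x)" if h: "unit_fun n h" and ij: "i < n" "j < n" for h i j
    by (rule integrable_bounded_mult_coordinates[OF unit_funD[OF h] ij])
  have int1: "integrable (gauss n) (\<lambda>x. x i * h x)" if h: "unit_fun n h" and i: "i < n" for h i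
    by (rule integrable_bounded_mult_coordinate[OF unit_funD[OF h] i])
  have int2': "integrable (gauss n) (\<lambda>x. (x i * x j - (if i = j then 1 else 0)) * h x)" if h: "unit_fun n h" and ij: "i < n" "j < n" for h i j
    using int2[OF that] int0[OF h] by (auto simp: left_diff_distrib)
  show "mform n f g 0 = (\<integral>x. f x \<partial>gauss n) * (\<integral>x. g x \<partial>gauss n)"
    using integrable_product_pair(2)[OF int0[OF f] int0[OF g]] by (simp add: mform_def mehler_zero)
  have "mform' n f g 0 = (\<integral>p. (\<Sum>i<n. (fst p i * f (fst p)) * (snd p i * g (snd p))) \<partial>gauss_sq n)"
    by (simp add: mform'_def mehler_zero dotp_def sum_distrib_left mult_ac)
  also have "\<dots> = (\<Sum>i<n. \<integral>p. (fst p i * f (fst p)) * (snd p i * g (snd p)) \<partial>gauss_sq n)"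
    by (intro Bochner_Integration.integral_sum integrable_product_pair(1) int1 f g) auto
  also have "\<dots> = (\<Sum>i<n. herm1 n f i * herm1 n g i)"
    unfolding herm1_def by (intro sum.cong refl integrable_product_pair(2) int1 f g) auto
  finally show "mform' n f g 0 = (\<Sum>i<n. herm1 n f i * herm1 n g i)" .
  let ?H = "\<lambda>i j x h. (x i * x j - (if i = j then 1 else 0 :: real)) * (h x :: real)"
  \<comment> \<open>The second derivative of the kernel as a sum over the entries of the second
    Hermite tensors; the diagonal produces \<open>real n\<close> and \<open>sqsum\<close>.\<close>
  have eq: "real n - sqsum n p + (dotp n p)\<^sup>2 = (\<Sum>i<n. \<Sum>j<n. (fst p i * fst p j - (if i = j then 1 else 0)) * (snd p i * snd p j - (if i = j then 1 else 0)))" for p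
  proof -
    have "(\<Sum>i<n. \<Sum>j<n. (fst p i * fst p j - (if i = j then 1 else 0)) * (snd p i * snd p j - (if i = j then 1 else 0)))
      = (\<Sum>i<n. \<Sum>j<n. (fst p i * snd p i) * (fst p j * snd p j) + (if i = j then 1 - ((fst p i)\<^sup>2 + (snd p i)\<^sup>2) else 0))"
      by (intro sum.cong refl) (auto simp: algebra_simps power2_eq_square)
    then show ?thesis
      by (simp add: sum.distrib sqsum_def dotp_def power2_eq_square[of "sum _ _"] sum_product sum_subtractf)
  qed
  have "mform'' n f g 0 = (\<integral>p. (\<Sum>i<n. \<Sum>j<n. ?H i j (fst p) f * ?H i j (snd p) g) \<partial>gauss_sq n)"
    unfolding mform''_def mehler_zero eq
    by (simp add: sum_distrib_left mult_ac)
  also have "\<dots> = (\<Sum>i<n. \<integral>p. (\<Sum>j<n. ?H i j (fst p) f * ?H i j (snd p) g) \<partial>gauss_sq n)"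
    by (intro Bochner_Integration.integral_sum Bochner_Integration.integrable_sum integrable_product_pair(1) int2' f g) auto
  also have "\<dots> = (\<Sum>i<n. \<Sum>j<n. \<integral>p. ?H i j (fst p) f * ?H i j (snd p) g \<partial>gauss_sq n)"
    by (intro sum.cong refl Bochner_Integration.integral_sum integrable_product_pair(1) int2' f g) auto
  also have "\<dots> = (\<Sum>i<n. \<Sum>j<n. herm2 n f i j * herm2 n g i j)"
    unfolding herm2_def by (intro sum.cong refl integrable_product_pair(2) int2' f g) auto
  finally show "mform'' n f g 0 = (\<Sum>i<n. \<Sum>j<n. herm2 n f i j * herm2 n g i j)" .
qed

text \<open>Mehler's kernel is the product of the densities of
  \<open>s * x i + sqrt (1 - s\<^sup>2) * w i\<close> given \<open>x i\<close>. This links the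
  smooth definition to the probabilistic picture.\<close>

lemma mform_eq_correlated:
  assumes f: "unit_fun n f" and g: "unit_fun n g" and s: "\<bar>s\<bar> < 1/8"
  shows "mform n f g s = (\<integral>p. f (fst p) * g (lincomb n s (fst p) (sqrt (1 - s\<^sup>2)) (snd p)) \<partial>gauss_sq n)"
proof -
  note [measurable] = unit_funD(1)[OF f] unit_funD(1)[OF g]
  let ?P = "gauss_sq n"
  define r where "r = sqrt (1 - s\<^sup>2)"
  have u: "1 - s\<^sup>2 > 0" using one_minus_square_ge[OF s] by simp
  then have r: "r > 0" "r\<^sup>2 = 1 - s\<^sup>2" "ln r = ln (1 - s\<^sup>2) / 2" by (auto simp: r_def ln_sqrt)
  define T where "T = (\<lambda>(z :: nat \<Rightarrow> real, w :: nat \<Rightarrow> real). (\<lambda>i\<in>{..<n}. fst (z i, w i), \<lambda>i\<in>{..<n}. (\<lambda>(x, y). s * x + r * y) (z i, w i)))"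
  have D: "distr ?P ?P T = density ?P (\<lambda>(z, w). \<Prod>i<n. (\<lambda>(x, y). ennreal (affine_rho r (s * x) y)) (z i, w i))"
    unfolding T_def
  proof (rule coordinatewise_distr)
    fix \<psi> :: "real \<times> real \<Rightarrow> ennreal" assume [measurable]: "\<psi> \<in> borel_measurable (borel \<Otimes>\<^sub>M borel)"
    show "(\<integral>\<^sup>+ a. \<integral>\<^sup>+ b. \<psi> (fst (a, b), case (a, b) of (x, y) \<Rightarrow> s * x + r * y) \<partial>gauss1 \<partial>gauss1)
      = (\<integral>\<^sup>+ a. \<integral>\<^sup>+ b. \<psi> (a, b) * (case (a, b) of (x, y) \<Rightarrow> ennreal (affine_rho r (s * x) y)) \<partial>gauss1 \<partial>gauss1)"
    proof (rule nn_integral_cong)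
      fix a
      show "(\<integral>\<^sup>+ b. \<psi> (fst (a, b), case (a, b) of (x, y) \<Rightarrow> s * x + r * y) \<partial>gauss1)
        = (\<integral>\<^sup>+ b. \<psi> (a, b) * (case (a, b) of (x, y) \<Rightarrow> ennreal (affine_rho r (s * x) y)) \<partial>gauss1)"
        using nn_integral_gauss1_affine[of "\<lambda>b. \<psi> (a, b)" r "s * a"] r by (simp add: add.commute)
    qed
  qed measurable
  have rho: "(case p of (z, w) \<Rightarrow> \<Prod>i<n. (\<lambda>(x, y). ennreal (affine_rho r (s * x) y)) (z i, w i)) = ennreal (mehler n s p)" for p
  proof -
    have "affine_rho r (s * x) y = exp ((s * (x * y) - s\<^sup>2 * (x\<^sup>2 + y\<^sup>2) / 2) / (1 - s\<^sup>2) - ln (1 - s\<^sup>2) / 2)" for x y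
    proof -
      have "y\<^sup>2 / 2 - ((y - s * x) / r)\<^sup>2 / 2 = (y\<^sup>2 * r\<^sup>2 - (y - s * x)\<^sup>2) / (2 * r\<^sup>2)"
        using r(1) by (simp add: power_divide field_simps)
      also have "y\<^sup>2 * r\<^sup>2 - (y - s * x)\<^sup>2 = 2 * (s * (x * y) - s\<^sup>2 * (x\<^sup>2 + y\<^sup>2) / 2)"
        unfolding r(2) by (simp add: algebra_simps power2_eq_square)
      finally have "y\<^sup>2 / 2 - ((y - s * x) / r)\<^sup>2 / 2 = (s * (x * y) - s\<^sup>2 * (x\<^sup>2 + y\<^sup>2) / 2) / (1 - s\<^sup>2)"
        by (simp only: r(2) mult_divide_mult_cancel_left_if) simp
      moreover have "\<bar>r\<bar> = exp (ln (1 - s\<^sup>2) / 2)"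
        unfolding r(3)[symmetric] using r(1) by simp
      ultimately show ?thesis
        by (simp add: affine_rho_def exp_diff)
    qed
    then have "(\<Prod>i<n. affine_rho r (s * fst p i) (snd p i)) = exp (\<Sum>i<n. (s * (fst p i * snd p i) - s\<^sup>2 * ((fst p i)\<^sup>2 + (snd p i)\<^sup>2) / 2) / (1 - s\<^sup>2) - ln (1 - s\<^sup>2) / 2)"
      by (simp add: exp_sum)
    also have "(\<Sum>i<n. (s * (fst p i * snd p i) - s\<^sup>2 * ((fst p i)\<^sup>2 + (snd p i)\<^sup>2) / 2) / (1 - s\<^sup>2) - ln (1 - s\<^sup>2) / 2)
      = mehler_exponent (real n) (sqsum n p) (dotp n p) s"
      by (simp add: mehler_exponent_def sqsum_def dotp_def sum_subtractf sum_divide_distrib[symmetric] sum_distrib_left[symmetric])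
    finally have "(\<Prod>i<n. affine_rho r (s * fst p i) (snd p i)) = mehler n s p" by (simp add: mehler_def)
    then show ?thesis
      by (simp add: case_prod_unfold prod_ennreal affine_rho_def)
  qed
  have T: "T p = (fst p, lincomb n s (fst p) r (snd p))" if "p \<in> space ?P" for p
  proof -
    obtain z w where p: "p = (z, w)" "z \<in> Rn n"
      using \<open>p \<in> space ?P\<close> unfolding space_pair_measure space_gauss by (rule SigmaE)
    then have "restrict z {..<n} = z" by (simp only: PiE_restrict)
    then show ?thesis by (simp add: p T_def lincomb_def)
  qed
  have [measurable]: "T \<in> ?P \<rightarrow>\<^sub>M ?P"
    by (subst measurable_cong[OF T]) (auto intro!: measurable_Pair measurable_lincomb)
  have "mform n f g s = (\<integral>p. f (fst p) * g (snd p) \<partial>density ?P (\<lambda>p. ennreal (mehler n s p)))"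
    unfolding mform_def by (subst integral_density) (auto simp: mehler_def mult_ac)
  also have "\<dots> = (\<integral>p. f (fst p) * g (snd p) \<partial>distr ?P ?P T)"
    unfolding D rho ..
  also have "\<dots> = (\<integral>p. f (fst (T p)) * g (snd (T p)) \<partial>?P)"
    by (rule integral_distr) measurable
  also have "\<dots> = (\<integral>p. f (fst p) * g (lincomb n s (fst p) r (snd p)) \<partial>?P)"
    by (rule Bochner_Integration.integral_cong) (simp_all add: T)
  finally show ?thesis by (simp add: r_def)
qed

section \<open>Mixture representation and semigroup property\<close>

lemma unit_fun_integrable: "unit_fun n f \<Longrightarrow> integrable (gauss n) f"
  using unit_funD[of n f] by (auto intro!: gauss.integrable_const_bound[where B=1])

lemma unit_fun_integral_le: "unit_fun n f \<Longrightarrow> \<bar>\<integral>x. f x \<partial>gauss n\<bar> \<le> 1"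
proof -
  assume f: "unit_fun n f"
  have "\<bar>\<integral>x. f x \<partial>gauss n\<bar> \<le> (\<integral>x. \<bar>f x\<bar> \<partial>gauss n)" by (rule integral_abs_bound)
  also have "\<dots> \<le> (\<integral>x. 1 \<partial>gauss n)"
    using unit_fun_integrable[OF f] unit_funD[OF f] by (intro integral_mono) auto
  finally show ?thesis using gauss.prob_space by simp
qed

lemma integrable_unit_pair:
  assumes "F \<in> borel_measurable (gauss_sq n)" "\<And>p. p \<in> space (gauss_sq n) \<Longrightarrow> \<bar>F p :: real\<bar> \<le> 1"
  shows "integrable (gauss_sq n) F"
  using assms by (auto intro!: gauss_pair.P.integrable_const_bound[where B=1])

lemma lincomb_cong:
  assumes "\<And>i. i < n \<Longrightarrow> a * x i + b * y i = c * u i + d * v i"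
  shows "lincomb n a x b y = lincomb n c u d v"
  using assms by (auto simp: lincomb_def)

lemma lincomb_eq:
  assumes "u \<in> space (gauss n)" "\<And>i. i < n \<Longrightarrow> a * x i + b * y i = u i"
  shows "lincomb n a x b y = u"
  using assms by (auto simp: lincomb_def space_gauss PiE_def extensional_def fun_eq_iff)

lemma integral_gauss_rotation:
  fixes \<Phi> :: "_ \<Rightarrow> real"
  assumes "a\<^sup>2 + b\<^sup>2 = (1::real)" "b \<noteq> 0" and [measurable]: "\<Phi> \<in> borel_measurable (gauss_sq n)"
  shows "(\<integral>p. \<Phi> (lincomb n a (fst p) b (snd p), lincomb n b (fst p) (-a) (snd p)) \<partial>gauss_sq n) = (\<integral>p. \<Phi> p \<partial>gauss_sq n)"
proof -
  have "(\<integral>p. \<Phi> p \<partial>gauss_sq n)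
    = (\<integral>p. \<Phi> p \<partial>distr (gauss_sq n) (gauss_sq n) (\<lambda>(z, w). (lincomb n a z b w, lincomb n b z (-a) w)))"
    unfolding distr_gauss_rotation[OF assms(1,2)] ..
  also have "\<dots> = (\<integral>p. \<Phi> (case p of (z, w) \<Rightarrow> (lincomb n a z b w, lincomb n b z (-a) w)) \<partial>gauss_sq n)"
    by (rule integral_distr) measurable
  finally show ?thesis by (simp add: case_prod_unfold)
qed

lemma integral_gauss_sum:
  fixes h :: "_ \<Rightarrow> real"
  assumes "a\<^sup>2 + b\<^sup>2 = (1::real)" "b \<noteq> 0" and h: "unit_fun n h"
  shows "(\<integral>x. \<integral>y. h (lincomb n a x b y) \<partial>gauss n \<partial>gauss n) = (\<integral>x. h x \<partial>gauss n)"
proof -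
  note [measurable] = unit_funD(1)[OF h]
  have "(\<integral>p. h (lincomb n a (fst p) b (snd p)) \<partial>gauss_sq n) = (\<integral>p. h (fst p) * 1 \<partial>gauss_sq n)"
    using integral_gauss_rotation[OF assms(1,2), of "\<lambda>p. h (fst p)" n] by simp
  also have "\<dots> = (\<integral>x. h x \<partial>gauss n)"
    using integrable_product_pair(2)[of n h "\<lambda>_. 1", OF unit_fun_integrable[OF h]] gauss.prob_space by simp
  also have "(\<integral>p. h (lincomb n a (fst p) b (snd p)) \<partial>gauss_sq n) = (\<integral>x. \<integral>y. h (lincomb n a x b y) \<partial>gauss n \<partial>gauss n)"
    using unit_funD(2)[OF h] gauss_pair.integral_fst'[of n "\<lambda>p. h (lincomb n a (fst p) b (snd p))", OF integrable_unit_pair] by simp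
  finally show ?thesis .
qed

text \<open>Conditioning \<open>f X\<close> on the part \<open>z\<close> of \<open>X\<close> revealed by time \<open>t\<close> leaves a function of an independent
  standard Gaussian vector.\<close>

definition shiftf :: "nat \<Rightarrow> ((nat \<Rightarrow> real) \<Rightarrow> real) \<Rightarrow> real \<Rightarrow> (nat \<Rightarrow> real) \<Rightarrow> (nat \<Rightarrow> real) \<Rightarrow> real" where
  "shiftf n f t z x = f (lincomb n (sqrt t) z (sqrt (1 - t)) x)"

lemma measurable_shiftf:
  assumes "unit_fun n f"
  shows "(\<lambda>p. shiftf n f t (fst p) (snd p)) \<in> borel_measurable (gauss_sq n)"
proof -
  note [measurable] = unit_funD(1)[OF assms]
  show ?thesis unfolding shiftf_def by measurable
qed

lemma unit_fun_shiftf: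
  assumes "unit_fun n f" "z \<in> space (gauss n)"
  shows "unit_fun n (shiftf n f t z)"
proof -
  note [measurable] = unit_funD(1)[OF assms(1)] assms(2)
  show ?thesis unfolding shiftf_def unit_fun_def using unit_funD(2)[OF assms(1)] by auto
qed

lemma unit_fun_shiftf_integral:
  assumes "unit_fun n f"
  shows "unit_fun n (\<lambda>z. \<integral>x. shiftf n f t z x \<partial>gauss n)"
proof -
  have "(\<lambda>z. \<integral>x. shiftf n f t z x \<partial>gauss n) \<in> borel_measurable (gauss n)"
    using measurable_shiftf[OF assms, of t] by (intro gauss.borel_measurable_lebesgue_integral) (simp add: case_prod_unfold)
  then show ?thesis
    using unit_fun_integral_le[OF unit_fun_shiftf[OF assms]] by (simp add: unit_fun_def)
qed

lemma unit_fun_mult: "unit_fun n f \<Longrightarrow> unit_fun n g \<Longrightarrow> unit_fun n (\<lambda>x. f x * g x)"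
  by (auto simp: unit_fun_def abs_mult intro: mult_le_one)

text \<open>For nonnegative correlation \<open>X\<close> and \<open>Y\<close> may share the part
  \<open>sqrt s * z\<close> and be conditionally independent given \<open>z\<close>, so the form is
  an average of products of conditional means. Both the semigroup property and the comparison with
  the mean of \<open>f * g\<close> start from here.\<close>

lemma mform_eq_mixture:
  assumes f: "unit_fun n f" and g: "unit_fun n g" and s: "0 \<le> s" "s < 1/8"
  shows "mform n f g s = (\<integral>z. (\<integral>x. shiftf n f s z x \<partial>gauss n) * (\<integral>y. shiftf n g s z y \<partial>gauss n) \<partial>gauss n)"
proof -
  note [measurable] = unit_funD(1)[OF f] unit_funD(1)[OF g] measurable_shiftf[OF f, of s] measurable_shiftf[OF g, of s]
  let ?P = "gauss_sq n" and ?a = "sqrt s" and ?b = "sqrt (1 - s)"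
  define J where "J z = (\<integral>y. shiftf n g s z y \<partial>gauss n)" for z
  have J: "unit_fun n J" unfolding J_def by (rule unit_fun_shiftf_integral[OF g])
  note [measurable] = unit_funD(1)[OF J]
  define \<Psi> where "\<Psi> p = shiftf n f s (fst p) (snd p) * J (fst p)" for p
  have [measurable]: "\<Psi> \<in> borel_measurable ?P"
    unfolding \<Psi>_def by measurable
  have \<Psi>1: "\<bar>\<Psi> p\<bar> \<le> 1" if "p \<in> space ?P" for p
    using unit_funD(2)[OF J, of "fst p"] unit_funD(2)[OF unit_fun_shiftf[OF f], of "fst p" "snd p"] that
    by (auto simp: \<Psi>_def abs_mult intro!: mult_le_one)
  have ab: "?a\<^sup>2 + ?b\<^sup>2 = 1" "?b \<noteq> 0" "?b * ?b = 1 - s" "?a * ?a = s" using s by auto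
  have "(\<integral>z. (\<integral>x. shiftf n f s z x \<partial>gauss n) * J z \<partial>gauss n) = (\<integral>z. \<integral>x. \<Psi> (z, x) \<partial>gauss n \<partial>gauss n)"
    by (simp add: \<Psi>_def)
  also have "\<dots> = (\<integral>p. \<Psi> p \<partial>?P)"
    by (rule gauss_pair.integral_fst'[OF integrable_unit_pair]) (use \<Psi>1 in auto)
  \<comment> \<open>Rotating the pair (common part, remainder of \<open>X\<close>) makes
    \<open>X\<close> itself the first variable; the reflection being an involution, the argument of
    \<open>f\<close> collapses to \<open>fst p\<close>.\<close>
  also have "\<dots> = (\<integral>p. \<Psi> (lincomb n ?a (fst p) ?b (snd p), lincomb n ?b (fst p) (-?a) (snd p)) \<partial>?P)"
    by (rule integral_gauss_rotation[symmetric]) (use ab in auto)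
  also have "\<dots> = (\<integral>p. f (fst p) * J (lincomb n ?a (fst p) ?b (snd p)) \<partial>?P)"
  proof (rule Bochner_Integration.integral_cong[OF refl])
    fix p assume "p \<in> space ?P"
    then have "lincomb n ?a (lincomb n ?a (fst p) ?b (snd p)) ?b (lincomb n ?b (fst p) (- ?a) (snd p)) = fst p"
    proof (intro lincomb_eq)
      fix i assume "i < n"
      have "?a * (?a * x + ?b * y) + ?b * (?b * x + - ?a * y) = (?a * ?a + ?b * ?b) * x" for x y
        by (simp only: algebra_simps)
      then show "?a * lincomb n ?a (fst p) ?b (snd p) i + ?b * lincomb n ?b (fst p) (- ?a) (snd p) i = fst p i"
        using \<open>i < n\<close> ab by simp
    qed simp
    then show "\<Psi> (lincomb n ?a (fst p) ?b (snd p), lincomb n ?b (fst p) (-?a) (snd p)) = f (fst p) * J (lincomb n ?a (fst p) ?b (snd p))"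
      by (simp add: \<Psi>_def shiftf_def)
  qed
  also have "\<dots> = (\<integral>x. \<integral>w. f x * J (lincomb n ?a x ?b w) \<partial>gauss n \<partial>gauss n)"
    using gauss_pair.integral_fst'[of n "\<lambda>p. f (fst p) * J (lincomb n ?a (fst p) ?b (snd p))", OF integrable_unit_pair]
      unit_funD(2)[OF f] unit_funD(2)[OF J] by (simp add: abs_mult mult_le_one)
  also have "\<dots> = (\<integral>x. \<integral>y. f x * g (lincomb n s x (sqrt (1 - s\<^sup>2)) y) \<partial>gauss n \<partial>gauss n)"
  proof (rule Bochner_Integration.integral_cong[OF refl])
    fix x assume x[measurable]: "x \<in> space (gauss n)"
    define h where "h w = g (lincomb n s x (sqrt (1 - s\<^sup>2)) w)" for w
    have h: "unit_fun n h"
      unfolding h_def unit_fun_def using unit_funD(2)[OF g] by auto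
    \<comment> \<open>Given \<open>X = x\<close>, the rest of \<open>Y\<close> consists of the
      unknown part \<open>w\<close> of the common noise and its own noise \<open>y\<close>. These
      are their weights after dividing by the total standard deviation
      \<open>sqrt (1 - s\<^sup>2)\<close>.\<close>
    define \<alpha> \<beta> where "\<alpha> = ?a / sqrt (1 + s)" and "\<beta> = 1 / sqrt (1 + s)"
    have "\<alpha>\<^sup>2 + \<beta>\<^sup>2 = (s + 1) / (1 + s)"
      using s by (simp add: \<alpha>_def \<beta>_def power_divide add_divide_distrib)
    then have \<alpha>\<beta>: "\<alpha>\<^sup>2 + \<beta>\<^sup>2 = 1" "\<beta> \<noteq> 0" using s by (auto simp: \<beta>_def)
    have r: "sqrt (1 - s\<^sup>2) = ?b * sqrt (1 + s)"
      by (simp add: real_sqrt_mult[symmetric] power2_eq_square algebra_simps)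
    have c: "sqrt (1 - s\<^sup>2) * \<alpha> = ?b * ?a" "sqrt (1 - s\<^sup>2) * \<beta> = ?b"
      unfolding r using s by (auto simp: \<alpha>_def \<beta>_def)
    have "J (lincomb n ?a x ?b w) = (\<integral>y. h (lincomb n \<alpha> w \<beta> y) \<partial>gauss n)" for w
      unfolding J_def shiftf_def h_def
    proof (intro Bochner_Integration.integral_cong refl arg_cong[where f=g] lincomb_cong)
      fix i y assume "i < n"
      have "?a * (?a * u + ?b * v) + ?b * w = s * u + sqrt (1 - s\<^sup>2) * (\<alpha> * v + \<beta> * w)" for u v w
      proof -
        have "?a * (?a * u + ?b * v) + ?b * w = (?a * ?a) * u + (?b * ?a) * v + ?b * w" by (simp only: algebra_simps)
        moreover have "s * u + sqrt (1 - s\<^sup>2) * (\<alpha> * v + \<beta> * w) = s * u + (sqrt (1 - s\<^sup>2) * \<alpha>) * v + (sqrt (1 - s\<^sup>2) * \<beta>) * w"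
          by (simp only: algebra_simps)
        ultimately show ?thesis by (simp only: c ab)
      qed
      then show "?a * lincomb n ?a x ?b w i + ?b * y i = s * x i + sqrt (1 - s\<^sup>2) * lincomb n \<alpha> w \<beta> y i"
        using \<open>i < n\<close> by simp
    qed
    then show "(\<integral>w. f x * J (lincomb n ?a x ?b w) \<partial>gauss n) = (\<integral>y. f x * g (lincomb n s x (sqrt (1 - s\<^sup>2)) y) \<partial>gauss n)"
      using integral_gauss_sum[OF \<alpha>\<beta> h] by (simp add: h_def)
  qed
  also have "\<dots> = (\<integral>p. f (fst p) * g (lincomb n s (fst p) (sqrt (1 - s\<^sup>2)) (snd p)) \<partial>?P)"
    using gauss_pair.integral_fst'[of n "\<lambda>p. f (fst p) * g (lincomb n s (fst p) (sqrt (1 - s\<^sup>2)) (snd p))", OF integrable_unit_pair]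
      unit_funD(2)[OF f] unit_funD(2)[OF g] by (simp add: abs_mult mult_le_one)
  also have "\<dots> = mform n f g s"
    using mform_eq_correlated[OF f g] s by simp
  finally show ?thesis by (simp add: J_def)
qed

text \<open>Revealing a fraction \<open>t\<close> of the variance and then a fraction
  \<open>s\<close> of what is left amounts to revealing \<open>t + s * (1 - t)\<close> at once. The
  bounds 1/16 keep this below the 1/8 allowed for the kernel.\<close>

lemma mform_shift:
  assumes f: "unit_fun n f" and g: "unit_fun n g" and t: "0 \<le> t" "t < 1/16" and s: "0 \<le> s" "s < 1/16"
  shows "mform n f g (t + s * (1 - t)) = (\<integral>z. mform n (shiftf n f t z) (shiftf n g t z) s \<partial>gauss n)"
proof (cases "s = 0")
  case True
  then show ?thesis
    using t mform_eq_mixture[OF f g t(1)] by (simp add: mform_zero[OF unit_fun_shiftf[OF f] unit_fun_shiftf[OF g]] cong: Bochner_Integration.integral_cong)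
next
  case False
  define \<tau> where "\<tau> = t + s * (1 - t)"
  have "s * (1 - t) \<le> s * 1" using s t by (intro mult_left_mono) auto
  moreover have "s * (1 - t) > 0" using s t False by (intro mult_pos_pos) auto
  ultimately have \<tau>: "0 < \<tau>" "\<tau> < 1/8" using s t unfolding \<tau>_def by linarith+
  have \<tau>1: "1 - \<tau> = (1 - t) * (1 - s)" by (simp add: \<tau>_def algebra_simps)
  define h where "h z = (\<integral>x. shiftf n f \<tau> z x \<partial>gauss n) * (\<integral>y. shiftf n g \<tau> z y \<partial>gauss n)" for z
  have h: "unit_fun n h" unfolding h_def by (intro unit_fun_mult unit_fun_shiftf_integral f g)
  \<comment> \<open>Weights with which the two revealed pieces merge into one standard Gaussian
    vector. \<open>\<beta> \<noteq> 0\<close> requires \<open>s \<noteq> 0\<close>; for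
    \<open>s = 0\<close> the claim is the mixture formula itself.\<close>
  define \<alpha> \<beta> where "\<alpha> = sqrt t / sqrt \<tau>" and "\<beta> = sqrt ((1 - t) * s) / sqrt \<tau>"
  have "\<alpha>\<^sup>2 + \<beta>\<^sup>2 = (t + (1 - t) * s) / \<tau>"
    using s t \<tau> by (simp add: \<alpha>_def \<beta>_def power_divide add_divide_distrib)
  also have "t + (1 - t) * s = \<tau>" by (simp add: \<tau>_def)
  finally have \<alpha>\<beta>: "\<alpha>\<^sup>2 + \<beta>\<^sup>2 = 1" "\<beta> \<noteq> 0" using \<tau> False t by (auto simp: \<beta>_def)
  have c: "sqrt \<tau> * \<alpha> = sqrt t" "sqrt \<tau> * \<beta> = sqrt (1 - t) * sqrt s" "sqrt (1 - \<tau>) = sqrt (1 - t) * sqrt (1 - s)"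
    using \<tau> by (auto simp: \<alpha>_def \<beta>_def \<tau>1 real_sqrt_mult)
  have sh: "shiftf n (shiftf n k t z) s w x = shiftf n k \<tau> (lincomb n \<alpha> z \<beta> w) x" for k z w x
    unfolding shiftf_def
  proof (intro arg_cong[where f=k] lincomb_cong)
    fix i assume "i < n"
    have "sqrt t * z + sqrt (1 - t) * (sqrt s * w + sqrt (1 - s) * x) = sqrt \<tau> * (\<alpha> * z + \<beta> * w) + sqrt (1 - \<tau>) * x" for z w x
    proof -
      have "sqrt \<tau> * (\<alpha> * z + \<beta> * w) + sqrt (1 - \<tau>) * x = (sqrt \<tau> * \<alpha>) * z + (sqrt \<tau> * \<beta>) * w + sqrt (1 - \<tau>) * x"
        by (simp only: algebra_simps)
      then show ?thesis unfolding c by (simp only: algebra_simps)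
    qed
    then show "sqrt t * z i + sqrt (1 - t) * lincomb n (sqrt s) w (sqrt (1 - s)) x i = sqrt \<tau> * lincomb n \<alpha> z \<beta> w i + sqrt (1 - \<tau>) * x i"
      using \<open>i < n\<close> by simp
  qed
  have "mform n f g \<tau> = (\<integral>z. h z \<partial>gauss n)"
    unfolding h_def by (rule mform_eq_mixture[OF f g]) (use \<tau> in auto)
  also have "\<dots> = (\<integral>z. \<integral>w. h (lincomb n \<alpha> z \<beta> w) \<partial>gauss n \<partial>gauss n)"
    by (rule integral_gauss_sum[OF \<alpha>\<beta> h, symmetric])
  also have "\<dots> = (\<integral>z. mform n (shiftf n f t z) (shiftf n g t z) s \<partial>gauss n)"
  proof (rule Bochner_Integration.integral_cong[OF refl])
    fix z assume z: "z \<in> space (gauss n)"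
    show "(\<integral>w. h (lincomb n \<alpha> z \<beta> w) \<partial>gauss n) = mform n (shiftf n f t z) (shiftf n g t z) s"
      using mform_eq_mixture[OF unit_fun_shiftf[OF f z] unit_fun_shiftf[OF g z], of s t t] s
      by (simp add: sh h_def)
  qed
  finally show ?thesis by (simp add: \<tau>_def)
qed

text \<open>The identity \<open>mform_shift\<close> involves square roots and holds for \<open>s \<ge> 0\<close> only; the next lemma still
  lets it be differentiated at \<open>s = 0\<close>.\<close>

lemma DERIV_eq_zero_right:
  assumes "(H has_real_derivative d) (at s)" "e > 0" "\<And>x. s \<le> x \<Longrightarrow> x < s + e \<Longrightarrow> H x = 0"
  shows "d = 0"
proof -
  have "((\<lambda>y. (H y - H s) / (y - s)) \<longlongrightarrow> d) (at_right s)"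
    using has_field_derivative_at_within[OF assms(1), of "{s<..}"] by (simp add: has_field_derivative_iff)
  moreover have "\<forall>\<^sub>F y in at_right s. (H y - H s) / (y - s) = 0"
    using assms by (intro eventually_at_rightI[of s "s + e"]) auto
  then have "((\<lambda>y. (H y - H s) / (y - s)) \<longlongrightarrow> 0) (at_right s)"
    by (rule tendsto_eventually)
  ultimately show ?thesis
    using tendsto_unique[OF trivial_limit_at_right_real] by blast
qed

lemma measurable_mform_shiftf:
  assumes f: "unit_fun n f" and g: "unit_fun n g" and [measurable]: "K \<in> borel_measurable (gauss_sq n)"
  shows "(\<lambda>z. \<integral>p. shiftf n f t z (fst p) * shiftf n g t z (snd p) * K p \<partial>gauss_sq n) \<in> borel_measurable (gauss n)"
proof -
  note [measurable] = unit_funD(1)[OF f] unit_funD(1)[OF g]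
  show ?thesis
    unfolding shiftf_def by measurable
qed

text \<open>The semigroup identity differentiated in \<open>s\<close> at 0, with a factor
  \<open>1 - t\<close> per derivative from the chain rule. A derivative at time \<open>t\<close>
  thus becomes an average of derivatives at time 0, which are inner products of Hermite
  tensors.\<close>

lemma mform_derivatives_shift:
  assumes f: "unit_fun n f" and g: "unit_fun n g" and t: "0 \<le> t" "t < 1/16"
  shows "mform' n f g t * (1 - t) = (\<integral>z. mform' n (shiftf n f t z) (shiftf n g t z) 0 \<partial>gauss n)"
    "mform'' n f g t * (1 - t)\<^sup>2 = (\<integral>z. mform'' n (shiftf n f t z) (shiftf n g t z) 0 \<partial>gauss n)"
proof -
  define W where "W = (\<integral>p. mehler_bound n p \<partial>gauss_sq n)"
  define M M' M'' where "M s z = mform n (shiftf n f t z) (shiftf n g t z) s"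
    and "M' s z = mform' n (shiftf n f t z) (shiftf n g t z) s"
    and "M'' s z = mform'' n (shiftf n f t z) (shiftf n g t z) s" for s z
  have meas: "M s \<in> borel_measurable (gauss n)" "M' s \<in> borel_measurable (gauss n)" "M'' s \<in> borel_measurable (gauss n)" for s
    unfolding M_def[abs_def] M'_def[abs_def] M''_def[abs_def] mform_def mform'_def mform''_def
    by (intro measurable_mform_shiftf f g measurable_mehler)+
  have bnd: "\<bar>M s z\<bar> \<le> W" "\<bar>M' s z\<bar> \<le> W" "\<bar>M'' s z\<bar> \<le> W" if "\<bar>s\<bar> < 1/8" "z \<in> space (gauss n)" for s z
    unfolding M_def M'_def M''_def mform_def mform'_def mform''_def W_def
    using that by (intro mform_integrand(3) unit_fun_shiftf f g measurable_mehler mehler_le_bound; simp)+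
  have int: "integrable (gauss n) (M s)" "integrable (gauss n) (M' s)" if "\<bar>s\<bar> < 1/8" for s
    using meas bnd[OF that] by (auto intro!: gauss.integrable_const_bound[where B=W])
  have dM: "((\<lambda>s. M s z) has_real_derivative M' s z) (at s)" "((\<lambda>s. M' s z) has_real_derivative M'' s z) (at s)"
    if "\<bar>s\<bar> < 1/8" "z \<in> space (gauss n)" for s z
    unfolding M_def M'_def M''_def
    by (intro DERIV_mform unit_fun_shiftf f g that)+
  have D1: "((\<lambda>s. \<integral>z. M s z \<partial>gauss n) has_real_derivative (\<integral>z. M' s z \<partial>gauss n)) (at s)" if "\<bar>s\<bar> < 1/8" for s
    by (rule has_real_derivative_integral[where r="1/8" and W="\<lambda>_. W"])
       (use that int meas bnd dM in auto)
  have D2: "((\<lambda>s. \<integral>z. M' s z \<partial>gauss n) has_real_derivative (\<integral>z. M'' s z \<partial>gauss n)) (at s)" if "\<bar>s\<bar> < 1/8" for s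
    by (rule has_real_derivative_integral[where r="1/8" and W="\<lambda>_. W"])
       (use that int meas bnd dM in auto)
  have \<tau>: "\<bar>t + s * (1 - t)\<bar> < 1/8" if "0 \<le> s" "s < 1/16" for s
  proof -
    have "s * (1 - t) \<le> s * 1" using that t by (intro mult_left_mono) auto
    moreover have "0 \<le> s * (1 - t)" using that t by (intro mult_nonneg_nonneg) auto
    ultimately show ?thesis using that t by linarith
  qed
  have lin: "((\<lambda>s. t + s * (1 - t)) has_real_derivative (1 - t)) (at s)" for s
    by (auto intro!: derivative_eq_intros)
  define H where "H s = mform n f g (t + s * (1 - t)) - (\<integral>z. M s z \<partial>gauss n)" for s
  define H' where "H' s = mform' n f g (t + s * (1 - t)) * (1 - t) - (\<integral>z. M' s z \<partial>gauss n)" for s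
  have H0: "H s = 0" if "0 \<le> s" "s < 1/16" for s
    using mform_shift[OF f g t that] by (simp add: H_def M_def)
  have DH: "(H has_real_derivative H' s) (at s)" if "0 \<le> s" "s < 1/16" for s
    unfolding H_def[abs_def] H'_def
    by (intro DERIV_diff D1 DERIV_chain2[OF DERIV_mform(1)[OF f g \<tau>[OF that]] lin]) (use that in auto)
  \<comment> \<open>The first derivative has to vanish on the whole interval, not only at 0, so that
    the one-sided argument can be repeated for \<open>H'\<close>.\<close>
  have H'0: "H' s = 0" if "0 \<le> s" "s < 1/16" for s
    by (rule DERIV_eq_zero_right[OF DH[OF that], of "1/16 - s"]) (use that H0 in auto)
  from H'0[of 0] show "mform' n f g t * (1 - t) = (\<integral>z. mform' n (shiftf n f t z) (shiftf n g t z) 0 \<partial>gauss n)"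
    by (simp add: H'_def M'_def)
  have "(H' has_real_derivative (mform'' n f g (t + 0 * (1 - t)) * (1 - t)) * (1 - t) - (\<integral>z. M'' 0 z \<partial>gauss n)) (at 0)"
    unfolding H'_def[abs_def]
    by (intro DERIV_diff D2 DERIV_cmult_right DERIV_chain2[OF DERIV_mform(2)[OF f g \<tau>] lin]) auto
  from DERIV_eq_zero_right[OF this, of "1/16"] H'0
  show "mform'' n f g t * (1 - t)\<^sup>2 = (\<integral>z. mform'' n (shiftf n f t z) (shiftf n g t z) 0 \<partial>gauss n)"
    by (simp add: M''_def power2_eq_square mult.assoc)
qed

section \<open>Increasing functions\<close>

text \<open>For two independent copies \<open>x\<close> and \<open>y\<close> the product
  \<open>(u x - u y) * (v x - v y)\<close> is nonnegative, and its mean is twice the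
  covariance.\<close>

lemma chebyshev_correlation:
  fixes u v :: "real \<Rightarrow> real" and M :: "real measure"
  assumes "prob_space M" "sets M = sets borel" and u: "mono u" "\<And>x. \<bar>u x\<bar> \<le> 1" and v: "mono v" "\<And>x. \<bar>v x\<bar> \<le> 1"
  shows "integral\<^sup>L M u * integral\<^sup>L M v \<le> integral\<^sup>L M (\<lambda>x. u x * v x)"
proof -
  interpret prob_space M by fact
  have [measurable]: "u \<in> borel_measurable M" "v \<in> borel_measurable M"
    using borel_measurable_mono[OF u(1)] borel_measurable_mono[OF v(1)] assms(2) by (simp_all cong: measurable_cong_sets)
  have int: "integrable M u" "integrable M v" "integrable M (\<lambda>x. u x * v x)"
    using u v by (auto intro!: integrable_const_bound[where B=1] AE_I2 simp: abs_mult mult_le_one)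
  have "0 \<le> integral\<^sup>L M (\<lambda>x. integral\<^sup>L M (\<lambda>y. (u x - u y) * (v x - v y)))"
  proof (intro Bochner_Integration.integral_nonneg)
    fix x y
    show "0 \<le> (u x - u y) * (v x - v y)"
      using monoD[OF u(1), of x y] monoD[OF u(1), of y x] monoD[OF v(1), of x y] monoD[OF v(1), of y x]
      by (cases "x \<le> y") (auto intro: mult_nonpos_nonpos mult_nonneg_nonneg)
  qed
  also have "\<dots> = integral\<^sup>L M (\<lambda>x. u x * v x - u x * integral\<^sup>L M v - v x * integral\<^sup>L M u + integral\<^sup>L M (\<lambda>y. u y * v y))"
  proof (intro Bochner_Integration.integral_cong refl)
    fix x
    have "(u x - u y) * (v x - v y) = u x * v x - u x * v y - v x * u y + u y * v y" for y
      by (simp add: algebra_simps)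
    then show "integral\<^sup>L M (\<lambda>y. (u x - u y) * (v x - v y)) = u x * v x - u x * integral\<^sup>L M v - v x * integral\<^sup>L M u + integral\<^sup>L M (\<lambda>y. u y * v y)"
      using int prob_space by simp
  qed
  also have "\<dots> = 2 * integral\<^sup>L M (\<lambda>x. u x * v x) - 2 * (integral\<^sup>L M u * integral\<^sup>L M v)"
    using int prob_space by simp
  finally show ?thesis by simp
qed

lemma gauss_Suc: "gauss (Suc n) = PiM (insert n {..<n}) (\<lambda>_. gauss1)"
  by (simp add: gauss_def lessThan_Suc)

lemma measurable_gauss_upd:
  "(\<lambda>p. (fst p)(n := snd p)) \<in> gauss n \<Otimes>\<^sub>M gauss1 \<rightarrow>\<^sub>M gauss (Suc n)"
  unfolding gauss_Suc unfolding gauss_def by measurable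

lemma upd_in_space: "x \<in> space (gauss n) \<Longrightarrow> x(n := y) \<in> space (gauss (Suc n))"
  by (auto simp: space_gauss PiE_def extensional_def)

text \<open>Averaging over the last coordinate preserves monotonicity, so the induction hypothesis
  applies to the averages; for fixed other coordinates the remaining step is the one-dimensional
  correlation inequality.\<close>

lemma harris_inequality_gauss:
  assumes "unit_fun n f" "unit_fun n g" "increasing_Rn n f" "increasing_Rn n g"
  shows "(\<integral>x. f x \<partial>gauss n) * (\<integral>x. g x \<partial>gauss n) \<le> (\<integral>x. f x * g x \<partial>gauss n)"
  using assms
proof (induction n arbitrary: f g)
  case 0
  \<comment> \<open>In dimension 0 the space has a single point, the everywhere undefined
    function.\<close>
  have "(\<integral>x. F x \<partial>gauss 0) = F (\<lambda>_. undefined)" for F :: "_ \<Rightarrow> real"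
  proof -
    have "(\<integral>x. F x \<partial>gauss 0) = (\<integral>x. F (\<lambda>_. undefined) \<partial>gauss 0)"
      by (rule Bochner_Integration.integral_cong) (auto simp: space_gauss)
    then show ?thesis using gauss.prob_space by simp
  qed
  then show ?case by simp
next
  case (Suc n)
  define av where "av F x = (\<integral>y. F (x(n := y)) \<partial>gauss1)" for F :: "(nat \<Rightarrow> real) \<Rightarrow> real" and x
  have split: "(\<integral>x. F x \<partial>gauss (Suc n)) = (\<integral>x. av F x \<partial>gauss n)" if "unit_fun (Suc n) F" for F
    using gausses.product_integral_insert[of "{..<n}" n F] unit_fun_integrable[OF that]
    by (simp add: av_def gauss_def lessThan_Suc)
  have meas: "(\<lambda>y. F (x(n := y))) \<in> borel_measurable gauss1" if F: "unit_fun (Suc n) F" and x[measurable]: "x \<in> space (gauss n)" for F x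
  proof -
    have "(\<lambda>y. (x, y)) \<in> gauss1 \<rightarrow>\<^sub>M gauss n \<Otimes>\<^sub>M gauss1" by measurable
    from measurable_compose[OF measurable_compose[OF this measurable_gauss_upd] unit_funD(1)[OF F]]
    show ?thesis by simp
  qed
  have int: "integrable gauss1 (\<lambda>y. F (x(n := y)))" if F: "unit_fun (Suc n) F" and x: "x \<in> space (gauss n)" for F x
    using meas[OF that] unit_funD(2)[OF F upd_in_space[OF x]] by (auto intro!: gauss1.integrable_const_bound[where B=1])
  have unit_av: "unit_fun n (av F)" if F: "unit_fun (Suc n) F" for F
    unfolding unit_fun_def
  proof (intro conjI ballI)
    have "(\<lambda>p. F ((fst p)(n := snd p))) \<in> borel_measurable (gauss n \<Otimes>\<^sub>M gauss1)"
      by (rule measurable_compose[OF measurable_gauss_upd unit_funD(1)[OF F]])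
    then show "av F \<in> borel_measurable (gauss n)"
      unfolding av_def[abs_def] by (intro gauss1.borel_measurable_lebesgue_integral) (simp add: case_prod_unfold)
    fix x assume x: "x \<in> space (gauss n)"
    have "\<bar>av F x\<bar> \<le> (\<integral>y. \<bar>F (x(n := y))\<bar> \<partial>gauss1)" unfolding av_def by (rule integral_abs_bound)
    also have "\<dots> \<le> (\<integral>y. 1 \<partial>gauss1)"
      using int[OF F x] unit_funD(2)[OF F upd_in_space[OF x]] by (intro integral_mono) auto
    finally show "\<bar>av F x\<bar> \<le> 1" using gauss1.prob_space by simp
  qed
  have mono_last: "mono (\<lambda>y. F (x(n := y)))" if "increasing_Rn (Suc n) F" "x \<in> space (gauss n)" for F x
  proof (rule monoI)
    fix y y' :: real assume "y \<le> y'"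
    with that upd_in_space[OF that(2), of y] show "F (x(n := y)) \<le> F (x(n := y'))"
      unfolding increasing_Rn_def space_gauss by (metis fun_upd_same fun_upd_upd lessI)
  qed
  have incr_av: "increasing_Rn n (av F)" if F: "unit_fun (Suc n) F" "increasing_Rn (Suc n) F" for F
    unfolding increasing_Rn_def
  proof (intro ballI allI impI)
    fix x i t assume x: "x \<in> Rn n" and i: "i < n" and t: "x i \<le> t"
    have x': "x \<in> space (gauss n)" "x(i := t) \<in> space (gauss n)"
      using x i by (auto simp: space_gauss PiE_def extensional_def)
    show "av F x \<le> av F (x(i := t))"
      unfolding av_def
    proof (intro integral_mono int F x')
      fix y
      have "(x(n := y)) i \<le> t" "x(n := y) \<in> Rn (Suc n)"
        using i t upd_in_space[OF x'(1), of y] by (auto simp: space_gauss)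
      then have "F (x(n := y)) \<le> F ((x(n := y))(i := t))"
        using F(2) i unfolding increasing_Rn_def by (simp add: less_Suc_eq)
      then show "F (x(n := y)) \<le> F ((x(i := t))(n := y))"
        using i by (simp add: fun_upd_twist)
    qed
  qed
  have "(\<integral>x. f x \<partial>gauss (Suc n)) * (\<integral>x. g x \<partial>gauss (Suc n)) = (\<integral>x. av f x \<partial>gauss n) * (\<integral>x. av g x \<partial>gauss n)"
    using split Suc.prems by simp
  also have "\<dots> \<le> (\<integral>x. av f x * av g x \<partial>gauss n)"
    using Suc.prems by (intro Suc.IH unit_av incr_av) auto
  also have "\<dots> \<le> (\<integral>x. av (\<lambda>x. f x * g x) x \<partial>gauss n)"
  proof (rule integral_mono)
    show "integrable (gauss n) (\<lambda>x. av f x * av g x)" "integrable (gauss n) (av (\<lambda>x. f x * g x))"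
      using Suc.prems by (auto intro!: unit_fun_integrable unit_fun_mult unit_av)
    fix x assume x: "x \<in> space (gauss n)"
    show "av f x * av g x \<le> av (\<lambda>x. f x * g x) x"
      unfolding av_def
      by (rule chebyshev_correlation[OF prob_space_gauss1 sets_gauss1
            mono_last[OF Suc.prems(3) x] unit_funD(2)[OF Suc.prems(1) upd_in_space[OF x]]
            mono_last[OF Suc.prems(4) x] unit_funD(2)[OF Suc.prems(2) upd_in_space[OF x]]])
  qed
  also have "\<dots> = (\<integral>x. f x * g x \<partial>gauss (Suc n))"
    using split[OF unit_fun_mult[OF Suc.prems(1,2)]] by simp
  finally show ?case .
qed

lemma increasing_shiftf:
  assumes "increasing_Rn n f" and t: "t \<le> 1"
  shows "increasing_Rn n (shiftf n f t z)"
  unfolding increasing_Rn_def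
proof (intro ballI allI impI)
  fix x i u assume x: "x \<in> Rn n" and i: "i < n" and u: "x i \<le> u"
  let ?l = "lincomb n (sqrt t) z (sqrt (1 - t))"
  have "?l (x(i := u)) = (?l x)(i := sqrt t * z i + sqrt (1 - t) * u)"
    using i by (auto simp: lincomb_def fun_eq_iff)
  moreover have "?l x \<in> Rn n" using lincomb_in_space by (simp add: space_gauss)
  moreover have "?l x i \<le> sqrt t * z i + sqrt (1 - t) * u"
    using i u t by (simp add: mult_left_mono)
  ultimately show "shiftf n f t z x \<le> shiftf n f t z (x(i := u))"
    using assms(1) i unfolding increasing_Rn_def shiftf_def by metis
qed

text \<open>Harris' inequality conditionally on the common part: given \<open>z\<close>, the product
  of the two conditional means is at most the conditional mean of the product.\<close>

lemma mform_le_integral_mult: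
  assumes f: "unit_fun n f" "increasing_Rn n f" and g: "unit_fun n g" "increasing_Rn n g" and s: "0 \<le> s" "s < 1/8"
  shows "mform n f g s \<le> (\<integral>x. f x * g x \<partial>gauss n)"
proof -
  note fg = unit_fun_mult[OF f(1) g(1)]
  have eq: "shiftf n (\<lambda>x. f x * g x) s z x = shiftf n f s z x * shiftf n g s z x" for z x
    by (simp add: shiftf_def)
  have "mform n f g s = (\<integral>z. (\<integral>x. shiftf n f s z x \<partial>gauss n) * (\<integral>y. shiftf n g s z y \<partial>gauss n) \<partial>gauss n)"
    by (rule mform_eq_mixture[OF f(1) g(1) s])
  also have "\<dots> \<le> (\<integral>z. \<integral>x. shiftf n (\<lambda>x. f x * g x) s z x \<partial>gauss n \<partial>gauss n)"
  proof (rule integral_mono)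
    show "integrable (gauss n) (\<lambda>z. (\<integral>x. shiftf n f s z x \<partial>gauss n) * (\<integral>y. shiftf n g s z y \<partial>gauss n))"
      by (intro unit_fun_integrable unit_fun_mult unit_fun_shiftf_integral f g)
    show "integrable (gauss n) (\<lambda>z. \<integral>x. shiftf n (\<lambda>x. f x * g x) s z x \<partial>gauss n)"
      by (intro unit_fun_integrable unit_fun_shiftf_integral fg)
    fix z assume "z \<in> space (gauss n)"
    then show "(\<integral>x. shiftf n f s z x \<partial>gauss n) * (\<integral>y. shiftf n g s z y \<partial>gauss n) \<le> (\<integral>x. shiftf n (\<lambda>x. f x * g x) s z x \<partial>gauss n)"
      unfolding eq using s by (intro harris_inequality_gauss unit_fun_shiftf increasing_shiftf f g) auto
  qed
  also have "\<dots> = (\<integral>x. f x * g x \<partial>gauss n)"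
    unfolding shiftf_def by (rule integral_gauss_sum[OF _ _ fg]) (use s in auto)
  finally show ?thesis .
qed

text \<open>Along one coordinate, \<open>y\<close> has mean 0, so \<open>v 0\<close> may be
  subtracted from the monotone section \<open>v\<close>; then \<open>y * (v y - v 0)\<close> is
  pointwise nonnegative.\<close>

lemma herm1_nonneg:
  assumes u: "unit_fun n u" "increasing_Rn n u" and i: "i < n"
  shows "herm1 n u i \<ge> 0"
proof -
  let ?I = "{..<n} - {i}"
  note [measurable] = unit_funD(1)[OF u(1)] i
  have g: "gauss n = PiM (insert i ?I) (\<lambda>_. gauss1)" using i by (simp add: gauss_def insert_absorb)
  have "integrable (gauss n) (\<lambda>x. x i * u x)"
    by (rule integrable_bounded_mult_coordinate[OF unit_funD[OF u(1)] i])
  then have "herm1 n u i = (\<integral>x. \<integral>y. (x(i := y)) i * u (x(i := y)) \<partial>gauss1 \<partial>PiM ?I (\<lambda>_. gauss1))"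
    using gausses.product_integral_insert[of ?I i "\<lambda>x. x i * u x"] by (simp add: herm1_def gauss_def insert_absorb i)
  also have "\<dots> \<ge> 0"
  proof (rule Bochner_Integration.integral_nonneg)
    fix x assume "x \<in> space (PiM ?I (\<lambda>_. gauss1))"
    then have x: "x(i := y) \<in> space (gauss n)" for y
      using i by (auto simp: space_gauss space_PiM PiE_def extensional_def)
    define v where "v y = u (x(i := y))" for y
    have "mono v"
      unfolding v_def
    proof (rule monoI)
      fix y y' :: real assume "y \<le> y'"
      with u(2) x[of y] i show "u (x(i := y)) \<le> u (x(i := y'))"
        unfolding increasing_Rn_def space_gauss by (metis fun_upd_same fun_upd_upd)
    qed
    have [measurable]: "v \<in> borel_measurable gauss1"
      using borel_measurable_mono[OF \<open>mono v\<close>] by (simp cong: measurable_cong_sets)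
    have v_le: "\<bar>v y\<bar> \<le> 1" for y
      using unit_funD(2)[OF u(1) x] by (simp add: v_def)
    have int_v: "integrable gauss1 (\<lambda>y. y * v y)"
      by (rule Bochner_Integration.integrable_bound[OF gauss1_moments(1)])
         (use v_le borel_measurable_times[OF measurable_ident_sets[OF sets_gauss1] \<open>v \<in> _\<close>] in \<open>auto intro!: AE_I2 simp: abs_mult mult_left_le\<close>)
    have "0 \<le> (\<integral>y. y * (v y - v 0) \<partial>gauss1)"
    proof (rule Bochner_Integration.integral_nonneg)
      fix y :: real
      show "0 \<le> y * (v y - v 0)"
        using monoD[OF \<open>mono v\<close>, of 0 y] monoD[OF \<open>mono v\<close>, of y 0]
        by (cases "0 \<le> y") (auto intro: mult_nonpos_nonpos mult_nonneg_nonneg)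
    qed
    also have "\<dots> = (\<integral>y. y * v y \<partial>gauss1)"
      using int_v gauss1_moments(1,2) by (simp add: right_diff_distrib)
    finally show "0 \<le> (\<integral>y. (x(i := y)) i * u (x(i := y)) \<partial>gauss1)" by (simp add: v_def)
  qed
  finally show ?thesis .
qed

section \<open>The differential inequality\<close>

text \<open>Up to a constant, \<open>halfgrad n f i\<close> is the \<open>i\<close>-th partial derivative of \<open>f\<close> smoothed by half of the
  Gaussian noise. The derivative of \<open>f\<close> itself is only a measure, and its entropy may be infinite.\<close>

definition halfgrad :: "nat \<Rightarrow> ((nat \<Rightarrow> real) \<Rightarrow> real) \<Rightarrow> nat \<Rightarrow> (nat \<Rightarrow> real) \<Rightarrow> real" where
  "halfgrad n f i x = herm1 n (shiftf n f (1/2) x) i"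

text \<open>Bessel's inequality for the conditioned function. This pointwise bound, uniform in the
  dimension, is the only normalization of the derivatives that the entropy estimate
  receives.\<close>

lemma halfgrad_square_sum:
  assumes f: "unit_fun n f" and x: "x \<in> space (gauss n)"
  shows "(\<Sum>i<n. (halfgrad n f i x)\<^sup>2) \<le> 1"
proof -
  note u = unit_fun_shiftf[OF f x, of "1/2"]
  have "(\<Sum>i<n. (halfgrad n f i x)\<^sup>2) \<le> (\<integral>y. (shiftf n f (1/2) x y)\<^sup>2 \<partial>gauss n)"
    unfolding halfgrad_def herm1_def by (rule bessel_inequality_gauss[OF unit_funD[OF u]])
  also have "\<dots> \<le> 1"
    using unit_fun_integral_le[OF unit_fun_mult[OF u u]] by (simp add: power2_eq_square)
  finally show ?thesis .
qed

lemma unit_fun_halfgrad: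
  assumes f: "unit_fun n f" and i: "i < n"
  shows "unit_fun n (halfgrad n f i)"
  unfolding unit_fun_def
proof (intro conjI ballI)
  note [measurable] = unit_funD(1)[OF f] i
  show "halfgrad n f i \<in> borel_measurable (gauss n)"
    unfolding halfgrad_def[abs_def] herm1_def shiftf_def by measurable
  fix x assume "x \<in> space (gauss n)"
  from halfgrad_square_sum[OF f this] have "(halfgrad n f i x)\<^sup>2 \<le> 1"
    using i by (intro order.trans[OF member_le_sum[of i "{..<n}" "\<lambda>i. (halfgrad n f i x)\<^sup>2"]]) auto
  then show "\<bar>halfgrad n f i x\<bar> \<le> 1"
    by (simp add: abs_square_le_1)
qed

lemma halfgrad_nonneg:
  assumes f: "unit_fun n f" "increasing_Rn n f" and i: "i < n" and x: "x \<in> space (gauss n)"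
  shows "halfgrad n f i x \<ge> 0"
  unfolding halfgrad_def by (intro herm1_nonneg unit_fun_shiftf increasing_shiftf assms) auto

lemma integrable_coordinate_pair:
  assumes [measurable]: "F \<in> borel_measurable (gauss_sq n)"
    and F: "\<And>p. p \<in> space (gauss_sq n) \<Longrightarrow> \<bar>F p :: real\<bar> \<le> 1" and i: "i < n"
  shows "integrable (gauss_sq n) (\<lambda>p. fst p i * F p)" "integrable (gauss_sq n) (\<lambda>p. snd p i * F p)"
proof -
  note [measurable] = i
  have 1: "integrable (gauss_sq n) (\<lambda>p. fst p i * 1)"
    using gauss_moments(1)[OF i i] gauss.integrable_const by (rule integrable_product_pair(1))
  have 2: "integrable (gauss_sq n) (\<lambda>p. 1 * snd p i)"
    using gauss.integrable_const gauss_moments(1)[OF i i] by (rule integrable_product_pair(1))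
  show "integrable (gauss_sq n) (\<lambda>p. fst p i * F p)"
    by (rule Bochner_Integration.integrable_bound[OF 1]) (use F in \<open>auto intro!: AE_I2 simp: abs_mult mult_left_le\<close>)
  show "integrable (gauss_sq n) (\<lambda>p. snd p i * F p)"
    by (rule Bochner_Integration.integrable_bound[OF 2]) (use F in \<open>auto intro!: AE_I2 simp: abs_mult mult_left_le\<close>)
qed

text \<open>\<open>halfgrad\<close> is a function of a vector carrying half of the variance, so
  revealing the fraction \<open>2 * t\<close> of that vector reveals \<open>t\<close> of the whole.
  Averaging out the remaining noise recovers the first Hermite tensor of \<open>f\<close>
  conditioned at time \<open>t\<close>, up to the weight \<open>b\<close> of \<open>y\<close> in the
  unrevealed part.\<close>

lemma herm1_eq_integral_halfgrad:
  assumes f: "unit_fun n f" and i: "i < n" and t: "0 \<le> t" "t < 1/16" and z[measurable]: "z \<in> space (gauss n)"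
  shows "(\<integral>x. shiftf n (halfgrad n f i) (2 * t) z x \<partial>gauss n) = herm1 n (shiftf n f t z) i / sqrt (2 * (1 - t))"
proof -
  note [measurable] = unit_funD(1)[OF f] i
  let ?P = "gauss_sq n"
  \<comment> \<open>Of the unrevealed variance \<open>1 - t\<close>, the part
    \<open>(1 - 2 * t) / 2\<close> sits in the argument of \<open>halfgrad\<close> and the part
    \<open>1 / 2\<close> in the noise it averages over; \<open>a\<^sup>2\<close> and
    \<open>b\<^sup>2\<close> are the shares.\<close>
  define a b where "a = sqrt ((1 - 2 * t) / 2) / sqrt (1 - t)" and "b = sqrt (1 / 2) / sqrt (1 - t)"
  have "a\<^sup>2 + b\<^sup>2 = ((1 - 2 * t) / 2 + 1 / 2) / (1 - t)"
    using t by (simp only: a_def b_def power_divide) (simp add: add_divide_distrib real_sqrt_pow2)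
  also have "(1 - 2 * t) / 2 + 1 / 2 = 1 - t" by (simp add: field_simps)
  finally have ab: "a\<^sup>2 + b\<^sup>2 = 1" "b \<noteq> 0" using t by (auto simp: b_def)
  have ab': "a * a + b * b = 1" using ab by (simp add: power2_eq_square)
  have "sqrt (1/2) * sqrt (1 - 2 * t) = sqrt ((1 - 2 * t) / 2)" "sqrt (1/2) * sqrt (2 * t) = sqrt t"
    by (simp_all only: real_sqrt_mult[symmetric]) simp_all
  moreover have "sqrt (1 - t) * (X / sqrt (1 - t)) = X" for X using t by simp
  ultimately have c: "sqrt (1 - t) * a = sqrt (1/2) * sqrt (1 - 2 * t)" "sqrt (1 - t) * b = sqrt (1/2)" "sqrt (1/2) * sqrt (2 * t) = sqrt t"
    by (simp_all only: a_def b_def)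
  have b: "b = 1 / sqrt (2 * (1 - t))"
    by (simp only: b_def real_sqrt_divide real_sqrt_mult real_sqrt_one divide_divide_eq_left)
  define u where "u = shiftf n f t z"
  have u: "unit_fun n u" unfolding u_def by (rule unit_fun_shiftf[OF f z])
  note [measurable] = unit_funD(1)[OF u]
  have h: "shiftf n (halfgrad n f i) (2 * t) z x = (\<integral>y. y i * u (lincomb n a x b y) \<partial>gauss n)" for x
    unfolding shiftf_def[of n "halfgrad n f i"] halfgrad_def herm1_def u_def
  proof (intro Bochner_Integration.integral_cong refl arg_cong2[where f="(*)"])
    fix y
    show "shiftf n f (1/2) (lincomb n (sqrt (2 * t)) z (sqrt (1 - 2 * t)) x) y = shiftf n f t z (lincomb n a x b y)"
      unfolding shiftf_def
    proof (intro arg_cong[where f=f] lincomb_cong)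
      fix j assume "j < n"
      have "sqrt (1/2) * (sqrt (2 * t) * z + sqrt (1 - 2 * t) * x) + sqrt (1/2) * y = sqrt t * z + sqrt (1 - t) * (a * x + b * y)" for x y z
      proof -
        have "sqrt (1/2) * (sqrt (2 * t) * z + sqrt (1 - 2 * t) * x) + sqrt (1/2) * y
          = (sqrt (1/2) * sqrt (2 * t)) * z + (sqrt (1/2) * sqrt (1 - 2 * t)) * x + sqrt (1/2) * y"
          by (simp only: algebra_simps)
        also have "\<dots> = sqrt t * z + (sqrt (1 - t) * a) * x + (sqrt (1 - t) * b) * y"
          by (simp only: c)
        finally show ?thesis by (simp only: algebra_simps)
      qed
      then show "sqrt (1/2) * lincomb n (sqrt (2 * t)) z (sqrt (1 - 2 * t)) x j + sqrt (1 - 1/2) * y j = sqrt t * z j + sqrt (1 - t) * lincomb n a x b y j"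
        using \<open>j < n\<close> by simp
    qed
  qed
  have int: "integrable ?P (\<lambda>p. snd p i * u (lincomb n a (fst p) b (snd p)))"
    by (rule integrable_coordinate_pair(2)[OF _ _ i]) (use unit_funD(2)[OF u] in auto)
  have intu: "integrable (gauss n) (\<lambda>x. x i * u x)"
    by (rule integrable_bounded_mult_coordinate[OF unit_funD[OF u] i])
  have "(\<integral>x. shiftf n (halfgrad n f i) (2 * t) z x \<partial>gauss n) = (\<integral>p. snd p i * u (lincomb n a (fst p) b (snd p)) \<partial>?P)"
    unfolding h using gauss_pair.integral_fst'[OF int] by simp
  \<comment> \<open>In the rotated coordinates \<open>y\<close> is \<open>b\<close> times the
    argument of \<open>u\<close> minus \<open>a\<close> times a vector independent of it; the latter
    is centred and contributes nothing.\<close>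
  also have "\<dots> = (\<integral>p. (\<lambda>p. (b * fst p i - a * snd p i) * u (fst p)) (lincomb n a (fst p) b (snd p), lincomb n b (fst p) (-a) (snd p)) \<partial>?P)"
  proof (rule Bochner_Integration.integral_cong[OF refl])
    fix p
    have "b * (a * x + b * y) - a * (b * x + - a * y) = (a * a + b * b) * y" for x y
      by (simp add: algebra_simps)
    then have "b * (a * fst p i + b * snd p i) - a * (b * fst p i + - a * snd p i) = snd p i"
      by (simp only: ab' mult_1_left)
    then show "snd p i * u (lincomb n a (fst p) b (snd p)) = (\<lambda>p. (b * fst p i - a * snd p i) * u (fst p)) (lincomb n a (fst p) b (snd p), lincomb n b (fst p) (-a) (snd p))"
      by (simp only: fst_conv snd_conv lincomb_apply[OF i])
  qed
  also have "\<dots> = (\<integral>p. (b * fst p i - a * snd p i) * u (fst p) \<partial>?P)"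
    by (rule integral_gauss_rotation[OF ab]) measurable
  also have "\<dots> = (\<integral>p. b * ((fst p i * u (fst p)) * 1) - a * (u (fst p) * snd p i) \<partial>?P)"
    by (intro Bochner_Integration.integral_cong refl) (simp add: algebra_simps)
  also have "\<dots> = b * (\<integral>p. (fst p i * u (fst p)) * 1 \<partial>?P) - a * (\<integral>p. u (fst p) * snd p i \<partial>?P)"
    using integrable_product_pair(1)[OF intu gauss.integrable_const[of n 1]] integrable_product_pair(1)[OF unit_fun_integrable[OF u] gauss_moments(1)[OF i i]]
    by simp
  also have "\<dots> = b * herm1 n u i"
    using integrable_product_pair(2)[OF intu gauss.integrable_const[of n 1]]
      integrable_product_pair(2)[OF unit_fun_integrable[OF u] gauss_moments(1)[OF i i]] gauss_moments(2)[OF i i] gauss.prob_space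
    by (simp add: herm1_def)
  finally show ?thesis by (simp add: b u_def)
qed

section \<open>The derivative as a form in the smoothed gradients\<close>

definition vform :: "nat \<Rightarrow> ((nat \<Rightarrow> real) \<Rightarrow> real) \<Rightarrow> ((nat \<Rightarrow> real) \<Rightarrow> real) \<Rightarrow> real \<Rightarrow> real" where
  "vform n f g s = (\<Sum>i<n. mform n (halfgrad n f i) (halfgrad n g i) s)"

definition vform' :: "nat \<Rightarrow> ((nat \<Rightarrow> real) \<Rightarrow> real) \<Rightarrow> ((nat \<Rightarrow> real) \<Rightarrow> real) \<Rightarrow> real \<Rightarrow> real" where
  "vform' n f g s = (\<Sum>i<n. mform' n (halfgrad n f i) (halfgrad n g i) s)"

definition vform'' :: "nat \<Rightarrow> ((nat \<Rightarrow> real) \<Rightarrow> real) \<Rightarrow> ((nat \<Rightarrow> real) \<Rightarrow> real) \<Rightarrow> real \<Rightarrow> real" where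
  "vform'' n f g s = (\<Sum>i<n. mform'' n (halfgrad n f i) (halfgrad n g i) s)"

lemma DERIV_vform:
  assumes "unit_fun n f" "unit_fun n g" "\<bar>s\<bar> < 1/8"
  shows "(vform n f g has_real_derivative vform' n f g s) (at s)"
    "(vform' n f g has_real_derivative vform'' n f g s) (at s)"
  unfolding vform_def[abs_def] vform'_def[abs_def] vform''_def
  by (intro DERIV_sum DERIV_mform unit_fun_halfgrad assms; simp)+

text \<open>The derivative at \<open>t\<close> is the average inner product of the conditioned first
  Hermite tensors. These are conditional means of half gradients at time \<open>2 * t\<close>, and
  the mixture formula assembles them into \<open>vform\<close>.\<close>

lemma mform'_eq_vform:
  assumes f: "unit_fun n f" and g: "unit_fun n g" and t: "0 \<le> t" "t < 1/16"
  shows "mform' n f g t = 2 * vform n f g (2 * t)"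
proof -
  let ?f = "\<lambda>i z. \<integral>x. shiftf n (halfgrad n f i) (2 * t) z x \<partial>gauss n" and ?g = "\<lambda>i z. \<integral>x. shiftf n (halfgrad n g i) (2 * t) z x \<partial>gauss n"
  have "mform' n f g t * (1 - t) = (\<integral>z. mform' n (shiftf n f t z) (shiftf n g t z) 0 \<partial>gauss n)"
    by (rule mform_derivatives_shift(1)[OF f g t])
  also have "\<dots> = (\<integral>z. (\<Sum>i<n. 2 * (1 - t) * (?f i z * ?g i z)) \<partial>gauss n)"
  proof (rule Bochner_Integration.integral_cong[OF refl])
    fix z assume z: "z \<in> space (gauss n)"
    have "2 * (1 - t) * (?f i z * ?g i z) = herm1 n (shiftf n f t z) i * herm1 n (shiftf n g t z) i" if "i < n" for i
    proof -
      have "sqrt (2 * (1 - t)) * sqrt (2 * (1 - t)) = 2 * (1 - t)" using t by simp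
      then show ?thesis
        unfolding herm1_eq_integral_halfgrad[OF f that t z] herm1_eq_integral_halfgrad[OF g that t z]
        using t by (simp add: divide_simps del: real_sqrt_mult_self)
    qed
    then show "mform' n (shiftf n f t z) (shiftf n g t z) 0 = (\<Sum>i<n. 2 * (1 - t) * (?f i z * ?g i z))"
      by (simp add: mform_zero[OF unit_fun_shiftf[OF f z] unit_fun_shiftf[OF g z]])
  qed
  also have "\<dots> = (\<Sum>i<n. 2 * (1 - t) * (\<integral>z. ?f i z * ?g i z \<partial>gauss n))"
    by (subst Bochner_Integration.integral_sum)
       (auto intro!: integrable_mult_right unit_fun_integrable unit_fun_mult unit_fun_shiftf_integral unit_fun_halfgrad f g)
  also have "\<dots> = 2 * (1 - t) * vform n f g (2 * t)"
    unfolding vform_def sum_distrib_left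
    by (intro sum.cong refl arg_cong2[where f="(*)"] mform_eq_mixture[symmetric] unit_fun_halfgrad f g) (use t in auto)
  finally have "mform' n f g t * (1 - t) = (2 * vform n f g (2 * t)) * (1 - t)"
    by (simp only: mult_ac)
  then show ?thesis using t by (subst (asm) mult_right_cancel) auto
qed

lemma herm2_eq_zero:
  assumes u: "unit_fun n u" "\<And>x. x \<in> space (gauss n) \<Longrightarrow> 0 \<le> u x" and "(\<integral>x. u x \<partial>gauss n) = 0"
  shows "herm2 n u i j = 0"
proof -
  have "AE x in gauss n. u x = 0"
    using integral_nonneg_eq_0_iff_AE[OF unit_fun_integrable[OF u(1)]] u(2) assms(3) by auto
  then have "AE x in gauss n. (x i * x j - (if i = j then 1 else 0)) * u x = 0"
    by eventually_elim simp
  then show ?thesis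
    unfolding herm2_def by (rule integral_eq_zero_AE)
qed

text \<open>The estimates for the single pairs are added by linearizing the logarithm at a common
  parameter \<open>U\<close>. The result is affine in \<open>u\<close>, and for \<open>U = u\<close>
  it reads \<open>4 * u * ln u\<close>; leaving \<open>U\<close> free lets it be fixed before a
  further average is taken.\<close>

lemma sum_herm2_inner_lower_bound:
  assumes h: "\<And>i. i < n \<Longrightarrow> unit_fun n (h i)" "\<And>i x. i < n \<Longrightarrow> x \<in> space (gauss n) \<Longrightarrow> 0 \<le> h i x"
    "\<And>x. x \<in> space (gauss n) \<Longrightarrow> (\<Sum>i<n. (h i x)\<^sup>2) \<le> 1"
    and k: "\<And>i. i < n \<Longrightarrow> unit_fun n (k i)" "\<And>i x. i < n \<Longrightarrow> x \<in> space (gauss n) \<Longrightarrow> 0 \<le> k i x"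
    "\<And>x. x \<in> space (gauss n) \<Longrightarrow> (\<Sum>i<n. (k i x)\<^sup>2) \<le> 1"
    and U: "U > 0"
  defines "u \<equiv> (\<Sum>i<n. (\<integral>x. h i x \<partial>gauss n) * (\<integral>x. k i x \<partial>gauss n))"
  shows "(\<Sum>i<n. \<Sum>a<n. \<Sum>b<n. herm2 n (h i) a b * herm2 n (k i) a b) \<ge> - 4 * (U - u - u * ln U)"
proof -
  define H where "H i = (\<integral>x. (h i x)\<^sup>2 \<partial>gauss n)" for i
  define K where "K i = (\<integral>x. (k i x)\<^sup>2 \<partial>gauss n)" for i
  define a where "a i = (\<integral>x. h i x \<partial>gauss n)" for i
  define b where "b i = (\<integral>x. k i x \<partial>gauss n)" for i
  \<comment> \<open>The arithmetic mean of the second moments bounds their geometric mean, and the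
    sum of all \<open>q i\<close> is at most 1.\<close>
  define q where "q i = (H i + K i) / 2" for i
  have nonneg: "a i \<ge> 0" "b i \<ge> 0" "H i \<ge> 0" "K i \<ge> 0" if "i < n" for i
    using h k that by (auto simp: a_def b_def H_def K_def intro!: Bochner_Integration.integral_nonneg)
  have sq_le: "(\<Sum>i<n. \<integral>x. (w i x)\<^sup>2 \<partial>gauss n) \<le> 1"
    if "\<And>i. i < n \<Longrightarrow> unit_fun n (w i)" "\<And>x. x \<in> space (gauss n) \<Longrightarrow> (\<Sum>i<n. (w i x)\<^sup>2) \<le> 1" for w
  proof -
    have int: "integrable (gauss n) (\<lambda>x. (w i x)\<^sup>2)" if "i < n" for i
      using unit_fun_integrable[OF unit_fun_mult[OF \<open>\<And>i. i < n \<Longrightarrow> unit_fun n (w i)\<close>[OF that] \<open>\<And>i. i < n \<Longrightarrow> unit_fun n (w i)\<close>[OF that]]]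
      by (simp add: power2_eq_square)
    have "(\<Sum>i<n. \<integral>x. (w i x)\<^sup>2 \<partial>gauss n) = (\<integral>x. (\<Sum>i<n. (w i x)\<^sup>2) \<partial>gauss n)"
      using int by (subst Bochner_Integration.integral_sum) auto
    also have "\<dots> \<le> (\<integral>x. 1 \<partial>gauss n)"
      using int that(2) by (intro integral_mono Bochner_Integration.integrable_sum) auto
    finally show ?thesis using gauss.prob_space by simp
  qed
  have summand: "(\<Sum>c<n. \<Sum>d<n. herm2 n (h i) c d * herm2 n (k i) c d) \<ge> - 4 * (U * q i - a i * b i - a i * b i * ln U)" if i: "i < n" for i
  proof (cases "a i = 0 \<or> b i = 0")
    case True
    then have "herm2 n (h i) c d * herm2 n (k i) c d = 0" for c d
      using herm2_eq_zero[OF h(1)[OF i] h(2)[OF i]] herm2_eq_zero[OF k(1)[OF i] k(2)[OF i]] by (auto simp: a_def b_def)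
    moreover have "a i * b i = 0" using True by auto
    moreover have "U * q i \<ge> 0" using U nonneg[OF i] by (simp add: q_def)
    ultimately show ?thesis by (simp only: sum.neutral_const) simp
  next
    case False
    then have pos: "a i > 0" "b i > 0" using nonneg[OF i] by auto
    have "(a i)\<^sup>2 \<le> H i" "(b i)\<^sup>2 \<le> K i"
    proof -
      have "(\<integral>x. w x \<partial>gauss n)\<^sup>2 \<le> (\<integral>x. (w x)\<^sup>2 \<partial>gauss n)" if w: "unit_fun n w" for w
        using gauss.variance_eq[OF unit_fun_integrable[OF w]] unit_fun_integrable[OF unit_fun_mult[OF w w]] gauss.variance_positive[of n w]
        by (simp add: power2_eq_square)
      then show "(a i)\<^sup>2 \<le> H i" "(b i)\<^sup>2 \<le> K i"
        using h(1)[OF i] k(1)[OF i] by (auto simp: a_def b_def H_def K_def)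
    qed
    moreover have "0 < (a i)\<^sup>2" "0 < (b i)\<^sup>2" using pos by auto
    ultimately have HK: "H i > 0" "K i > 0" by linarith+
    then have q: "q i > 0" by (simp add: q_def)
    let ?p = "a i * b i"
    have p: "?p > 0" using pos by simp
    have "ln (H i / (a i)\<^sup>2) + ln (K i / (b i)\<^sup>2) = ln (H i * K i) - 2 * ln ?p"
      using pos HK by (simp add: ln_div ln_mult ln_realpow)
    also have "H i * K i \<le> (q i)\<^sup>2"
      using zero_le_power2[of "H i - K i"] by (simp add: q_def power2_eq_square field_simps)
    then have "ln (H i * K i) \<le> 2 * ln (q i)"
      using HK q by (subst ln_realpow[of _ 2, simplified, symmetric]) (auto simp: ln_mono)
    finally have L: "ln (H i / (a i)\<^sup>2) + ln (K i / (b i)\<^sup>2) \<le> 2 * (ln (q i) - ln ?p)" by simp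
    \<comment> \<open>The tangent bound that moves the logarithm from the individual ratio
      \<open>q i / ?p\<close> to the common \<open>U\<close>; it is sharp when all ratios equal
      \<open>1 / U\<close>.\<close>
    have "ln (q i * U / ?p) \<le> q i * U / ?p - 1"
      by (rule ln_le_minus_one) (use q U p in auto)
    then have "ln (q i) - ln ?p \<le> q i * U / ?p - 1 - ln U"
      using q U p pos by (simp add: ln_div ln_mult)
    then have "?p * (ln (q i) - ln ?p) \<le> ?p * (q i * U / ?p - 1 - ln U)"
      using p by (intro mult_left_mono) auto
    also have "\<dots> = U * q i - ?p - ?p * ln U"
      using p pos by (simp add: right_diff_distrib mult.commute)
    finally have M: "?p * (ln (q i) - ln ?p) \<le> U * q i - ?p - ?p * ln U" .
    have "?p * (ln (H i / (a i)\<^sup>2) + ln (K i / (b i)\<^sup>2)) \<le> ?p * (2 * (ln (q i) - ln ?p))"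
      using L p by (intro mult_left_mono) auto
    moreover have "(\<Sum>c<n. \<Sum>d<n. herm2 n (h i) c d * herm2 n (k i) c d) \<ge>
        - 2 * a i * b i * (ln ((\<integral>x. (h i x)\<^sup>2 \<partial>gauss n) / (a i)\<^sup>2) + ln ((\<integral>x. (k i x)\<^sup>2 \<partial>gauss n) / (b i)\<^sup>2))"
      using h(1,2)[OF i] k(1,2)[OF i] unit_funD(2)[OF h(1)[OF i]] unit_funD(2)[OF k(1)[OF i]] pos
      by (intro herm2_inner_lower_bound[where C=1]) (auto simp: unit_funD a_def b_def abs_le_iff)
    ultimately show ?thesis
      using M unfolding H_def[symmetric] K_def[symmetric] by (simp add: algebra_simps)
  qed
  have "(\<Sum>i<n. q i) \<le> 1"
    using sq_le[OF h(1,3)] sq_le[OF k(1,3)] by (simp add: q_def sum_divide_distrib[symmetric] sum.distrib H_def K_def)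
  then have "U * (\<Sum>i<n. q i) \<le> U * 1" using U by (intro mult_left_mono) auto
  then have "- 4 * (U - u - u * ln U) \<le> (\<Sum>i<n. - 4 * (U * q i - a i * b i - a i * b i * ln U))"
    by (simp add: sum_distrib_left[symmetric] sum_subtractf sum_distrib_right[symmetric] u_def a_def b_def)
  also have "\<dots> \<le> (\<Sum>i<n. \<Sum>a<n. \<Sum>b<n. herm2 n (h i) a b * herm2 n (k i) a b)"
    using summand by (intro sum_mono) auto
  finally show ?thesis .
qed

text \<open>The bound at time 0 is applied to the conditioned half gradients with \<open>U\<close>
  equal to the mean of \<open>u z\<close>. Being affine in \<open>u z\<close>, it averages exactly
  to \<open>4 * U * ln U\<close>, which takes the place of Jensen's inequality.\<close>

lemma vform''_lower_bound:
  assumes f: "unit_fun n f" "increasing_Rn n f" and g: "unit_fun n g" "increasing_Rn n g"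
    and s: "0 \<le> s" "s < 1/16" and pos: "vform n f g s > 0"
  shows "vform'' n f g s * (1 - s)\<^sup>2 \<ge> 4 * vform n f g s * ln (vform n f g s)"
proof -
  define U where "U = vform n f g s"
  define h where "h z i = shiftf n (halfgrad n f i) s z" for z i
  define k where "k z i = shiftf n (halfgrad n g i) s z" for z i
  define u where "u z = (\<Sum>i<n. (\<integral>x. h z i x \<partial>gauss n) * (\<integral>x. k z i x \<partial>gauss n))" for z
  note uf = unit_fun_halfgrad[OF f(1)] and ug = unit_fun_halfgrad[OF g(1)]
  have int_u: "integrable (gauss n) u" 
    unfolding u_def[abs_def] h_def k_def
    by (intro Bochner_Integration.integrable_sum unit_fun_integrable unit_fun_mult unit_fun_shiftf_integral uf ug) auto
  have U: "U = (\<integral>z. u z \<partial>gauss n)"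
    unfolding U_def vform_def u_def h_def k_def
    by (subst Bochner_Integration.integral_sum)
       (use s in \<open>auto intro!: sum.cong mform_eq_mixture unit_fun_integrable unit_fun_mult unit_fun_shiftf_integral uf ug\<close>)
  define W where "W = (\<integral>p. mehler_bound n p \<partial>gauss_sq n)"
  have int2: "integrable (gauss n) (\<lambda>z. mform'' n (h z i) (k z i) 0)" if "i < n" for i
  proof (rule gauss.integrable_const_bound[where B=W])
    show "(\<lambda>z. mform'' n (h z i) (k z i) 0) \<in> borel_measurable (gauss n)"
      unfolding mform''_def h_def k_def using that by (intro measurable_mform_shiftf uf ug measurable_mehler)
    show "AE z in gauss n. norm (mform'' n (h z i) (k z i) 0) \<le> W"
      unfolding mform''_def h_def k_def W_def real_norm_def using that
      by (intro AE_I2 mform_integrand(3) unit_fun_shiftf uf ug measurable_mehler mehler_le_bound) auto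
  qed
  have "vform'' n f g s * (1 - s)\<^sup>2 = (\<Sum>i<n. \<integral>z. mform'' n (h z i) (k z i) 0 \<partial>gauss n)"
    unfolding vform''_def sum_distrib_right h_def k_def
    using s by (intro sum.cong refl mform_derivatives_shift(2) uf ug) auto
  also have "\<dots> = (\<integral>z. (\<Sum>i<n. mform'' n (h z i) (k z i) 0) \<partial>gauss n)"
    using int2 by (subst Bochner_Integration.integral_sum) auto
  also have "\<dots> \<ge> (\<integral>z. - 4 * (U - u z - u z * ln U) \<partial>gauss n)"
  proof (rule integral_mono)
    show "integrable (gauss n) (\<lambda>z. - 4 * (U - u z - u z * ln U))" using int_u by simp
    show "integrable (gauss n) (\<lambda>z. \<Sum>i<n. mform'' n (h z i) (k z i) 0)"
      using int2 by (intro Bochner_Integration.integrable_sum) simp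
    fix z assume z: "z \<in> space (gauss n)"
    have uh: "unit_fun n (h z i)" "unit_fun n (k z i)" if "i < n" for i
      using that unfolding h_def k_def by (intro unit_fun_shiftf uf ug z; simp)+
    have "(\<Sum>i<n. mform'' n (h z i) (k z i) 0) = (\<Sum>i<n. \<Sum>a<n. \<Sum>b<n. herm2 n (h z i) a b * herm2 n (k z i) a b)"
      using mform_zero(3)[OF uh] by simp
    also have "\<dots> \<ge> - 4 * (U - u z - u z * ln U)"
      unfolding u_def
    proof (rule sum_herm2_inner_lower_bound[OF uh(1) _ _ uh(2)])
      show "0 \<le> h z i x" if "i < n" for i x
        unfolding h_def shiftf_def by (intro halfgrad_nonneg f that lincomb_in_space)
      show "0 \<le> k z i x" if "i < n" for i x
        unfolding k_def shiftf_def by (intro halfgrad_nonneg g that lincomb_in_space)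
      show "(\<Sum>i<n. (h z i x)\<^sup>2) \<le> 1" for x
        unfolding h_def shiftf_def by (intro halfgrad_square_sum f lincomb_in_space)
      show "(\<Sum>i<n. (k z i x)\<^sup>2) \<le> 1" for x
        unfolding k_def shiftf_def by (intro halfgrad_square_sum g lincomb_in_space)
      show "U > 0" using pos by (simp add: U_def)
    qed
    finally show "- 4 * (U - u z - u z * ln U) \<le> (\<Sum>i<n. mform'' n (h z i) (k z i) 0)" .
  qed
  also have "(\<integral>z. - 4 * (U - u z - u z * ln U) \<partial>gauss n) = 4 * U * ln U"
    using int_u gauss.prob_space by (simp add: U[symmetric])
  finally show ?thesis by (simp add: U_def)
qed

section \<open>Borel versions of increasing functions\<close>

lemma increasing_Rn_le:
  assumes f: "increasing_Rn n f" and x: "x \<in> Rn n" and y: "y \<in> Rn n" and le: "\<And>i. i < n \<Longrightarrow> x i \<le> y i"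
  shows "f x \<le> f y"
proof -
  define z where "z k = (\<lambda>i. if i < k then y i else x i)" for k
  have "f x \<le> f (z k)" if "k \<le> n" for k
    using that
  proof (induction k)
    case 0
    then show ?case by (simp add: z_def)
  next
    case (Suc k)
    have "z k \<in> Rn n" using x y Suc.prems by (auto simp: z_def PiE_def extensional_def)
    moreover have "z k k \<le> y k" using le Suc.prems by (simp add: z_def)
    ultimately have "f (z k) \<le> f ((z k)(k := y k))"
      using f Suc.prems unfolding increasing_Rn_def by auto
    also have "(z k)(k := y k) = z (Suc k)" by (auto simp: z_def less_Suc_eq)
    finally show ?case using Suc by simp
  qed
  from this[of n] have "f x \<le> f (z n)" by simp
  also have "z n = y" using x y by (auto simp: z_def fun_eq_iff PiE_def extensional_def)
  finally show ?thesis .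
qed

definition translate :: "nat \<Rightarrow> real \<Rightarrow> (nat \<Rightarrow> real) \<Rightarrow> nat \<Rightarrow> real" where
  "translate n e x = (\<lambda>i\<in>{..<n}. x i + e)"

lemma translate_in_space: "translate n e x \<in> space (gauss n)"
  by (auto simp: translate_def space_gauss)

text \<open>The Cameron-Martin formula for a diagonal shift. The second factor of
  \<open>gauss_sq n\<close> is a dummy that brings the shift into the form of a coordinatewise
  planar map.\<close>

lemma integral_translate_gauss:
  assumes f: "unit_fun n f"
  shows "(\<integral>x. f (translate n e x) \<partial>gauss n) = (\<integral>x. f x * exp (e * (\<Sum>i<n. x i) - real n * e\<^sup>2 / 2) \<partial>gauss n)"
    "(\<lambda>x. f (translate n e x)) \<in> borel_measurable (gauss n)"
proof -
  note [measurable] = unit_funD(1)[OF f]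
  let ?P = "gauss_sq n"
  let ?d = "\<lambda>x. exp (e * (\<Sum>i<n. x i) - real n * e\<^sup>2 / 2)"
  define T where "T = (\<lambda>(z :: nat \<Rightarrow> real, w :: nat \<Rightarrow> real). (\<lambda>i\<in>{..<n}. (\<lambda>(x, y). x + e) (z i, w i), \<lambda>i\<in>{..<n}. snd (z i, w i)))"
  have D: "distr ?P ?P T = density ?P (\<lambda>(z, w). \<Prod>i<n. (\<lambda>(x, y). ennreal (affine_rho 1 e x)) (z i, w i))"
    unfolding T_def
  proof (rule coordinatewise_distr)
    interpret G: pair_sigma_finite gauss1 gauss1 ..
    fix \<psi> :: "real \<times> real \<Rightarrow> ennreal" assume [measurable]: "\<psi> \<in> borel_measurable (borel \<Otimes>\<^sub>M borel)"
    have "(\<integral>\<^sup>+ a. \<integral>\<^sup>+ b. \<psi> (a + e, b) \<partial>gauss1 \<partial>gauss1) = (\<integral>\<^sup>+ a. (\<integral>\<^sup>+ b. \<psi> (a, b) \<partial>gauss1) * ennreal (affine_rho 1 e a) \<partial>gauss1)"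
      using nn_integral_gauss1_affine[of "\<lambda>a. \<integral>\<^sup>+ b. \<psi> (a, b) \<partial>gauss1" 1 e] by simp
    also have "\<dots> = (\<integral>\<^sup>+ a. \<integral>\<^sup>+ b. \<psi> (a, b) * ennreal (affine_rho 1 e a) \<partial>gauss1 \<partial>gauss1)"
    proof (rule nn_integral_cong)
      fix a
      have "(\<lambda>b. \<psi> (a, b)) \<in> borel_measurable gauss1"
        using measurable_compose[OF measurable_Pair1'[of a borel borel] \<open>\<psi> \<in> _\<close>] by (simp cong: measurable_cong_sets)
      then show "(\<integral>\<^sup>+ b. \<psi> (a, b) \<partial>gauss1) * ennreal (affine_rho 1 e a) = (\<integral>\<^sup>+ b. \<psi> (a, b) * ennreal (affine_rho 1 e a) \<partial>gauss1)"
        by (rule nn_integral_multc[symmetric])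
    qed
    finally show "(\<integral>\<^sup>+ a. \<integral>\<^sup>+ b. \<psi> ((case (a, b) of (x, y) \<Rightarrow> x + e), snd (a, b)) \<partial>gauss1 \<partial>gauss1)
      = (\<integral>\<^sup>+ a. \<integral>\<^sup>+ b. \<psi> (a, b) * (case (a, b) of (x, y) \<Rightarrow> ennreal (affine_rho 1 e x)) \<partial>gauss1 \<partial>gauss1)"
      by simp
  qed measurable
  have rho: "(case p of (z, w) \<Rightarrow> \<Prod>i<n. (\<lambda>(x, y). ennreal (affine_rho 1 e x)) (z i, w i)) = ennreal (?d (fst p))" for p :: "(nat \<Rightarrow> real) \<times> (nat \<Rightarrow> real)"
  proof -
    have "affine_rho 1 e x = exp (e * x - e\<^sup>2 / 2)" for x
      by (simp add: affine_rho_def power2_eq_square field_simps)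
    then have "(\<Prod>i<n. affine_rho 1 e (fst p i)) = exp (\<Sum>i<n. e * fst p i - e\<^sup>2 / 2)"
      by (simp add: exp_sum)
    then show ?thesis
      by (simp add: case_prod_unfold prod_ennreal affine_rho_def sum_subtractf sum_distrib_left)
  qed
  have T1: "fst (T p) = translate n e (fst p)" for p
    by (simp add: T_def translate_def case_prod_unfold)
  have T_eq: "T p = (translate n e (fst p), lincomb n 1 (snd p) 0 (snd p))" for p
    by (simp add: T_def translate_def lincomb_def case_prod_unfold)
  have [measurable]: "translate n e \<in> gauss n \<rightarrow>\<^sub>M gauss n"
    unfolding translate_def[abs_def] gauss_def by measurable
  show "(\<lambda>x. f (translate n e x)) \<in> borel_measurable (gauss n)" by measurable
  have [measurable]: "T \<in> ?P \<rightarrow>\<^sub>M ?P"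
    unfolding T_eq[abs_def] by measurable
  have red: "(\<integral>p. F (fst p) \<partial>?P) = (\<integral>x. F x \<partial>gauss n)" if "F \<in> borel_measurable (gauss n)" for F :: "_ \<Rightarrow> real"
  proof -
    have "distr ?P (gauss n) fst = gauss n"
      by (rule gauss.distr_pair_fst)
    then show ?thesis
      using integral_distr[of fst ?P "gauss n" F] that by simp
  qed
  have "(\<integral>x. f (translate n e x) \<partial>gauss n) = (\<integral>p. f (fst (T p)) \<partial>?P)"
    unfolding T1 by (rule red[symmetric]) measurable
  also have "\<dots> = (\<integral>p. f (fst p) \<partial>distr ?P ?P T)"
    by (rule integral_distr[symmetric]) measurable
  also have "\<dots> = (\<integral>p. f (fst p) \<partial>density ?P (\<lambda>p. ennreal (?d (fst p))))"
    unfolding D rho ..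
  also have "\<dots> = (\<integral>p. ?d (fst p) * f (fst p) \<partial>?P)"
    by (subst integral_density) auto
  also have "\<dots> = (\<integral>x. ?d x * f x \<partial>gauss n)"
    by (rule red) measurable
  finally show "(\<integral>x. f (translate n e x) \<partial>gauss n) = (\<integral>x. f x * ?d x \<partial>gauss n)"
    by (simp add: mult.commute)
qed

text \<open>The shift is carried by the density, which tends to 1 pointwise and under a fixed
  integrable bound; \<open>f\<close> itself may be discontinuous.\<close>

lemma integral_translate_tendsto:
  assumes f: "unit_fun n f"
  shows "(\<lambda>k. \<integral>x. f (translate n (1 / real (Suc k)) x) \<partial>gauss n) \<longlonglongrightarrow> (\<integral>x. f x \<partial>gauss n)"
proof -
  note [measurable] = unit_funD(1)[OF f]
  let ?e = "\<lambda>k. 1 / real (Suc k)"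
  have "(\<lambda>k. \<integral>x. f x * exp (?e k * (\<Sum>i<n. x i) - real n * (?e k)\<^sup>2 / 2) \<partial>gauss n) \<longlonglongrightarrow> (\<integral>x. f x \<partial>gauss n)"
  proof (rule integral_dominated_convergence[where w="\<lambda>x. exp (real n) * exp ((\<Sum>i<n. (x i)\<^sup>2) / 4)"])
    show "integrable (gauss n) (\<lambda>x. exp (real n) * exp ((\<Sum>i<n. (x i)\<^sup>2) / 4))"
      by (intro integrable_mult_right integrable_gauss_exp)
    show "AE x in gauss n. (\<lambda>k. f x * exp (?e k * (\<Sum>i<n. x i) - real n * (?e k)\<^sup>2 / 2)) \<longlonglongrightarrow> f x"
    proof (intro AE_I2)
      fix x
      have "?e \<longlonglongrightarrow> 0" using LIMSEQ_Suc[OF lim_inverse_n'] by simp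
      then have "(\<lambda>k. f x * exp (?e k * (\<Sum>i<n. x i) - real n * (?e k)\<^sup>2 / 2)) \<longlonglongrightarrow> f x * exp (0 * (\<Sum>i<n. x i) - real n * 0\<^sup>2 / 2)"
        by (intro tendsto_intros) auto
      then show "(\<lambda>k. f x * exp (?e k * (\<Sum>i<n. x i) - real n * (?e k)\<^sup>2 / 2)) \<longlonglongrightarrow> f x" by simp
    qed
    show "AE x in gauss n. norm (f x * exp (?e k * (\<Sum>i<n. x i) - real n * (?e k)\<^sup>2 / 2)) \<le> exp (real n) * exp ((\<Sum>i<n. (x i)\<^sup>2) / 4)" for k
    proof (intro AE_I2)
      fix x assume x: "x \<in> space (gauss n)"
      have e: "0 \<le> ?e k" "?e k \<le> 1" by auto
      have "?e k * (\<Sum>i<n. x i) = (\<Sum>i<n. ?e k * x i)" by (simp only: sum_distrib_left)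
      also have "\<dots> \<le> (\<Sum>i<n. 1 + (x i)\<^sup>2 / 4)"
      proof (rule sum_mono)
        fix i
        have "?e k * x i \<le> ?e k * \<bar>x i\<bar>" using e by (intro mult_left_mono) auto
        also have "\<dots> \<le> 1 * \<bar>x i\<bar>" using e by (intro mult_right_mono) auto
        also have "\<bar>x i\<bar> \<le> 1 + (x i)\<^sup>2 / 4"
          using sum_squares_bound[of "\<bar>x i\<bar> / 2" 1] by (simp add: power_divide)
        finally show "?e k * x i \<le> 1 + (x i)\<^sup>2 / 4" by simp
      qed
      also have "\<dots> = real n + (\<Sum>i<n. (x i)\<^sup>2) / 4" by (simp add: sum.distrib sum_divide_distrib)
      finally have "?e k * (\<Sum>i<n. x i) \<le> real n + (\<Sum>i<n. (x i)\<^sup>2) / 4" .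
      moreover have "real n * (?e k)\<^sup>2 / 2 \<ge> 0" by simp
      ultimately have "?e k * (\<Sum>i<n. x i) - real n * (?e k)\<^sup>2 / 2 \<le> real n + (\<Sum>i<n. (x i)\<^sup>2) / 4" by argo
      then have "\<bar>f x\<bar> * exp (?e k * (\<Sum>i<n. x i) - real n * (?e k)\<^sup>2 / 2) \<le> 1 * exp (real n + (\<Sum>i<n. (x i)\<^sup>2) / 4)"
        using unit_funD(2)[OF f x] by (intro mult_mono) auto
      then show "norm (f x * exp (?e k * (\<Sum>i<n. x i) - real n * (?e k)\<^sup>2 / 2)) \<le> exp (real n) * exp ((\<Sum>i<n. (x i)\<^sup>2) / 4)"
        by (simp add: abs_mult exp_add)
    qed
  qed measurable
  then show ?thesis
    by (simp only: integral_translate_gauss(1)[OF f])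
qed

text \<open>An increasing function lies between its suprema and infima over strictly smaller and strictly
  larger rational points. Both are Borel, and the upper one is bounded by arbitrarily small
  diagonal translates of the lower one.\<close>

lemma increasing_Rn_AE_borel:
  assumes f: "increasing_Rn n f" and range: "f \<in> Rn n \<rightarrow> {0..1}"
  obtains f' where "unit_fun n f'" "f' \<in> Rn n \<rightarrow> {0..1}" "increasing_Rn n f'" "AE x in gauss n. f x = f' x"
proof -
  define Q where "Q = PiE {..<n} (\<lambda>_. \<rat> :: real set)"
  have Q: "countable Q" "Q \<noteq> {}" "Q \<subseteq> Rn n"
    unfolding Q_def by (auto intro!: countable_PiE countable_rat simp: PiE_eq_empty_iff Rats_0 intro: exI[of _ 0])
  \<comment> \<open>The defaults 0 and 1 are the ends of the range, so they do not affect the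
    comparison with \<open>f\<close>. The rational points make supremum and infimum countable, hence
    Borel.\<close>
  define L where "L q x = (if \<forall>i<n. q i < x i then f q else 0)" for q x
  define R where "R q x = (if \<forall>i<n. x i < q i then f q else 1)" for q x
  define lo where "lo x = (SUP q\<in>Q. L q x)" for x
  define hi where "hi x = (INF q\<in>Q. R q x)" for x
  have f01: "0 \<le> f x" "f x \<le> 1" if "x \<in> Rn n" for x using range that by auto
  have L01: "0 \<le> L q x" "L q x \<le> 1" "0 \<le> R q x" "R q x \<le> 1" if "q \<in> Q" for q x
    using f01[of q] that Q(3) by (auto simp: L_def R_def)
  have bdd: "bdd_above ((\<lambda>q. L q x) ` Q)" "bdd_below ((\<lambda>q. R q x) ` Q)" for x
    using L01 by (auto intro!: bdd_aboveI2 bdd_belowI2)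
  have lo_f: "lo x \<le> f x" if x: "x \<in> Rn n" for x
    unfolding lo_def
  proof (rule cSUP_least[OF Q(2)])
    fix q assume "q \<in> Q"
    then show "L q x \<le> f x"
      using increasing_Rn_le[OF f, of q x] x Q(3) f01[OF x] by (auto simp: L_def less_imp_le)
  qed
  have f_hi: "f x \<le> hi x" if x: "x \<in> Rn n" for x
    unfolding hi_def
  proof (rule cINF_greatest[OF Q(2)])
    fix q assume "q \<in> Q"
    then show "f x \<le> R q x"
      using increasing_Rn_le[OF f, of x q] x Q(3) f01[OF x] by (auto simp: R_def less_imp_le)
  qed
  have lo0: "0 \<le> lo x" for x
  proof -
    obtain q where "q \<in> Q" using Q(2) by auto
    then show ?thesis unfolding lo_def using L01(1) bdd(1) by (rule_tac cSUP_upper2) auto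
  qed
  have lo1: "lo x \<le> 1" for x
    unfolding lo_def using L01 Q(2) by (intro cSUP_least) auto
  have hi0: "0 \<le> hi x" for x
    unfolding hi_def using L01 Q(2) by (intro cINF_greatest) auto
  have hi1: "hi x \<le> 1" for x
  proof -
    obtain q where "q \<in> Q" using Q(2) by auto
    then show ?thesis unfolding hi_def using L01(4) bdd(2) by (rule_tac cINF_lower2) auto
  qed
  have [measurable]: "lo \<in> borel_measurable (gauss n)" "hi \<in> borel_measurable (gauss n)"
    unfolding lo_def[abs_def] hi_def[abs_def] L_def R_def
    using bdd[unfolded L_def R_def] by (intro borel_measurable_cSUP borel_measurable_cINF Q(1); measurable)+
  have ulo: "unit_fun n lo" and uhi: "unit_fun n hi"
    using lo0 lo1 hi0 hi1 by (auto simp: unit_fun_def abs_of_nonneg)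
  have incr: "increasing_Rn n lo"
    unfolding increasing_Rn_def
  proof (intro ballI allI impI)
    fix x i t assume "x \<in> Rn n" "i < n" "x i \<le> t"
    then show "lo x \<le> lo (x(i := t))"
      unfolding lo_def
    proof (intro cSUP_mono[OF Q(2) bdd(1)])
      fix q assume q: "q \<in> Q"
      have "L q x \<le> L q (x(i := t))"
        using \<open>x i \<le> t\<close> L01(1)[OF q] f01[of q] q Q(3) by (auto simp: L_def dest: spec[of _ i])
      then show "\<exists>m\<in>Q. L q x \<le> L m (x(i := t))" using q by auto
    qed
  qed
  \<comment> \<open>A rational point strictly between \<open>x\<close> and its translate is
    admissible for the infimum at \<open>x\<close> and for the supremum at the translate.\<close>
  have hi_lo: "hi x \<le> lo (translate n e x)" if "e > 0" for x e
  proof -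
    have "\<exists>q. q \<in> \<rat> \<and> x i < q \<and> q < x i + e" for i
      using Rats_dense_in_real[of "x i" "x i + e"] that by auto
    then have "\<forall>i. \<exists>q. q \<in> \<rat> \<and> x i < q \<and> q < x i + e" by blast
    from choice[OF this] obtain r where r: "\<And>i. r i \<in> \<rat> \<and> x i < r i \<and> r i < x i + e" by blast
    define q where "q = (\<lambda>i\<in>{..<n}. r i)"
    have q: "q \<in> Q" using r by (auto simp: q_def Q_def)
    have "hi x \<le> R q x" unfolding hi_def by (rule cINF_lower[OF bdd(2) q])
    also have "R q x = f q" using r by (simp add: R_def q_def)
    also have "f q = L q (translate n e x)" using r by (simp add: L_def q_def translate_def)
    also have "\<dots> \<le> lo (translate n e x)" unfolding lo_def by (rule cSUP_upper[OF q bdd(1)])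
    finally show ?thesis .
  qed
  have "(\<integral>x. hi x \<partial>gauss n) \<le> (\<integral>x. lo (translate n (1 / real (Suc k)) x) \<partial>gauss n)" for k
  proof (rule integral_mono)
    have "unit_fun n (\<lambda>x. lo (translate n (1 / real (Suc k)) x))"
      using integral_translate_gauss(2)[OF ulo] unit_funD(2)[OF ulo translate_in_space] by (simp add: unit_fun_def)
    then show "integrable (gauss n) (\<lambda>x. lo (translate n (1 / real (Suc k)) x))" by (rule unit_fun_integrable)
  qed (use hi_lo unit_fun_integrable[OF uhi] in auto)
  then have "(\<integral>x. hi x \<partial>gauss n) \<le> (\<integral>x. lo x \<partial>gauss n)"
    by (intro LIMSEQ_le_const[OF integral_translate_tendsto[OF ulo]]) auto
  moreover have "lo x \<le> hi x" if "x \<in> space (gauss n)" for x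
    using order.trans[OF lo_f[of x] f_hi[of x]] that by (simp only: space_gauss)
  then have "(\<integral>x. lo x \<partial>gauss n) \<le> (\<integral>x. hi x \<partial>gauss n)"
    by (intro integral_mono unit_fun_integrable ulo uhi)
  ultimately have "(\<integral>x. hi x - lo x \<partial>gauss n) = 0"
    using unit_fun_integrable[OF ulo] unit_fun_integrable[OF uhi] by simp
  then have "AE x in gauss n. hi x - lo x = 0"
    using unit_fun_integrable[OF ulo] unit_fun_integrable[OF uhi] \<open>\<And>x. x \<in> space (gauss n) \<Longrightarrow> lo x \<le> hi x\<close>
    by (subst integral_nonneg_eq_0_iff_AE[symmetric]) auto
  then have "AE x in gauss n. f x = lo x"
    using AE_space
  proof eventually_elim
    case (elim x)
    then show ?case using lo_f[of x] f_hi[of x] by (simp add: space_gauss)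
  qed
  with ulo incr lo0 lo1 show ?thesis by (intro that[of lo]) auto
qed

text \<open>The set where \<open>f\<close> and \<open>f'\<close> differ is contained in a null set,
  so in the completion all its subsets are measurable.\<close>

lemma measurable_completion_AE:
  assumes [measurable]: "f' \<in> borel_measurable M" and ae: "AE x in M. f x = f' x"
  shows "f \<in> borel_measurable (completion M)"
proof (rule measurableI)
  fix A :: "'b set" assume [measurable]: "A \<in> sets borel"
  have [measurable]: "Measurable.pred (completion M) (\<lambda>x. f x \<noteq> f' x)"
    by (rule sets_completion_AE) (use ae in simp)
  have [measurable]: "Measurable.pred (completion M) (\<lambda>x. f x \<noteq> f' x \<and> f x \<in> A)"
    by (rule sets_completion_AE) (use ae in auto)
  have [measurable]: "f' \<in> borel_measurable (completion M)"
    by (rule measurable_completion) fact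
  have "f -` A \<inter> space (completion M) = {x \<in> space (completion M). (f' x \<in> A \<and> \<not> f x \<noteq> f' x) \<or> (f x \<noteq> f' x \<and> f x \<in> A)}"
    by auto
  also have "\<dots> \<in> sets (completion M)" by measurable
  finally show "f -` A \<inter> space (completion M) \<in> sets (completion M)" .
qed simp

lemma integral_completion_AE:
  fixes w f f' :: "'a \<Rightarrow> real"
  assumes [measurable]: "w \<in> borel_measurable M" "f' \<in> borel_measurable M" and ae: "AE x in M. f x = f' x"
  shows "(\<integral>x. w x * f x \<partial>completion M) = (\<integral>x. w x * f' x \<partial>M)"
proof -
  note [measurable] = measurable_completion_AE[OF assms(2) ae] measurable_completion[OF assms(1)] measurable_completion[OF assms(2)]
  have "AE x in completion M. w x * f x = w x * f' x"
    using AE_completion[OF ae] by eventually_elim simp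
  then have "(\<integral>x. w x * f x \<partial>completion M) = (\<integral>x. w x * f' x \<partial>completion M)"
    by (intro integral_cong_AE) measurable
  also have "\<dots> = (\<integral>x. w x * f' x \<partial>M)"
    by (rule integral_completion) measurable
  finally show ?thesis .
qed

section \<open>The correlation inequality\<close>

text \<open>On the way from its maximum down to half of its initial value the function loses a fixed
  proportion of that maximum, which the bound on the second derivative forbids in short time.\<close>

lemma second_order_persistence:
  fixes V V' V'' :: "real \<Rightarrow> real"
  assumes D1: "\<And>s. 0 \<le> s \<Longrightarrow> s \<le> T \<Longrightarrow> (V has_real_derivative V' s) (at s)"
    and D2: "\<And>s. 0 \<le> s \<Longrightarrow> s \<le> T \<Longrightarrow> (V' has_real_derivative V'' s) (at s)"
    and lower: "\<And>s. 0 \<le> s \<Longrightarrow> s \<le> T \<Longrightarrow> V s > 0 \<Longrightarrow> V'' s * (1 - s)\<^sup>2 \<ge> 4 * V s * ln (V s)"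
    and T: "T < 1/16" and v: "0 < V 0" "V 0 \<le> 2"
    and T1: "\<bar>V' 0\<bar> * T \<le> V 0 / 8" and T2: "ln (2 / V 0) * T\<^sup>2 \<le> 1/16"
    and s: "0 \<le> s" "s \<le> T"
  shows "V s \<ge> V 0 / 2"
proof (rule ccontr)
  assume "\<not> V s \<ge> V 0 / 2"
  then have s_less: "V s < V 0 / 2" by simp
  define l where "l = ln (2 / V 0)"
  have l: "l \<ge> 0" using v by (simp add: l_def)
  have cont: "continuous_on {0..T} V"
    using D1 by (intro continuous_at_imp_continuous_on ballI) (auto intro: DERIV_isCont)
  \<comment> \<open>Its least element \<open>e\<close> is the first time at which \<open>V\<close>
    has dropped to half of its initial value.\<close>
  define C where "C = {x \<in> {0..s}. V x \<le> V 0 / 2}"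
  have "closed C"
    unfolding C_def using cont s
    by (intro continuous_on_closed_Collect_le continuous_on_const) (auto elim: continuous_on_subset)
  moreover have "bounded C"
    by (rule bounded_subset[OF bounded_closed_interval[of 0 s]]) (auto simp: C_def)
  ultimately have "compact C" by (simp add: compact_eq_bounded_closed)
  moreover have "s \<in> C" using s s_less by (simp add: C_def)
  ultimately obtain e where e: "e \<in> C" "\<And>x. x \<in> C \<Longrightarrow> e \<le> x"
    using compact_attains_inf[of C] by auto
  have e_in: "0 \<le> e" "e \<le> T" "V e \<le> V 0 / 2" using e s by (auto simp: C_def)
  have above: "V x > V 0 / 2" if "0 \<le> x" "x < e" for x
  proof (rule ccontr)
    assume "\<not> V x > V 0 / 2"
    then have "x \<in> C" using that e_in e(1) by (auto simp: C_def)
    then show False using e(2)[of x] that by simp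
  qed
  \<comment> \<open>Expanding at the maximum makes the first-order term vanish when \<open>m\<close>
    is interior, and measures all losses against \<open>V m\<close>.\<close>
  obtain m where m: "m \<in> {0..e}" "\<And>x. x \<in> {0..e} \<Longrightarrow> V x \<le> V m"
    using continuous_attains_sup[of "{0..e}" V] e_in continuous_on_subset[OF cont, of "{0..e}"] by auto
  have Vm: "V m \<ge> V 0" using m(2)[of 0] e_in by simp
  have "m \<noteq> e" using Vm e_in v by auto
  then have me: "0 \<le> m" "m < e" using m(1) by auto
  obtain t where t: "m < t" "t < e" "V e = V m + V' m * (e - m) + V'' t / 2 * (e - m)\<^sup>2"
  proof -
    define diff where "diff k = (if k = 0 then V else if k = 1 then V' else V'')" for k :: nat
    have "\<exists>t>m. t < e \<and> V e = (\<Sum>k<2. diff k m / fact k * (e - m) ^ k) + diff 2 t / fact 2 * (e - m) ^ 2"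
      by (rule Taylor_up[where a=0]) (use D1 D2 me e_in in \<open>auto simp: diff_def less_2_cases_iff\<close>)
    then show ?thesis using that by (auto simp: diff_def numeral_2_eq_2)
  qed
  have Vt: "V t > V 0 / 2" "V t \<le> V m" using above[of t] m(2)[of t] t me by auto
  have t_in: "0 \<le> t" "t \<le> T" using t me e_in by auto
  \<comment> \<open>Before time \<open>e\<close> the value \<open>V t\<close> exceeds
    \<open>V 0 / 2\<close>, so its logarithm is at least \<open>- l\<close>. The constant 8 is the 4
    of \<open>lower\<close> doubled by \<open>(1 - t)\<^sup>2 \<ge> 1/2\<close>; above the level 1
    the second derivative is nonnegative.\<close>
  have V''t: "V'' t \<ge> - 8 * (V m * l)"
  proof (cases "V t \<ge> 1")
    case True
    then have "0 \<le> V'' t * (1 - t)\<^sup>2"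
      using lower[OF t_in] ln_ge_zero[OF True] by (intro order.trans[OF _ lower[OF t_in]]) auto
    then have "0 \<le> V'' t" using t_in T by (simp add: zero_le_mult_iff)
    moreover have "0 \<le> V m * l" using Vm v l by simp
    ultimately show ?thesis by simp
  next
    case False
    have "- l \<le> ln (V t)"
    proof -
      have "- l = ln (V 0 / 2)" using v by (simp add: l_def ln_div)
      also have "\<dots> \<le> ln (V t)" using Vt v by (simp add: ln_mono)
      finally show ?thesis .
    qed
    then have "V t * (- ln (V t)) \<le> V m * l"
      using Vt v l False by (intro mult_mono) auto
    moreover have "V t * (- ln (V t)) = - (V t * ln (V t))" by simp
    ultimately have "- 4 * (V m * l) \<le> 4 * (V t * ln (V t))" by argo
    also have "\<dots> = 4 * V t * ln (V t)" by (simp only: mult.assoc)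
    also have "\<dots> \<le> V'' t * (1 - t)\<^sup>2" using lower[OF t_in] Vt v by simp
    finally have le: "- 4 * (V m * l) \<le> V'' t * (1 - t)\<^sup>2" .
    have q: "(1 - t)\<^sup>2 \<ge> 1/2"
    proof -
      have "(15/16)\<^sup>2 \<le> (1 - t)\<^sup>2" using t_in T by (intro power_mono) auto
      then show ?thesis by (simp add: power2_eq_square)
    qed
    show ?thesis
    proof (rule ccontr)
      assume "\<not> V'' t \<ge> - 8 * (V m * l)"
      then have lt: "V'' t < - 8 * (V m * l)" by simp
      then have "V'' t * (1 - t)\<^sup>2 \<le> V'' t * (1/2)"
        using q l Vm v by (intro mult_left_mono_neg) (auto intro: order.trans[of _ "- 8 * (V m * l)"] less_imp_le)
      then show False using le lt by simp
    qed
  qed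
  have d: "0 \<le> e - m" "e - m \<le> T" using me e_in by auto
  have "(e - m)\<^sup>2 \<le> T\<^sup>2" using d by (intro power_mono)
  then have "4 * (V m * l) * (e - m)\<^sup>2 \<le> 4 * (V m * l) * T\<^sup>2"
    using l Vm v by (intro mult_left_mono) auto
  also have "\<dots> = 4 * V m * (l * T\<^sup>2)" by (simp add: mult_ac)
  also have "\<dots> \<le> 4 * V m * (1/16)"
    using T2 Vm v by (intro mult_left_mono) (auto simp: l_def)
  finally have b1: "4 * (V m * l) * (e - m)\<^sup>2 \<le> V m / 4" by simp
  have "- 8 * (V m * l) / 2 * (e - m)\<^sup>2 \<le> V'' t / 2 * (e - m)\<^sup>2"
    using V''t by (intro mult_right_mono divide_right_mono) auto
  moreover have "- 8 * (V m * l) / 2 * (e - m)\<^sup>2 = - (4 * (V m * l) * (e - m)\<^sup>2)" by simp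
  ultimately have b2: "V e \<ge> V m + V' m * (e - m) - V m / 4"
    using t(3) b1 by argo
  \<comment> \<open>Only a maximum at the left end can have a nonzero slope, and then
    \<open>T1\<close> controls it.\<close>
  have "V' m * (e - m) \<ge> - (V m / 8)"
  proof (cases "m = 0")
    case True
    have "\<bar>V' 0\<bar> * (e - m) \<le> \<bar>V' 0\<bar> * T" using d by (intro mult_left_mono) auto
    moreover have "- \<bar>V' m\<bar> * (e - m) \<le> V' m * (e - m)"
      using d by (intro mult_right_mono) auto
    ultimately show ?thesis using T1 True by simp
  next
    case False
    have "V' m = 0"
    proof (rule DERIV_local_max[of V _ m "min m (e - m)"])
      show "(V has_real_derivative V' m) (at m)" using D1 me e_in by simp
      show "0 < min m (e - m)" using False me by simp
      show "\<forall>y. \<bar>m - y\<bar> < min m (e - m) \<longrightarrow> V y \<le> V m"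
      proof (intro allI impI)
        fix y assume "\<bar>m - y\<bar> < min m (e - m)"
        then have "0 \<le> y" "y \<le> e" by (auto simp: abs_less_iff)
        then show "V y \<le> V m" using m(2) by auto
      qed
    qed
    then show ?thesis using Vm v by simp
  qed
  \<comment> \<open>The losses 1/4 and 1/8 leave \<open>V e \<ge> 5/8 * V m\<close>, more than
    \<open>V 0 / 2\<close>.\<close>
  then show False using b2 e_in Vm v by argo
qed

text \<open>The form starts at the product of the means, ends below the mean of the product, and
  meanwhile grows at least at rate \<open>m1 / 2\<close> up to time \<open>T / 2\<close>. The
  resulting gain \<open>m1 * T / 4\<close> with \<open>T = 1 / (32 * sqrt L)\<close> gives the
  constant 1/128; the other choice of \<open>T\<close> gives 1/16.\<close>

lemma correlation_lower_bound:
  assumes f: "unit_fun n f" "increasing_Rn n f" and g: "unit_fun n g" "increasing_Rn n g"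
  defines "m1 \<equiv> (\<Sum>i<n. herm1 n f i * herm1 n g i)"
    and "m2 \<equiv> (\<Sum>i<n. \<Sum>j<n. herm2 n f i j * herm2 n g i j)"
    and "cor \<equiv> (\<integral>x. f x * g x \<partial>gauss n) - (\<integral>x. f x \<partial>gauss n) * (\<integral>x. g x \<partial>gauss n)"
  shows "cor \<ge> 0" "m1 \<ge> 0" "m1 > 0 \<Longrightarrow> 1/128 * (m1 / sqrt (ln (exp 1 / m1))) \<le> cor \<or> (m2 \<noteq> 0 \<and> 1/128 * (m1\<^sup>2 / \<bar>m2\<bar>) \<le> cor)"
proof -
  show "cor \<ge> 0" unfolding cor_def using harris_inequality_gauss[OF f(1) g(1) f(2) g(2)] by simp
  show "m1 \<ge> 0" unfolding m1_def by (intro sum_nonneg mult_nonneg_nonneg herm1_nonneg f g) auto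
  assume m1: "m1 > 0"
  have "m1 \<le> (\<Sum>i<n. ((herm1 n f i)\<^sup>2 + (herm1 n g i)\<^sup>2) / 2)"
    unfolding m1_def
  proof (rule sum_mono)
    fix i
    show "herm1 n f i * herm1 n g i \<le> ((herm1 n f i)\<^sup>2 + (herm1 n g i)\<^sup>2) / 2"
      using sum_squares_bound[of "herm1 n f i" "herm1 n g i"] by simp
  qed
  also have "\<dots> \<le> 1"
  proof -
    have "(\<Sum>i<n. (herm1 n w i)\<^sup>2) \<le> 1" if w: "unit_fun n w" for w
      using bessel_inequality_gauss[OF unit_funD[OF w]] unit_fun_integral_le[OF unit_fun_mult[OF w w]]
      unfolding herm1_def by (simp add: power2_eq_square)
    from this[OF f(1)] this[OF g(1)] show ?thesis
      by (simp add: sum_divide_distrib[symmetric] sum.distrib)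
  qed
  finally have m1_le: "m1 \<le> 1" .
  define V where "V = vform n f g"
  define L where "L = ln (exp 1 / m1)"
  have L: "L = 1 - ln m1" using m1 by (simp add: L_def ln_div)
  have L1: "L \<ge> 1" using m1 m1_le by (simp add: L)
  have V0: "V 0 = m1 / 2"
    using mform'_eq_vform[OF f(1) g(1), of 0] mform_zero(2)[OF f(1) g(1)] by (simp add: V_def m1_def)
  \<comment> \<open>From differentiating \<open>mform' t = 2 * vform (2 * t)\<close> at 0, where the
    identity is known to the right only.\<close>
  have V'0: "vform' n f g 0 = m2 / 4"
  proof -
    have "((\<lambda>t. mform' n f g t - 2 * vform n f g (2 * t)) has_real_derivative mform'' n f g 0 - 2 * (vform' n f g 0 * 2)) (at 0)"
    proof (intro DERIV_diff DERIV_cmult)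
      show "(mform' n f g has_real_derivative mform'' n f g 0) (at 0)"
        by (rule DERIV_mform(2)[OF f(1) g(1)]) simp
      have "(vform n f g has_real_derivative vform' n f g (2 * 0)) (at (2 * 0))"
        using DERIV_vform(1)[OF f(1) g(1), of 0] by simp
      moreover have "((\<lambda>t::real. 2 * t) has_real_derivative 2) (at 0)"
        by (auto intro!: derivative_eq_intros)
      ultimately show "((\<lambda>t. vform n f g (2 * t)) has_real_derivative vform' n f g 0 * 2) (at 0)"
        using DERIV_chain2[of "vform n f g" "vform' n f g (2 * 0)" "\<lambda>t. 2 * t" 0 2] by simp
    qed
    from DERIV_eq_zero_right[OF this, of "1/16"] mform'_eq_vform[OF f(1) g(1)]
    have "mform'' n f g 0 = 4 * vform' n f g 0" by simp
    then show ?thesis using mform_zero(3)[OF f(1) g(1)] by (simp add: m2_def)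
  qed
  \<comment> \<open>The first bound keeps \<open>ln (2 / V 0) * T\<^sup>2\<close> small, using
    \<open>ln (2 / V 0) \<le> 2 * L\<close>, and also gives \<open>T \<le> 1/32\<close>. The second
    is exactly what makes the initial slope \<open>m2 / 4\<close> lose at most
    \<open>V 0 / 8\<close>.\<close>
  define T where "T = (if m2 = 0 then 1 / (32 * sqrt L) else min (1 / (32 * sqrt L)) (m1 / (4 * \<bar>m2\<bar>)))"
  have sL: "sqrt L \<ge> 1" using L1 by simp
  have T0: "T > 0" using sL m1 by (auto simp: T_def)
  have TL: "T \<le> 1 / (32 * sqrt L)" by (auto simp: T_def)
  also have "\<dots> \<le> 1 / 32" using sL by (simp add: divide_simps)
  finally have T32: "T \<le> 1/32" .
  have Tm: "\<bar>m2\<bar> * T \<le> m1 / 4"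
  proof (cases "m2 = 0")
    case False
    then have "\<bar>m2\<bar> * T \<le> \<bar>m2\<bar> * (m1 / (4 * \<bar>m2\<bar>))" by (intro mult_left_mono) (auto simp: T_def)
    then show ?thesis using False by simp
  qed (use m1 in simp)
  have V_lower: "V s \<ge> m1 / 4" if "0 \<le> s" "s \<le> T" for s
  proof -
    have "V s \<ge> V 0 / 2"
    proof (rule second_order_persistence[where T=T and V'="vform' n f g" and V''="vform'' n f g"])
      show "(V has_real_derivative vform' n f g s) (at s)" "(vform' n f g has_real_derivative vform'' n f g s) (at s)"
        if "0 \<le> s" "s \<le> T" for s
        using that T32 unfolding V_def by (auto intro!: DERIV_vform f g)
      show "4 * V s * ln (V s) \<le> vform'' n f g s * (1 - s)\<^sup>2" if "0 \<le> s" "s \<le> T" "V s > 0" for s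
        using vform''_lower_bound[OF f g] that T32 by (simp add: V_def)
      show "ln (2 / V 0) * T\<^sup>2 \<le> 1/16"
      proof -
        have "ln (2 / V 0) = ln 4 - ln m1" using m1 by (simp add: V0 ln_div)
        also have "ln 4 \<le> (2::real)"
        proof -
          have "ln (4::real) = 2 * ln 2" using ln_realpow[of 2 2] by simp
          then show ?thesis using ln_le_minus_one[of "2::real"] by simp
        qed
        finally have "ln (2 / V 0) \<le> 2 - ln m1" by simp
        moreover have "ln m1 \<le> 0" using m1 m1_le by simp
        ultimately have "ln (2 / V 0) \<le> 2 * L" unfolding L by argo
        moreover have "T\<^sup>2 \<le> (1 / (32 * sqrt L))\<^sup>2" using TL T0 by (intro power_mono) auto
        ultimately have "ln (2 / V 0) * T\<^sup>2 \<le> (2 * L) * (1 / (32 * sqrt L))\<^sup>2"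
          using L1 by (intro mult_mono) auto
        also have "\<dots> = 2 / 1024" using L1 by (simp add: power_divide power_mult_distrib)
        finally show ?thesis by simp
      qed
      show "\<bar>vform' n f g 0\<bar> * T \<le> V 0 / 8" using Tm by (simp add: V0 V'0 mult_ac)
    qed (use that T32 m1 m1_le V0 in auto)
    then show ?thesis by (simp add: V0)
  qed
  \<comment> \<open>\<open>mform'\<close> at \<open>t\<close> is twice \<open>V (2 * t)\<close>,
    hence at least \<open>m1 / 2\<close> as long as \<open>2 * t \<le> T\<close>.\<close>
  have "mform n f g 0 - m1 / 2 * 0 \<le> mform n f g (T / 2) - m1 / 2 * (T / 2)"
  proof (rule DERIV_nonneg_imp_nondecreasing[where f="\<lambda>t. mform n f g t - m1 / 2 * t"])
    show "0 \<le> T / 2" using T0 by simp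
    fix t assume t: "0 \<le> t" "t \<le> T / 2"
    have "((\<lambda>t. mform n f g t - m1 / 2 * t) has_real_derivative mform' n f g t - m1 / 2) (at t)"
      by (intro DERIV_diff DERIV_mform(1) f g DERIV_cmult_Id) (use t T32 in auto)
    moreover have "mform' n f g t - m1 / 2 \<ge> 0"
      using mform'_eq_vform[OF f(1) g(1), of t] V_lower[of "2 * t"] t T32 by (simp add: V_def)
    ultimately show "\<exists>y. ((\<lambda>t. mform n f g t - m1 / 2 * t) has_real_derivative y) (at t) \<and> 0 \<le> y" by blast
  qed
  moreover have "mform n f g (T / 2) \<le> (\<integral>x. f x * g x \<partial>gauss n)"
    by (rule mform_le_integral_mult[OF f g]) (use T0 T32 in auto)
  ultimately have cor: "m1 * T / 4 \<le> cor"
    using mform_zero(1)[OF f(1) g(1)] by (simp add: cor_def)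
  show "1/128 * (m1 / sqrt (ln (exp 1 / m1))) \<le> cor \<or> (m2 \<noteq> 0 \<and> 1/128 * (m1\<^sup>2 / \<bar>m2\<bar>) \<le> cor)"
  proof (cases "T = 1 / (32 * sqrt L)")
    case True
    then show ?thesis using cor by (simp add: L_def)
  next
    case False
    then have T: "m2 \<noteq> 0" "T = m1 / (4 * \<bar>m2\<bar>)" by (auto simp: T_def min_def split: if_splits)
    have "1/128 * (m1\<^sup>2 / \<bar>m2\<bar>) \<le> 1/16 * (m1\<^sup>2 / \<bar>m2\<bar>)" by (intro mult_right_mono) auto
    also have "\<dots> = m1 * T / 4" unfolding T(2) by (simp add: power2_eq_square)
    finally show ?thesis using T(1) cor by simp
  qed
qed

theorem theorem7:
  "\<exists>c::real. c > 0 \<and>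
     (\<forall>n\<ge>1. \<forall>f g :: (nat \<Rightarrow> real) \<Rightarrow> real.
        f \<in> Rn n \<rightarrow> {0..1} \<longrightarrow> g \<in> Rn n \<rightarrow> {0..1} \<longrightarrow>
        increasing_Rn n f \<longrightarrow> increasing_Rn n g \<longrightarrow>
        ereal (Cor n f g)
          \<ge> ereal c * cor_bound (hermite1_inner n f g) (hermite2_inner n f g))"
proof (intro exI[of _ "1/128"] conjI allI impI)
  fix n :: nat and f g :: "(nat \<Rightarrow> real) \<Rightarrow> real"
  assume f: "f \<in> Rn n \<rightarrow> {0..1}" "increasing_Rn n f" and g: "g \<in> Rn n \<rightarrow> {0..1}" "increasing_Rn n g"
  \<comment> \<open>The Borel versions are increasing everywhere, not merely almost everywhere, so
    Harris' inequality applies to them; all integrals over the completion agree with theirs.\<close>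
  obtain f' where f': "unit_fun n f'" "increasing_Rn n f'" and aef: "AE x in gauss n. f x = f' x"
    by (rule increasing_Rn_AE_borel[OF f(2,1)])
  obtain g' where g': "unit_fun n g'" "increasing_Rn n g'" and aeg: "AE x in gauss n. g x = g' x"
    by (rule increasing_Rn_AE_borel[OF g(2,1)])
  note [measurable] = unit_funD(1)[OF f'(1)] unit_funD(1)[OF g'(1)]
  have h1: "hermite1 n k i = herm1 n k' i" if "unit_fun n k'" "AE x in gauss n. k x = k' x" and [measurable]: "i < n" for k k' i
    unfolding hermite1_def herm1_def std_gaussian_eq
    by (rule integral_completion_AE[OF _ unit_funD(1)[OF that(1)] that(2)]) measurable
  have h2: "hermite2 n k i j = herm2 n k' i j" if "unit_fun n k'" "AE x in gauss n. k x = k' x" and [measurable]: "i < n" "j < n" for k k' i j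
    unfolding hermite2_def herm2_def std_gaussian_eq
    by (rule integral_completion_AE[OF _ unit_funD(1)[OF that(1)] that(2)]) measurable
  have int: "(\<integral>x. k x \<partial>std_gaussian n) = (\<integral>x. k' x \<partial>gauss n)" if "k' \<in> borel_measurable (gauss n)" "AE x in gauss n. k x = k' x" for k k' :: "(nat \<Rightarrow> real) \<Rightarrow> real"
    using integral_completion_AE[of "\<lambda>_. 1" "gauss n" k' k] that by (simp add: std_gaussian_eq)
  define m1 where "m1 = (\<Sum>i<n. herm1 n f' i * herm1 n g' i)"
  define m2 where "m2 = (\<Sum>i<n. \<Sum>j<n. herm2 n f' i j * herm2 n g' i j)"
  define cor where "cor = (\<integral>x. f' x * g' x \<partial>gauss n) - (\<integral>x. f' x \<partial>gauss n) * (\<integral>x. g' x \<partial>gauss n)"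
  have m1: "hermite1_inner n f g = m1"
    unfolding hermite1_inner_def m1_def
    by (intro sum.cong refl) (simp add: h1[OF f'(1) aef] h1[OF g'(1) aeg])
  have m2: "hermite2_inner n f g = m2"
    unfolding hermite2_inner_def m2_def
    by (intro sum.cong refl) (simp add: h2[OF f'(1) aef] h2[OF g'(1) aeg])
  have "AE x in gauss n. f x * g x = f' x * g' x"
    using aef aeg by eventually_elim simp
  then have cor: "Cor n f g = cor"
    unfolding Cor_def cor_def by (simp add: int[OF _ aef] int[OF _ aeg] int)
  note B = correlation_lower_bound[OF f' g', folded m1_def m2_def cor_def]
  show "ereal (1/128) * cor_bound (hermite1_inner n f g) (hermite2_inner n f g) \<le> ereal (Cor n f g)"
  proof (cases "m1 = 0")
    case True
    then show ?thesis using B(1) by (simp add: m1 cor cor_bound_def)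
  next
    case False
    let ?a = "m1 / sqrt (ln (exp 1 / m1))"
    have disj: "1/128 * ?a \<le> cor \<or> (m2 \<noteq> 0 \<and> 1/128 * (m1\<^sup>2 / \<bar>m2\<bar>) \<le> cor)"
      using B(2,3) False by simp
    show ?thesis
    proof (cases "m2 = 0")
      case True
      then show ?thesis using disj False by (simp add: m1 m2 cor cor_bound_def)
    next
      case nz: False
      have "1/128 * min ?a (m1\<^sup>2 / \<bar>m2\<bar>) \<le> cor"
        using disj by (auto intro: order.trans[OF mult_left_mono])
      moreover have "cor_bound m1 m2 = ereal (min ?a (m1\<^sup>2 / \<bar>m2\<bar>))"
        using False nz by (simp add: cor_bound_def min_def)
      ultimately show ?thesis by (simp only: m1 m2 cor times_ereal.simps ereal_less_eq)
    qed
  qed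
qed simp

end
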